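(* Let $d\ge 3$. For integers $J\ge 1$, $I\ge 1$ and a non-empty compact set $A\subseteq\mathbb{R}^d$, define $$\Phi_{J,I,A}=\sup_{\ell_*\ge 0}\ \sup_{U_0\in\mathcal{U}_{\ell_*,A}}\ \sup_{L\ge L(J)}\ \sup_{x\in A} P_x[H_{\mathrm{Res}}=\infty],\qquad \Phi_{J,I}=\Phi_{J,I,\{0\}},$$ where $\mathrm{Res}=\mathrm{Res}(U_0,\ell_*,J,L,I)$ and $\ell_*$ ranges over non-negative integers, $L$ over integers. Then $\Phi_{J,I,A}\le \Phi_{J,I}$, and there is a constant $c_2(J)\in(0,1)$ depending only on $d$ and $J$ such that $$\limsup_{I\to\infty} I^{-1/2^{J-1}}\log \Phi_{J,I}\le \log\big(1-c_2(J)\big)\ (<0).$$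
   Context: $|\cdot|_\infty$ is the sup-norm on $\mathbb{R}^d$, $B(x,r)$ the closed sup-norm ball of center $x$ and radius $r$, $|\cdot|$ Lebesgue measure. $P_x$ is Wiener measure (law of canonical Brownian motion $X$ on $\mathbb{R}^d$ started at $x$); for closed $F$, $H_F=\inf\{s\ge0: X_s\in F\}$. For a non-empty bounded Borel set $U_0\subseteq\mathbb{R}^d$ with complement $U_1=\mathbb{R}^d\setminus U_0$, and $\ell\in\mathbb{Z}$, set $\widehat\sigma_\ell(x)=|B(x,2^{-\ell})\cap U_1|/|B(x,2^{-\ell})|$ and $\widetilde\sigma_\ell(x)=|B(x,4\cdot 2^{-\ell})\cap U_1|/|B(x,4\cdot 2^{-\ell})|$. Let $\widetilde\alpha=\frac13 4^{-d}$. For a non-empty compact $A$ and integer $\ell_*\ge0$, $\mathcal{U}_{\ell_*,A}$ is the collection of non-empty bounded Borel $U_0$ with $\widehat\sigma_\ell(x)\le\frac12$ for all $x\in A$ and all integers $\ell\ge\ell_*$. Let $c_0=d2^{d-1}$ and, for $J\ge1$, $L(J)$ the smallest integer $L\ge5$ with $c_0 2^{-L}\le(200J)^{-1}$. With $\mathbb{N}=\{0,1,2,\dots\}$, for $J\ge1$, integer $L\ge L(J)$, $I\ge1$, set $\ell_0=\inf\{\ell\in (J+1)L\mathbb{N}:\ell\ge\ell_*\}$, $\mathcal{A}_*=\{\ell\in L\mathbb{N}: \ell_0\le\ell<\ell_0+I(J+1)L\}$, and the resonance set $\mathrm{Res}(U_0,\ell_*,J,L,I)=\{x\in\mathbb{R}^d: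 \sum_{\ell\in\mathcal{A}_*}1\{\widetilde\sigma_\ell(x)\in[\widetilde\alpha,1-\widetilde\alpha]\}\ge J\}$. *)

theory Defs
  imports "HOL-Analysis.Analysis" "HOL-Probability.Probability"
begin

definition BM_family ::
  "(real^'n \<Rightarrow> 'w measure) \<Rightarrow> (real^'n \<Rightarrow> real \<Rightarrow> 'w \<Rightarrow> real^'n) \<Rightarrow> bool" where
  "BM_family M X \<longleftrightarrow> (\<forall>x.
     prob_space (M x) \<and>
     (\<forall>t\<ge>0. X x t \<in> borel_measurable (M x)) \<and>
     (\<forall>\<omega>\<in>space (M x). X x 0 \<omega> = x \<and> continuous_on {0..} (\<lambda>t. X x t \<omega>)) \<and>
     (\<forall>(ts::nat \<Rightarrow> real) k. 0 \<le> ts 0 \<and> (\<forall>i<k. ts i < ts (Suc i)) \<longrightarrow>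
        prob_space.indep_vars (M x) (\<lambda>_. borel)
          (\<lambda>i \<omega>. X x (ts (Suc i)) \<omega> - X x (ts i) \<omega>) {..<k}) \<and>
     (\<forall>s t. 0 \<le> s \<and> s < t \<longrightarrow>
        prob_space.indep_vars (M x) (\<lambda>_. borel) (\<lambda>i \<omega>. (X x t \<omega> - X x s \<omega>) $ i) UNIV \<and>
        (\<forall>i. distributed (M x) lborel (\<lambda>\<omega>. (X x t \<omega> - X x s \<omega>) $ i)
                (normal_density 0 (sqrt (t - s))))))"

definition nohit_prob ::
  "(real^'n \<Rightarrow> 'w measure) \<Rightarrow> (real^'n \<Rightarrow> real \<Rightarrow> 'w \<Rightarrow> real^'n) \<Rightarrow> (real^'n) set \<Rightarrow> real^'n \<Rightarrow> real" where
  "nohit_prob M X F x = measure (M x) {\<omega>\<in>space (M x). \<forall>s\<ge>0. X x s \<omega> \<notin> F}"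

definition supball :: "real^'n \<Rightarrow> real \<Rightarrow> (real^'n) set" where
  "supball x r = {y. \<forall>i. \<bar>y $ i - x $ i\<bar> \<le> r}"

definition sigma_hat :: "(real^'n) set \<Rightarrow> int \<Rightarrow> real^'n \<Rightarrow> real" where
  "sigma_hat U0 l x = measure lebesgue (supball x (2 powr (- real_of_int l)) \<inter> (- U0))
                      / measure lebesgue (supball x (2 powr (- real_of_int l)))"

definition sigma_tilde :: "(real^'n) set \<Rightarrow> int \<Rightarrow> real^'n \<Rightarrow> real" where
  "sigma_tilde U0 l x = measure lebesgue (supball x (4 * 2 powr (- real_of_int l)) \<inter> (- U0))
                      / measure lebesgue (supball x (4 * 2 powr (- real_of_int l)))"

definition alpha_tilde :: "nat \<Rightarrow> real" where
  "alpha_tilde d = (1/3) * 4 powr (- real d)"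

definition Ucal :: "nat \<Rightarrow> (real^'n) set \<Rightarrow> (real^'n) set set" where
  "Ucal lstar A = {U0. U0 \<noteq> {} \<and> bounded U0 \<and> U0 \<in> sets borel \<and>
      (\<forall>x\<in>A. \<forall>l::int. l \<ge> int lstar \<longrightarrow> sigma_hat U0 l x \<le> 1/2)}"

definition c0 :: "nat \<Rightarrow> real" where
  "c0 d = real d * 2 ^ (d - 1)"

definition LJ :: "nat \<Rightarrow> nat \<Rightarrow> nat" where
  "LJ d J = (LEAST L::nat. 5 \<le> L \<and> c0 d * 2 powr (- real L) \<le> 1 / (200 * real J))"

definition ell0 :: "nat \<Rightarrow> nat \<Rightarrow> nat \<Rightarrow> nat" where
  "ell0 lstar J L = (LEAST l::nat. (J + 1) * L dvd l \<and> lstar \<le> l)"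

definition Astar :: "nat \<Rightarrow> nat \<Rightarrow> nat \<Rightarrow> nat \<Rightarrow> nat set" where
  "Astar lstar J L I = {l. L dvd l \<and> ell0 lstar J L \<le> l \<and> l < ell0 lstar J L + I * (J + 1) * L}"

definition Res :: "(real^'n) set \<Rightarrow> nat \<Rightarrow> nat \<Rightarrow> nat \<Rightarrow> nat \<Rightarrow> (real^'n) set" where
  "Res U0 lstar J L I = {x. card {l \<in> Astar lstar J L I.
       alpha_tilde CARD('n) \<le> sigma_tilde U0 (int l) x \<and>
       sigma_tilde U0 (int l) x \<le> 1 - alpha_tilde CARD('n)} \<ge> J}"

definition Phi ::
  "(real^'n \<Rightarrow> 'w measure) \<Rightarrow> (real^'n \<Rightarrow> real \<Rightarrow> 'w \<Rightarrow> real^'n) \<Rightarrow> nat \<Rightarrow> nat \<Rightarrow> (real^'n) set \<Rightarrow> real" where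
  "Phi M X J I A = Sup {nohit_prob M X (Res U0 lstar J L I) x | lstar U0 L x.
       U0 \<in> Ucal lstar A \<and> L \<ge> LJ CARD('n) J \<and> x \<in> A}"

definition eln :: "real \<Rightarrow> ereal" where
  "eln y = (if y = 0 then -\<infinity> else ereal (ln y))"

end

theory Submission
  imports Defs "HOL-Real_Asymp.Real_Asymp"
begin

text \<open>Along a time grid \<open>4\<^sup>-\<^sup>n\<close> the path is a random walk with Gaussian steps. If \<open>\<sigma>\<close> is balanced
  at the top scale \<open>l\<close> of a block, then with probability bounded below the walk moves on to points where
  one further scale of the block after the other is balanced, before \<open>l\<close> stops being resonant; then it has hit
  the resonance set. Each of the \<open>I\<close> blocks gives such a trial. As long as the resonance set is avoided, fewer than \<open>J\<close>
  trials are active at the same time, since an active trial makes its top scale resonant. If \<open>S\<close> denotes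
  the set of started trials and \<open>g\<^sub>i\<close> the conditional success probability of the trial \<open>i\<close>, this
  overlap bound makes \<open>(1 - c / J)\<close> to the power \<open>- card S\<close>, times
  \<open>1 - (\<Sum>i\<in>S. g\<^sub>i) / J\<close>, a supermartingale while the resonance set is avoided.
  Every trial is started before the path leaves \<open>U\<^sub>0\<close> for good, so the avoidance probability
  is at most \<open>(1 - c / J) ^ I\<close>, which is stronger than the claim.\<close>

section \<open>Densities at a scale\<close>

text \<open>The obstacle is the overlap of the trials: they may start in any order, several at once,
  and while others are still running, so they cannot be conditioned on one after the other. The
  potential in the supermartingale needs only the bound on how many run simultaneously. The time
  grid replaces stopping times and the strong Markov property: a path becomes a point of a finite
  product of Gaussian laws, hitting probabilities are given by a first-step recursion, and the
  supermartingale property is Fubini in the last step. A path that misses the resonance set misses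
  it at grid times too, so discretising costs only two small events: some step is long, or the path
  is still close to \<open>U0\<close> at a late time. Uniformity in \<open>U0\<close>,
  \<open>lstar\<close> and \<open>L\<close> comes from scaling. A stage at scale \<open>r\<close>
  lasts time \<open>r\<^sup>2\<close> and stays in a box of size \<open>2 * r\<close>, so its
  success probability is bounded below in terms of the dimension and \<open>J\<close> alone; only
  the mesh of the grid depends on the rest.\<close>

definition dens :: "(real^'n) set \<Rightarrow> real \<Rightarrow> real^'n \<Rightarrow> real" where
  "dens W r x = measure lborel (supball x r \<inter> W) / (2 * r) ^ CARD('n)"

lemma supball_eq_cbox: "supball x r = cbox (\<chi> i. x $ i - r) (\<chi> i. x $ i + r)"
  unfolding supball_def by (auto simp: mem_box_cart abs_le_iff algebra_simps; smt (verit))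

lemma supball_sym: "y \<in> supball x r \<longleftrightarrow> x \<in> supball y r"
  by (simp add: supball_def abs_minus_commute)

lemma supball_mono: "y \<in> supball x r \<Longrightarrow> r \<le> s \<Longrightarrow> y \<in> supball x s"
  by (auto simp: supball_def intro: order_trans)

lemma supball_trans:
  assumes "y \<in> supball x r" "z \<in> supball y s"
  shows "z \<in> supball x (r + s)"
  unfolding supball_def
proof (intro CollectI allI)
  fix i
  have "\<bar>y $ i - x $ i\<bar> \<le> r" "\<bar>z $ i - y $ i\<bar> \<le> s" using assms by (auto simp: supball_def)
  then show "\<bar>z $ i - x $ i\<bar> \<le> r + s" by linarith
qed

lemma supball_borel [measurable, simp]: "supball x r \<in> sets borel"
  by (simp add: supball_eq_cbox)

lemma supball_fmeasurable [simp]: "supball x r \<in> fmeasurable lborel"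
  by (simp add: supball_eq_cbox fmeasurable_cbox)

lemma measure_supball:
  fixes x :: "real^'n"
  assumes "0 \<le> r"
  shows "measure lborel (supball x r) = (2 * r) ^ CARD('n)"
proof -
  have ne: "supball x r \<noteq> {}" using assms by (auto simp: supball_def intro!: exI[of _ x])
  then show ?thesis
    using content_cbox_cart[of "\<chi> i. x $ i - r" "\<chi> i. x $ i + r"]
    by (simp add: supball_eq_cbox)
qed

lemma supball_Int_fmeasurable:
  "W \<in> sets borel \<Longrightarrow> supball x r \<inter> W \<in> fmeasurable lborel"
  by (rule fmeasurable_Int_fmeasurable) auto

lemma sigma_hat_eq_dens:
  fixes U0 :: "(real^'n) set"
  assumes "U0 \<in> sets borel"
  shows "sigma_hat U0 l x = dens (- U0) (2 powr (- real_of_int l)) x"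
  using assms measure_supball[of "2 powr (- real_of_int l)" x] by (simp add: sigma_hat_def dens_def)

lemma sigma_tilde_eq_dens:
  fixes U0 :: "(real^'n) set"
  assumes "U0 \<in> sets borel"
  shows "sigma_tilde U0 l x = dens (- U0) (4 * 2 powr (- real_of_int l)) x"
  using assms measure_supball[of "4 * 2 powr (- real_of_int l)" x] by (simp add: sigma_tilde_def dens_def)

lemma dens_nonneg: "0 < r \<Longrightarrow> 0 \<le> dens W r x"
  by (simp add: dens_def)

lemma dens_compl:
  fixes x :: "real^'n"
  assumes "0 < r" "W \<in> sets borel"
  shows "dens (- W) r x = 1 - dens W r x"
proof -
  have "measure lborel (supball x r) = measure lborel (supball x r \<inter> W) + measure lborel (supball x r - W)"
    using measure_Un2[of "supball x r \<inter> W" lborel "supball x r"] supball_Int_fmeasurable[OF assms(2), of x r]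
    by (simp add: Un_absorb1 Diff_Int_distrib2 Diff_Int)
  then have "measure lborel (supball x r \<inter> - W) = (2 * r) ^ CARD('n) - measure lborel (supball x r \<inter> W)"
    using assms by (simp add: measure_supball Diff_eq)
  then show ?thesis using assms by (simp add: dens_def diff_divide_distrib)
qed

lemma dens_le_1:
  assumes "0 < r" "W \<in> sets borel"
  shows "dens W r x \<le> 1"
  using dens_compl[OF assms, of x] dens_nonneg[OF assms(1), of "- W" x] by simp

text \<open>Moving the centre by \<open>e\<close> adds at most the shell between radii
  \<open>r\<close> and \<open>r + e\<close>, whose volume relative to the ball is
  \<open>(1 + e / r) ^ CARD('n) - 1\<close>.\<close>

lemma dens_shift_le:
  fixes x y :: "real^'n"
  assumes "0 < r" "0 \<le> e" "W \<in> sets borel" and near: "y \<in> supball x e"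
  shows "dens W r y \<le> dens W r x + ((1 + e / r) ^ CARD('n) - 1)"
proof -
  have big: "supball y r \<subseteq> supball x (r + e)"
    using supball_trans[OF near] by (auto simp: add.commute[of r])
  have sub: "supball x r \<subseteq> supball x (r + e)"
    using assms by (auto intro: supball_mono)
  have "measure lborel (supball y r \<inter> W) \<le> measure lborel ((supball x r \<inter> W) \<union> (supball x (r + e) - supball x r))"
    using big assms by (intro measure_mono_fmeasurable) (auto intro!: fmeasurable.Un supball_Int_fmeasurable fmeasurable_Diff)
  also have "\<dots> \<le> measure lborel (supball x r \<inter> W) + measure lborel (supball x (r + e) - supball x r)"
    using assms by (intro measure_Un_le) auto
  also have "measure lborel (supball x (r + e) - supball x r) = (2 * (r + e)) ^ CARD('n) - (2 * r) ^ CARD('n)"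
    using assms sub by (subst measure_Diff) (auto simp: measure_supball fmeasurableD2)
  finally have "dens W r y \<le> (measure lborel (supball x r \<inter> W) + ((2 * (r + e)) ^ CARD('n) - (2 * r) ^ CARD('n))) / (2 * r) ^ CARD('n)"
    using assms by (simp add: dens_def divide_right_mono)
  also have "\<dots> = dens W r x + ((2 * (r + e)) ^ CARD('n) / (2 * r) ^ CARD('n) - 1)"
    using assms by (simp add: dens_def add_divide_distrib diff_divide_distrib)
  also have "(2 * (r + e)) ^ CARD('n) / (2 * r) ^ CARD('n) = (1 + e / r) ^ CARD('n)"
  proof -
    have "1 + e / r = (2 * (r + e)) / (2 * r)" using assms by (simp add: field_simps)
    then show ?thesis by (simp only: power_divide)
  qed
  finally show ?thesis .
qed

lemma dens_shift:
  fixes x y :: "real^'n"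
  assumes "0 < r" "0 \<le> e" "W \<in> sets borel" and near: "y \<in> supball x e"
  shows "\<bar>dens W r y - dens W r x\<bar> \<le> (1 + e / r) ^ CARD('n) - 1"
proof -
  have "x \<in> supball y e" using near by (auto simp: supball_def abs_minus_commute)
  then show ?thesis using dens_shift_le[OF assms] dens_shift_le[OF assms(1-3), of x y] by linarith
qed

lemma dist_imp_in_supball: "dist x y \<le> e \<Longrightarrow> y \<in> supball x e"
  unfolding supball_def dist_norm
  using component_le_norm_cart[of "y - x"] by (auto simp: norm_minus_commute) (meson order_trans)

text \<open>The shift bound does not involve the centre, so one step size serves all positions. This
  is what keeps a walk with short steps from leaping over a strip of density levels.\<close>

lemma dens_uniform:
  assumes "0 < r" "W \<in> sets borel" "0 < \<eta>"
  obtains e where "0 < e" "\<And>x y :: real^'n. y \<in> supball x e \<Longrightarrow> \<bar>dens W r y - dens W r x\<bar> \<le> \<eta>"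
proof -
  have "((\<lambda>e. (1 + e / r) ^ CARD('n) - 1) \<longlongrightarrow> (1 + 0 / r) ^ CARD('n) - 1) (at_right 0)"
    by (intro tendsto_intros) (use assms in auto)
  then have "eventually (\<lambda>e. (1 + e / r) ^ CARD('n) - 1 < \<eta>) (at_right 0)"
    by (rule order_tendstoD) (use assms in auto)
  then obtain b where b: "b > 0" "\<And>e. 0 < e \<Longrightarrow> e < b \<Longrightarrow> (1 + e / r) ^ CARD('n) - 1 < \<eta>"
    by (auto simp: eventually_at_right_field)
  show ?thesis
  proof (rule that[of "b/2"])
    show "\<bar>dens W r y - dens W r x\<bar> \<le> \<eta>" if "y \<in> supball x (b/2)" for x y :: "real^'n"
      using dens_shift[OF assms(1) _ assms(2) that] b(1) b(2)[of "b/2"] by simp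
  qed (use b in simp)
qed

lemma continuous_dens:
  assumes "0 < r" "W \<in> sets borel"
  shows "continuous_on UNIV (dens W r :: real^'n \<Rightarrow> real)"
proof -
  have "\<exists>d>0. \<forall>x'\<in>UNIV. dist x' x < d \<longrightarrow> dist (dens W r x') (dens W r x) < e" if "e > 0" for e and x :: "real^'n"
  proof -
    obtain d where d: "0 < d" "\<And>x y :: real^'n. y \<in> supball x d \<Longrightarrow> \<bar>dens W r y - dens W r x\<bar> \<le> e/2"
      using dens_uniform[OF assms, of "e/2"] \<open>e > 0\<close> by auto
    show ?thesis
      by (intro exI[of _ d]) (use d \<open>e > 0\<close> in \<open>force simp: dist_real_def dist_commute intro!: le_less_trans[OF d(2)] dist_imp_in_supball\<close>)
  qed
  then show ?thesis by (simp add: continuous_on_iff)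
qed

lemma borel_measurable_dens:
  assumes "0 < r" "W \<in> sets borel"
  shows "(dens W r :: real^'n \<Rightarrow> real) \<in> borel_measurable borel"
  using continuous_dens[OF assms] by (rule borel_measurable_continuous_onI)

text \<open>The small ball lies in the large one, so only the volume ratio is lost. With
  \<open>R = 4 * r\<close> this links the balls of \<open>sigma_hat\<close> to those of
  \<open>sigma_tilde\<close>.\<close>

lemma dens_enlarge:
  fixes x y :: "real^'n"
  assumes "0 < r" "r \<le> R" "W \<in> sets borel" and near: "y \<in> supball x (R - r)"
  shows "(r / R) ^ CARD('n) * dens W r x \<le> dens W R y"
proof -
  have "supball x r \<subseteq> supball y R"
    using supball_trans[OF near[unfolded supball_sym[of y]], of _ r] by simp (blast)
  then have "measure lborel (supball x r \<inter> W) \<le> measure lborel (supball y R \<inter> W)"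
    using assms by (intro measure_mono_fmeasurable supball_Int_fmeasurable) auto
  then show ?thesis using assms
    by (simp add: dens_def field_simps power_divide power_mult_distrib)
qed

section \<open>Averages of small-scale densities over a larger ball\<close>

lemma nn_integral_lborel_shift:
  fixes f :: "'a::euclidean_space \<Rightarrow> ennreal"
  assumes [measurable]: "f \<in> borel_measurable borel"
  shows "(\<integral>\<^sup>+ x. f (c + x) \<partial>lborel) = (\<integral>\<^sup>+ x. f x \<partial>lborel)"
proof -
  have "(\<integral>\<^sup>+ x. f x \<partial>lborel) = (\<integral>\<^sup>+ x. f x \<partial>distr lborel borel ((+) c))"
    by (simp add: lborel_distr_plus)
  then show ?thesis by (simp add: nn_integral_distr)
qed

lemma dens_times_volume:
  fixes x :: "real^'n"
  assumes "0 < r" "W \<in> sets borel"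
  shows "ennreal (dens W r x) * ennreal ((2 * r) ^ CARD('n)) = (\<integral>\<^sup>+ w. indicator (supball x r \<inter> W) w \<partial>lborel)"
  using assms supball_Int_fmeasurable[OF assms(2), of x r]
  by (simp add: dens_def ennreal_mult[symmetric] emeasure_eq_measure2 fmeasurableD2)

text \<open>Fubini, after substituting \<open>w = z + u\<close>.\<close>

lemma nn_integral_dens_swap:
  fixes x :: "real^'n"
  assumes "0 < r" "0 < s" and W[measurable]: "W \<in> sets borel"
  shows "(\<integral>\<^sup>+ z. ennreal (dens W s z) * indicator (supball x r) z \<partial>lborel) * ennreal ((2 * s) ^ CARD('n))
       = (\<integral>\<^sup>+ u. ennreal (dens W r (x + u)) * indicator (supball 0 s) u \<partial>lborel) * ennreal ((2 * r) ^ CARD('n))"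
proof -
  have ind[measurable]: "(\<lambda>(z, u). indicator W (z + u) :: ennreal) \<in> borel_measurable (borel \<Otimes>\<^sub>M borel)"
    by measurable
  have L: "ennreal (dens W s z) * ennreal ((2 * s) ^ CARD('n)) = (\<integral>\<^sup>+ u. indicator (supball 0 s) u * indicator W (z + u) \<partial>lborel)" for z :: "real^'n"
    unfolding dens_times_volume[OF assms(2) W]
    by (subst nn_integral_lborel_shift[symmetric, of _ z], simp)
       (auto intro!: nn_integral_cong simp: indicator_def supball_def)
  have R: "ennreal (dens W r (x + u)) * ennreal ((2 * r) ^ CARD('n)) = (\<integral>\<^sup>+ z. indicator (supball x r) z * indicator W (z + u) \<partial>lborel)" for u :: "real^'n"
    unfolding dens_times_volume[OF assms(1) W]
    by (subst nn_integral_lborel_shift[symmetric, of _ u], simp)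
       (auto intro!: nn_integral_cong simp: indicator_def supball_def algebra_simps)
  have [measurable]: "(dens W r :: real^'n \<Rightarrow> real) \<in> borel_measurable borel" "(dens W s :: real^'n \<Rightarrow> real) \<in> borel_measurable borel"
    by (auto intro!: borel_measurable_dens assms)
  have "(\<integral>\<^sup>+ z. ennreal (dens W s z) * indicator (supball x r) z \<partial>lborel) * ennreal ((2 * s) ^ CARD('n))
     = (\<integral>\<^sup>+ z. indicator (supball x r) z * (ennreal (dens W s z) * ennreal ((2 * s) ^ CARD('n))) \<partial>lborel)"
    by (subst nn_integral_multc[symmetric], measurable) (simp add: mult_ac)
  also have "\<dots> = (\<integral>\<^sup>+ z. \<integral>\<^sup>+ u. indicator (supball x r) z * (indicator (supball 0 s) u * indicator W (z + u)) \<partial>lborel \<partial>lborel)"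
    unfolding L by (intro nn_integral_cong nn_integral_cmult[symmetric]) measurable
  also have "\<dots> = (\<integral>\<^sup>+ u. \<integral>\<^sup>+ z. indicator (supball x r) z * (indicator (supball 0 s) u * indicator W (z + u)) \<partial>lborel \<partial>lborel)"
    by (rule lborel_pair.Fubini') measurable
  also have "\<dots> = (\<integral>\<^sup>+ u. \<integral>\<^sup>+ z. indicator (supball 0 s) u * (indicator (supball x r) z * indicator W (z + u)) \<partial>lborel \<partial>lborel)"
    by (simp add: mult_ac)
  also have "\<dots> = (\<integral>\<^sup>+ u. indicator (supball 0 s) u * (ennreal (dens W r (x + u)) * ennreal ((2 * r) ^ CARD('n))) \<partial>lborel)"
    unfolding R by (intro nn_integral_cong nn_integral_cmult) measurable
  also have "\<dots> = (\<integral>\<^sup>+ u. ennreal (dens W r (x + u)) * indicator (supball 0 s) u \<partial>lborel) * ennreal ((2 * r) ^ CARD('n))"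
    by (subst nn_integral_multc[symmetric], measurable) (simp add: mult_ac)
  finally show ?thesis .
qed

text \<open>Averaged over the ball of radius \<open>r\<close>, the density at scale \<open>s\<close>
  agrees with the one at scale \<open>r\<close> up to a shell. As densities are at most 1, this
  average is at most the fraction of good points plus \<open>lo\<close>.\<close>

lemma dens_fraction:
  fixes x :: "real^'n"
  assumes "0 < r" "0 < s" and W[measurable]: "W \<in> sets borel" and "0 \<le> lo"
  shows "(dens W r x - ((1 + s / r) ^ CARD('n) - 1) - lo) * (2 * r) ^ CARD('n)
           \<le> measure lborel (supball x r \<inter> {z. lo \<le> dens W s z})"
proof -
  \<comment> \<open>\<open>a\<close> is a lower bound for the density at scale \<open>r\<close>
    around every centre within \<open>s\<close> of \<open>x\<close>.\<close>
  define a where "a = dens W r x - ((1 + s / r) ^ CARD('n) - 1)"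
  define G where "G = {z :: real^'n. lo \<le> dens W s z}"
  have [measurable]: "(dens W r :: real^'n \<Rightarrow> real) \<in> borel_measurable borel" "(dens W s :: real^'n \<Rightarrow> real) \<in> borel_measurable borel"
    by (auto intro!: borel_measurable_dens assms)
  have G[measurable]: "G \<in> sets borel" unfolding G_def by measurable
  have "ennreal a * ennreal ((2 * s) ^ CARD('n)) * ennreal ((2 * r) ^ CARD('n))
      = (\<integral>\<^sup>+ u. ennreal a * indicator (supball (0::real^'n) s) u \<partial>lborel) * ennreal ((2 * r) ^ CARD('n))"
    using assms by (simp add: nn_integral_cmult emeasure_eq_measure2 fmeasurableD2 measure_supball)
  also have "\<dots> \<le> (\<integral>\<^sup>+ u. ennreal (dens W r (x + u)) * indicator (supball 0 s) u \<partial>lborel) * ennreal ((2 * r) ^ CARD('n))"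
  proof (rule mult_right_mono, rule nn_integral_mono)
    fix u :: "real^'n"
    have "a \<le> dens W r (x + u)" if "u \<in> supball 0 s"
    proof -
      have "x + u \<in> supball x s" using that by (auto simp: supball_def)
      from dens_shift[OF assms(1) _ W this] assms(2) show ?thesis unfolding a_def by linarith
    qed
    then show "ennreal a * indicator (supball 0 s) u \<le> ennreal (dens W r (x + u)) * indicator (supball 0 s) u"
      by (auto split: split_indicator intro: ennreal_leI)
  qed auto
  also have "\<dots> = (\<integral>\<^sup>+ z. ennreal (dens W s z) * indicator (supball x r) z \<partial>lborel) * ennreal ((2 * s) ^ CARD('n))"
    by (rule nn_integral_dens_swap[symmetric, OF assms(1-3)])
  also have "(\<integral>\<^sup>+ z. ennreal (dens W s z) * indicator (supball x r) z \<partial>lborel)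
     \<le> (\<integral>\<^sup>+ z. indicator (supball x r \<inter> G) z + ennreal lo * indicator (supball x r) z \<partial>lborel)"
  proof (intro nn_integral_mono)
    fix z :: "real^'n"
    show "ennreal (dens W s z) * indicator (supball x r) z \<le> indicator (supball x r \<inter> G) z + ennreal lo * indicator (supball x r) z"
    proof (cases "lo \<le> dens W s z")
      case True
      have "ennreal (dens W s z) \<le> 1"
        using dens_le_1[OF assms(2) W, of z] by (simp add: ennreal_le_1)
      with True show ?thesis
        by (auto simp: G_def split: split_indicator intro!: add_increasing2)
    next
      case False
      then show ?thesis by (auto simp: G_def split: split_indicator intro!: ennreal_leI)
    qed
  qed
  also have "\<dots> = ennreal (measure lborel (supball x r \<inter> G)) + ennreal lo * ennreal ((2 * r) ^ CARD('n))"
    using supball_Int_fmeasurable[OF G, of x r] assms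
    by (simp add: nn_integral_add nn_integral_cmult emeasure_eq_measure2 fmeasurableD2 measure_supball)
  also have "\<dots> = ennreal (measure lborel (supball x r \<inter> G) + lo * (2 * r) ^ CARD('n))"
    using assms by (simp add: ennreal_mult ennreal_plus)
  finally have "ennreal a * ennreal ((2 * s) ^ CARD('n)) * ennreal ((2 * r) ^ CARD('n)) \<le>
     ennreal (measure lborel (supball x r \<inter> G) + lo * (2 * r) ^ CARD('n)) * ennreal ((2 * s) ^ CARD('n))"
    by (simp add: mult_right_mono)
  then have "ennreal (a * (2 * r) ^ CARD('n) * (2 * s) ^ CARD('n)) \<le> ennreal ((measure lborel (supball x r \<inter> G) + lo * (2 * r) ^ CARD('n)) * (2 * s) ^ CARD('n))"
    using assms by (simp add: ennreal_mult'' mult_ac)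
  then have "a * (2 * r) ^ CARD('n) * (2 * s) ^ CARD('n) \<le> (measure lborel (supball x r \<inter> G) + lo * (2 * r) ^ CARD('n)) * (2 * s) ^ CARD('n)"
    using assms by (subst (asm) ennreal_le_iff) auto
  then have "a * (2 * r) ^ CARD('n) \<le> measure lborel (supball x r \<inter> G) + lo * (2 * r) ^ CARD('n)"
    by (rule mult_right_le_imp_le) (use assms in simp)
  then show ?thesis unfolding a_def[symmetric] G_def by (simp add: left_diff_distrib)
qed

section \<open>Gaussian steps\<close>

lemma borel_measurable_vec_component [measurable (raw)]:
  "f \<in> borel_measurable M \<Longrightarrow> (\<lambda>\<omega>. (f \<omega> :: real^'n) $ i) \<in> borel_measurable M"
  by (erule measurable_compose) (simp add: borel_measurable_continuous_onI continuous_on_component)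

text \<open>The parameter is the variance of each coordinate, that is, the elapsed time.\<close>

definition gauss :: "real \<Rightarrow> (real^'n) measure" where
  "gauss \<delta> = density lborel (\<lambda>z. ennreal (\<Prod>i\<in>UNIV. normal_density 0 (sqrt \<delta>) (z $ i)))"

lemma sets_gauss [simp, measurable_cong]: "sets (gauss \<delta>) = sets borel"
  by (simp add: gauss_def)

lemma space_gauss [simp]: "space (gauss \<delta>) = UNIV"
  by (simp add: gauss_def)

lemma nn_integral_lborel_prod_cart:
  fixes f :: "'n::finite \<Rightarrow> real \<Rightarrow> ennreal"
  assumes [measurable]: "\<And>i. f i \<in> borel_measurable borel"
  shows "(\<integral>\<^sup>+ x. (\<Prod>i\<in>UNIV. f i (x $ i)) \<partial>(lborel :: (real^'n) measure)) = (\<Prod>i\<in>UNIV. \<integral>\<^sup>+ x. f i x \<partial>lborel)"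
proof -
  \<comment> \<open>The product formula for \<open>lborel\<close> is indexed by
    \<open>Basis\<close>; \<open>h\<close> carries the coordinate functions over to basis
    vectors.\<close>
  define h where "h b = f (THE i. b = axis i (1::real))" for b :: "real^'n"
  have h: "h (axis i 1) = f i" for i
    unfolding h_def by (simp add: axis_eq_axis)
  have B: "(Basis :: (real^'n) set) = (\<lambda>i. axis i 1) ` UNIV" by (auto simp: Basis_vec_def)
  have inj: "inj (\<lambda>i::'n. axis i (1::real))" by (auto simp: inj_def axis_eq_axis)
  have [measurable]: "h b \<in> borel_measurable borel" if "b \<in> Basis" for b
    unfolding h_def by measurable
  have "(\<integral>\<^sup>+ x. (\<Prod>b\<in>Basis. h b (x \<bullet> b)) \<partial>(lborel :: (real^'n) measure)) = (\<Prod>b\<in>Basis. (\<integral>\<^sup>+ x. h b x \<partial>lborel))"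
    by (rule nn_integral_lborel_prod) auto
  then show ?thesis
    by (simp add: B prod.reindex[OF inj] h inner_axis)
qed

lemma nn_integral_gauss_prod:
  fixes f :: "'n::finite \<Rightarrow> real \<Rightarrow> ennreal"
  assumes [measurable]: "\<And>i. f i \<in> borel_measurable borel"
  shows "(\<integral>\<^sup>+ x. (\<Prod>i\<in>UNIV. f i (x $ i)) \<partial>(gauss \<delta> :: (real^'n) measure))
       = (\<Prod>i\<in>UNIV. \<integral>\<^sup>+ z. f i z * ennreal (normal_density 0 (sqrt \<delta>) z) \<partial>lborel)"
proof -
  have "(\<integral>\<^sup>+ x. (\<Prod>i\<in>UNIV. f i (x $ i)) \<partial>(gauss \<delta> :: (real^'n) measure))
     = (\<integral>\<^sup>+ x. (\<Prod>i\<in>UNIV. f i (x $ i) * ennreal (normal_density 0 (sqrt \<delta>) (x $ i))) \<partial>(lborel :: (real^'n) measure))"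
    unfolding gauss_def
    by (subst nn_integral_density) (auto simp: prod.distrib prod_ennreal mult.commute)
  also have "\<dots> = (\<Prod>i\<in>UNIV. \<integral>\<^sup>+ z. f i z * ennreal (normal_density 0 (sqrt \<delta>) z) \<partial>lborel)"
    by (rule nn_integral_lborel_prod_cart) auto
  finally show ?thesis .
qed

lemma nn_integral_normal_density_1: "0 < \<sigma> \<Longrightarrow> (\<integral>\<^sup>+ z. ennreal (normal_density 0 \<sigma> z) \<partial>lborel) = 1"
  by (subst nn_integral_eq_integral) auto

lemma prob_space_gauss:
  assumes "0 < \<delta>" shows "prob_space (gauss \<delta> :: (real^'n) measure)"
proof
  show "emeasure (gauss \<delta> :: (real^'n) measure) (space (gauss \<delta>)) = 1"
    using nn_integral_gauss_prod[of "\<lambda>_ _. 1" \<delta>] assms by (simp add: nn_integral_normal_density_1)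
qed

lemma nn_integral_gauss_component:
  fixes j :: "'n::finite"
  assumes [measurable]: "f \<in> borel_measurable borel" and "0 < \<delta>"
  shows "(\<integral>\<^sup>+ x. f (x $ j) \<partial>(gauss \<delta> :: (real^'n) measure)) = (\<integral>\<^sup>+ z. f z * ennreal (normal_density 0 (sqrt \<delta>) z) \<partial>lborel)"
proof -
  have "(\<integral>\<^sup>+ x. f (x $ j) \<partial>(gauss \<delta> :: (real^'n) measure)) = (\<integral>\<^sup>+ x. (\<Prod>i\<in>UNIV. (if i = j then f else (\<lambda>_. 1)) (x $ i)) \<partial>(gauss \<delta> :: (real^'n) measure))"
    by (simp add: if_distrib[of "\<lambda>h. h _"] prod.delta cong: if_cong)
  also have "\<dots> = (\<Prod>i\<in>UNIV. \<integral>\<^sup>+ z. (if i = j then f else (\<lambda>_. 1)) z * ennreal (normal_density 0 (sqrt \<delta>) z) \<partial>lborel)"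
    by (rule nn_integral_gauss_prod) auto
  also have "\<dots> = (\<Prod>i\<in>UNIV. if i = j then (\<integral>\<^sup>+ z. f z * ennreal (normal_density 0 (sqrt \<delta>) z) \<partial>lborel) else 1)"
    using assms(2) by (intro prod.cong) (auto simp: nn_integral_normal_density_1)
  finally show ?thesis by (simp add: prod.delta)
qed

text \<open>Markov's inequality for the fourth moment. The second moment would give order
  \<open>\<delta>\<close> per step, which does not vanish when summed over the order of
  \<open>1 / \<delta>\<close> steps; the fourth gives order \<open>\<delta>\<^sup>2\<close>.\<close>

lemma gauss_jump_bound:
  assumes "0 < \<delta>" "0 < e"
  shows "measure (gauss \<delta> :: (real^'n) measure) (- supball 0 e) \<le> real CARD('n) * (3 * \<delta>\<^sup>2 / e ^ 4)"
proof -
  interpret prob_space "gauss \<delta> :: (real^'n) measure" by (rule prob_space_gauss) fact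
  have 1: "emeasure (gauss \<delta> :: (real^'n) measure) {z. e < \<bar>z $ i\<bar>} \<le> ennreal (3 * \<delta>\<^sup>2 / e ^ 4)" for i :: 'n
  proof -
    have m: "has_bochner_integral lborel (\<lambda>x. normal_density 0 (sqrt \<delta>) x * x ^ 4) (3 * \<delta>\<^sup>2)"
      using normal_moment_even[of "sqrt \<delta>" 0 2] assms by (simp add: fact_numeral power_divide field_simps power2_eq_square)
    have "emeasure (gauss \<delta> :: (real^'n) measure) {z. e < \<bar>z $ i\<bar>} = (\<integral>\<^sup>+ z. indicator {u. e < \<bar>u\<bar>} (z $ i) \<partial>(gauss \<delta> :: (real^'n) measure))"
    proof -
      have "(\<lambda>z. indicator {u. e < \<bar>u\<bar>} (z $ i)) = (indicator {z :: real^'n. e < \<bar>z $ i\<bar>} :: real^'n \<Rightarrow> ennreal)"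
        by (auto simp: indicator_def fun_eq_iff)
      then show ?thesis by simp
    qed
    also have "\<dots> = (\<integral>\<^sup>+ u. indicator {u. e < \<bar>u\<bar>} u * ennreal (normal_density 0 (sqrt \<delta>) u) \<partial>lborel)"
      using assms by (intro nn_integral_gauss_component) auto
    also have "\<dots> \<le> (\<integral>\<^sup>+ u. ennreal (1 / e ^ 4) * ennreal (normal_density 0 (sqrt \<delta>) u * u ^ 4) \<partial>lborel)"
    proof (rule nn_integral_mono)
      fix u :: real
      have "normal_density 0 (sqrt \<delta>) u \<le> 1 / e ^ 4 * (normal_density 0 (sqrt \<delta>) u * u ^ 4)" if "e < \<bar>u\<bar>"
      proof -
        have "e ^ 4 \<le> \<bar>u\<bar> ^ 4" using that assms by (intro power_mono) auto
        then have "1 \<le> u ^ 4 / e ^ 4" using assms by (simp add: power_even_abs field_simps)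
        then have "normal_density 0 (sqrt \<delta>) u * 1 \<le> normal_density 0 (sqrt \<delta>) u * (u ^ 4 / e ^ 4)"
          by (intro mult_left_mono) auto
        then show ?thesis by simp
      qed
      then show "indicator {u. e < \<bar>u\<bar>} u * ennreal (normal_density 0 (sqrt \<delta>) u) \<le> ennreal (1 / e ^ 4) * ennreal (normal_density 0 (sqrt \<delta>) u * u ^ 4)"
        using assms by (auto simp flip: ennreal_mult split: split_indicator intro!: ennreal_leI)
    qed
    also have "\<dots> = ennreal (1 / e ^ 4) * ennreal (3 * \<delta>\<^sup>2)"
      using m by (subst nn_integral_cmult, simp, subst nn_integral_eq_integral) (auto simp: has_bochner_integral_iff)
    also have "\<dots> = ennreal (3 * \<delta>\<^sup>2 / e ^ 4)" using assms by (simp flip: ennreal_mult)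
    finally show ?thesis .
  qed
  have "- supball 0 e = (\<Union>i\<in>UNIV. {z::real^'n. e < \<bar>z $ i\<bar>})" by (simp add: set_eq_iff supball_def not_le)
  then have "measure (gauss \<delta>) (- supball (0::real^'n) e) \<le> (\<Sum>i\<in>UNIV. measure (gauss \<delta>) {z::real^'n. e < \<bar>z $ i\<bar>})"
    by (simp only:) (rule finite_measure_subadditive_finite, auto)
  also have "\<dots> \<le> (\<Sum>i\<in>(UNIV::'n set). 3 * \<delta>\<^sup>2 / e ^ 4)"
    using 1 assms by (intro sum_mono) (simp add: emeasure_eq_measure)
  finally show ?thesis by simp
qed

text \<open>Subtracting the two images of the Gaussian kernel reflected at \<open>\<plusminus> 2 * r\<close> gives a lower
  bound for the kernel of Brownian motion killed outside \<open>[- 2 * r, 2 * r]\<close>.\<close>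

definition absorbed :: "real \<Rightarrow> real \<Rightarrow> real \<Rightarrow> real \<Rightarrow> real" where
  "absorbed r t u v = max 0 (normal_density 0 (sqrt t) (u - v) - normal_density 0 (sqrt t) (4 * r - u - v)
       - normal_density 0 (sqrt t) (4 * r + u + v))"

lemma normal_density_antimono:
  assumes "\<bar>a\<bar> \<le> \<bar>b\<bar>" "0 < s"
  shows "normal_density 0 s b \<le> normal_density 0 s a"
proof -
  have "a\<^sup>2 \<le> b\<^sup>2" using assms(1) by (simp add: abs_le_square_iff)
  then show ?thesis using assms(2) by (auto simp: normal_density_def intro!: mult_left_mono divide_right_mono)
qed

text \<open>Beyond \<open>2 * r\<close> the point \<open>u\<close> is at least as close to the image
  of \<open>v\<close> on its own side as to \<open>v\<close>, so the difference is at most 0 and is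
  cut off.\<close>

lemma absorbed_outside:
  assumes "0 < r" "0 < t" "\<bar>v\<bar> \<le> r" "2 * r \<le> \<bar>u\<bar>"
  shows "absorbed r t u v = 0"
proof (cases "0 \<le> u")
  case True
  then have "normal_density 0 (sqrt t) (u - v) \<le> normal_density 0 (sqrt t) (4 * r - u - v)"
    using assms by (intro normal_density_antimono) auto
  moreover have "0 \<le> normal_density 0 (sqrt t) (4 * r + u + v)" by simp
  ultimately show ?thesis unfolding absorbed_def by (intro max_absorb1) linarith
next
  case False
  then have "normal_density 0 (sqrt t) (u - v) \<le> normal_density 0 (sqrt t) (4 * r + u + v)"
    using assms by (intro normal_density_antimono) auto
  moreover have "0 \<le> normal_density 0 (sqrt t) (4 * r - u - v)" by simp
  ultimately show ?thesis unfolding absorbed_def by (intro max_absorb1) linarith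
qed

lemma normal_density_conv:
  assumes "0 < s" "0 < t"
  shows "(\<integral>\<^sup>+ z. ennreal (normal_density 0 (sqrt s) (a + z) * normal_density 0 (sqrt t) z) \<partial>lborel) = ennreal (normal_density 0 (sqrt (s + t)) a)"
proof -
  have sym: "normal_density 0 c (- x) = normal_density 0 c x" for c x by (simp add: normal_density_def)
  have "ennreal (normal_density 0 (sqrt (s + t)) (- a)) = (\<integral>\<^sup>+ z. ennreal (normal_density 0 (sqrt s) (- a - z) * normal_density 0 (sqrt t) z) \<partial>lborel)"
    using fun_cong[OF conv_normal_density_zero_mean[of "sqrt s" "sqrt t"], of "- a"] assms by simp
  also have "\<dots> = (\<integral>\<^sup>+ z. ennreal (normal_density 0 (sqrt s) (a + z) * normal_density 0 (sqrt t) z) \<partial>lborel)"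
  proof (intro nn_integral_cong)
    fix z
    have "- a - z = - (a + z)" by simp
    then show "ennreal (normal_density 0 (sqrt s) (- a - z) * normal_density 0 (sqrt t) z) = ennreal (normal_density 0 (sqrt s) (a + z) * normal_density 0 (sqrt t) z)"
      using sym[of "sqrt s" "a + z"] by simp
  qed
  finally show ?thesis by (simp add: sym)
qed

lemma normal_density_conv_integral:
  assumes "0 < s" "0 < t"
  shows "has_bochner_integral lborel (\<lambda>z. normal_density 0 (sqrt s) (a + z) * normal_density 0 (sqrt t) z) (normal_density 0 (sqrt (s + t)) a)"
  using normal_density_conv[OF assms, of a]
  by (intro has_bochner_integral_nn_integral) auto

text \<open>Before truncation this is the semigroup identity for three Gaussian kernels. Truncation
  turns it into an inequality, because the positive part of an integral is at most the integral of
  the positive part.\<close>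

lemma absorbed_step:
  assumes "0 < r" "0 < t" "0 < \<delta>"
  shows "ennreal (absorbed r (t + \<delta>) u v) \<le> (\<integral>\<^sup>+ z. ennreal (absorbed r t (u + z) v) * ennreal (normal_density 0 (sqrt \<delta>) z) \<partial>lborel)"
proof -
  let ?p = "\<lambda>t. normal_density 0 (sqrt t)"
  let ?k = "\<lambda>z. ?p t (u + z - v) - ?p t (4 * r - (u + z) - v) - ?p t (4 * r + (u + z) + v)"
  have sym: "normal_density 0 c (- x) = normal_density 0 c x" for c x by (simp add: normal_density_def)
  \<comment> \<open>The Gaussian is even, so all three terms can be brought to the form
    \<open>a + z\<close> of \<open>normal_density_conv_integral\<close>.\<close>
  have s1: "?p t (4 * r - (u + z) - v) = ?p t ((u + v - 4 * r) + z)" for z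
    using sym[of "sqrt t" "(u + v - 4 * r) + z"] by (simp add: algebra_simps)
  have s2: "?p (t + \<delta>) (4 * r - u - v) = ?p (t + \<delta>) (u + v - 4 * r)"
    using sym[of "sqrt (t + \<delta>)" "u + v - 4 * r"] by (simp add: algebra_simps)
  have i: "has_bochner_integral lborel (\<lambda>z. ?p t ((u - v) + z) * ?p \<delta> z - ?p t ((u + v - 4 * r) + z) * ?p \<delta> z - ?p t ((4 * r + u + v) + z) * ?p \<delta> z)
     (?p (t + \<delta>) (u - v) - ?p (t + \<delta>) (u + v - 4 * r) - ?p (t + \<delta>) (4 * r + u + v))"
    by (intro has_bochner_integral_diff normal_density_conv_integral assms)
  have eq: "?k z * ?p \<delta> z = ?p t ((u - v) + z) * ?p \<delta> z - ?p t ((u + v - 4 * r) + z) * ?p \<delta> z - ?p t ((4 * r + u + v) + z) * ?p \<delta> z" for z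
    unfolding s1 by (simp add: algebra_simps)
  have "?p (t + \<delta>) (u - v) - ?p (t + \<delta>) (4 * r - u - v) - ?p (t + \<delta>) (4 * r + u + v) = (\<integral>z. ?k z * ?p \<delta> z \<partial>lborel)"
    unfolding eq s2 using i by (simp add: has_bochner_integral_iff)
  moreover have "ennreal (\<integral>z. ?k z * ?p \<delta> z \<partial>lborel) \<le> (\<integral>\<^sup>+ z. ennreal (?k z * ?p \<delta> z) \<partial>lborel)"
  proof -
    have int: "integrable lborel (\<lambda>z. ?k z * ?p \<delta> z)" unfolding eq using i by (simp add: has_bochner_integral_iff)
    have "(\<integral>z. ?k z * ?p \<delta> z \<partial>lborel) \<le> (\<integral>z. max 0 (?k z * ?p \<delta> z) \<partial>lborel)"
      using int by (intro integral_mono) auto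
    then have "ennreal (\<integral>z. ?k z * ?p \<delta> z \<partial>lborel) \<le> ennreal (\<integral>z. max 0 (?k z * ?p \<delta> z) \<partial>lborel)" by (rule ennreal_leI)
    also have "\<dots> = (\<integral>\<^sup>+ z. ennreal (max 0 (?k z * ?p \<delta> z)) \<partial>lborel)"
      using int by (subst nn_integral_eq_integral) auto
    also have "\<dots> = (\<integral>\<^sup>+ z. ennreal (?k z * ?p \<delta> z) \<partial>lborel)"
      by (intro nn_integral_cong) (auto simp: max_def ennreal_neg)
    finally show ?thesis .
  qed
  moreover have "(\<integral>\<^sup>+ z. ennreal (?k z * ?p \<delta> z) \<partial>lborel) = (\<integral>\<^sup>+ z. ennreal (absorbed r t (u + z) v) * ennreal (?p \<delta> z) \<partial>lborel)"
    by (intro nn_integral_cong) (auto simp: absorbed_def max_def ennreal_mult'' ennreal_neg)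
  ultimately show ?thesis unfolding absorbed_def by (auto simp: max_def)
qed

text \<open>At time \<open>r\<^sup>2\<close> the standard deviation is \<open>r\<close>; the target
  is within \<open>r\<close> of the start while both images are at least \<open>3 * r\<close>
  away.\<close>

lemma absorbed_lower:
  assumes "0 < r" "\<bar>v\<bar> \<le> r"
  shows "1 / (8 * r) \<le> absorbed r (r\<^sup>2) 0 v"
proof -
  let ?p = "normal_density 0 r"
  have s: "sqrt (r\<^sup>2) = r" using assms by simp
  have 1: "?p r \<le> ?p (0 - v)" "?p (4 * r - 0 - v) \<le> ?p (3 * r)" "?p (4 * r + 0 + v) \<le> ?p (3 * r)"
    using assms by (auto intro!: normal_density_antimono)
  define A where "A = 1 / (r * sqrt (2 * pi))"
  have "sqrt (2 * pi * r\<^sup>2) = r * sqrt (2 * pi)" using assms by (simp add: real_sqrt_mult)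
  then have pr: "?p r = A * exp (- 1 / 2)" "?p (3 * r) = A * exp (- 9 / 2)"
    using assms by (auto simp: normal_density_def A_def power_mult_distrib)
  have "sqrt (2 * pi) \<le> 3" by (rule real_le_lsqrt) (use pi_less_4 in auto)
  then have A: "1 / (3 * r) \<le> A" unfolding A_def using assms by (intro divide_left_mono) auto
  have e1: "1 / 2 \<le> exp (- 1 / 2 :: real)" using exp_ge_add_one_self[of "- 1 / 2 :: real"] by simp
  have "8 \<le> exp (4 :: real)" using exp_ge_add_one_self[of "2 :: real"] mult_mono[of 3 "exp 2" 3 "exp (2::real)"]
    by (simp flip: exp_add)
  have "exp (- 9 / 2) \<le> exp (- 1 / 2 :: real) / 8"
  proof -
    have "exp (- 9 / 2) * 8 \<le> exp (- 9 / 2) * exp (4 :: real)" using \<open>8 \<le> exp 4\<close> by simp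
    also have "\<dots> = exp (- 1 / 2)" by (simp flip: exp_add)
    finally show ?thesis by simp
  qed
  \<comment> \<open>The two images take at most a quarter of \<open>exp (- 1 / 2)\<close>, which
    leaves three quarters of at least 1/2. Times the lower bound \<open>1 / (3 * r)\<close> of
    \<open>A\<close> this is \<open>1 / (8 * r)\<close>.\<close>
  then have "3 / 8 \<le> exp (- 1 / 2) - 2 * exp (- 9 / 2 :: real)" using e1 by simp
  then have "1 / (3 * r) * (3 / 8) \<le> A * (exp (- 1 / 2) - 2 * exp (- 9 / 2 :: real))"
    using A assms by (intro mult_mono) (auto simp: A_def)
  then show ?thesis using 1 pr unfolding absorbed_def s by (simp add: algebra_simps)
qed

section \<open>Hitting probabilities\<close>

text \<open>The probability that a walk with step law \<open>N\<close> from \<open>y\<close> enters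
  \<open>A\<close> within \<open>n\<close> steps, with all earlier positions in \<open>B\<close>.
  The first-step recursion needs no path space.\<close>

primrec hit_within :: "'a::monoid_add measure \<Rightarrow> 'a set \<Rightarrow> 'a set \<Rightarrow> nat \<Rightarrow> 'a \<Rightarrow> ennreal" where
  "hit_within N A B 0 y = indicator A y"
| "hit_within N A B (Suc n) y =
     (if y \<in> A then 1 else if y \<in> B then \<integral>\<^sup>+ z. hit_within N A B n (y + z) \<partial>N else 0)"

definition hit :: "'a::monoid_add measure \<Rightarrow> 'a set \<Rightarrow> 'a set \<Rightarrow> 'a \<Rightarrow> ennreal" where
  "hit N A B y = (SUP n. hit_within N A B n y)"

context
  fixes N :: "(real^'n) measure" and A B :: "(real^'n) set"
  assumes N: "prob_space N" "sets N = sets borel"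
    and A [measurable]: "A \<in> sets borel" and B [measurable]: "B \<in> sets borel"
begin

lemma measurable_hit_within [measurable]: "hit_within N A B n \<in> borel_measurable borel"
proof (induction n)
  case 0
  show ?case by simp
next
  case (Suc n)
  interpret prob_space N by fact
  note [measurable_cong] = N(2) and [measurable] = Suc
  have "(\<lambda>y. if y \<in> A then 1 else if y \<in> B then \<integral>\<^sup>+ z. hit_within N A B n (y + z) \<partial>N else 0) \<in> borel_measurable borel"
    by measurable
  then show ?case by (simp cong: measurable_cong)
qed

lemma hit_within_le_1: "hit_within N A B n y \<le> 1"
proof (induction n arbitrary: y)
  case (Suc n)
  interpret prob_space N by fact
  have "(\<integral>\<^sup>+ z. hit_within N A B n (y + z) \<partial>N) \<le> (\<integral>\<^sup>+ z. 1 \<partial>N)"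
    by (intro nn_integral_mono Suc)
  then show ?case by (simp add: emeasure_space_1)
qed (simp split: split_indicator)

lemma hit_within_Suc: "hit_within N A B n y \<le> hit_within N A B (Suc n) y"
proof (induction n arbitrary: y)
  case (Suc n)
  have "(\<integral>\<^sup>+ z. hit_within N A B n (y + z) \<partial>N) \<le> (\<integral>\<^sup>+ z. hit_within N A B (Suc n) (y + z) \<partial>N)"
    by (intro nn_integral_mono Suc)
  then show ?case by simp
qed (simp split: split_indicator)

lemma measurable_hit [measurable]: "hit N A B \<in> borel_measurable borel"
  unfolding hit_def by measurable

lemma hit_le_1: "hit N A B y \<le> 1"
  unfolding hit_def by (intro SUP_least hit_within_le_1)

lemma hit_target: "y \<in> A \<Longrightarrow> hit N A B y = 1"
  unfolding hit_def
  by (intro antisym SUP_least hit_within_le_1 SUP_upper2[of 0]) auto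

lemma hit_outside:
  assumes "y \<notin> A" "y \<notin> B" shows "hit N A B y = 0"
proof -
  have "hit_within N A B n y = 0" for n using assms by (cases n) auto
  then show ?thesis by (simp add: hit_def)
qed

text \<open>Monotone convergence turns the recursion for \<open>hit_within\<close> into a
  fixed-point equation.\<close>

lemma hit_harmonic:
  assumes "y \<notin> A" "y \<in> B"
  shows "(\<integral>\<^sup>+ z. hit N A B (y + z) \<partial>N) = hit N A B y"
proof -
  note [measurable_cong] = N(2)
  have "(\<integral>\<^sup>+ z. hit N A B (y + z) \<partial>N) = (SUP n. \<integral>\<^sup>+ z. hit_within N A B n (y + z) \<partial>N)"
    unfolding hit_def
    by (intro nn_integral_monotone_convergence_SUP) (auto intro!: incseq_SucI le_funI hit_within_Suc simp del: hit_within.simps)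
  also have "\<dots> = (SUP n. hit_within N A B (Suc n) y)"
    using assms by simp
  also have "\<dots> = hit N A B y"
    unfolding hit_def
    by (intro antisym SUP_least) (rule SUP_upper2[OF UNIV_I] order_refl hit_within_Suc)+
  finally show ?thesis .
qed

end

section \<open>Mass of the absorbed kernel on a target set, and crossing of a level strip\<close>

definition absorbed_mass :: "real \<Rightarrow> real^'n \<Rightarrow> (real^'n) set \<Rightarrow> real \<Rightarrow> real^'n \<Rightarrow> ennreal" where
  "absorbed_mass r x G t y =
     (\<integral>\<^sup>+ v. indicator G v * (\<Prod>i\<in>UNIV. ennreal (absorbed r t (y $ i - x $ i) (v $ i - x $ i))) \<partial>lborel)"

lemma measurable_absorbed [measurable (raw)]:
  assumes [measurable]: "f \<in> borel_measurable M" "g \<in> borel_measurable M"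
  shows "(\<lambda>\<omega>. absorbed r t (f \<omega>) (g \<omega>)) \<in> borel_measurable M"
  unfolding absorbed_def by measurable

text \<open>Dropping both negative images leaves the free Gaussian kernel, and
  \<open>v = y + z\<close> makes the target a step.\<close>

lemma absorbed_mass_le_gauss:
  fixes x y :: "real^'n"
  assumes [measurable]: "G \<in> sets borel"
  shows "absorbed_mass r x G t y \<le> (\<integral>\<^sup>+ z. indicator G (y + z) \<partial>gauss t)"
proof -
  have sym: "normal_density 0 c (- u) = normal_density 0 c u" for c u by (simp add: normal_density_def)
  have 1: "absorbed r t (y $ i - x $ i) (v $ i - x $ i) \<le> normal_density 0 (sqrt t) ((v - y) $ i)" for v :: "real^'n" and i
  proof -
    have "normal_density 0 (sqrt t) ((y $ i - x $ i) - (v $ i - x $ i)) = normal_density 0 (sqrt t) ((v - y) $ i)"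
      using sym[of "sqrt t" "v $ i - y $ i"] by simp
    then show ?thesis unfolding absorbed_def
      by (intro max.boundedI) (simp_all add: add_nonneg_nonneg diff_le_eq add_increasing2)
  qed
  have "absorbed_mass r x G t y \<le> (\<integral>\<^sup>+ v. indicator G v * ennreal (\<Prod>i\<in>UNIV. normal_density 0 (sqrt t) ((v - y) $ i)) \<partial>lborel)"
    unfolding absorbed_mass_def
    by (intro nn_integral_mono mult_left_mono)
       (simp_all add: prod_ennreal[symmetric] prod_mono_ennreal ennreal_leI 1[unfolded vector_minus_component])
  also have "\<dots> = (\<integral>\<^sup>+ z. indicator G (y + z) * ennreal (\<Prod>i\<in>UNIV. normal_density 0 (sqrt t) (((y + z) - y) $ i)) \<partial>lborel)"
    by (rule nn_integral_lborel_shift[symmetric]) measurable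
  also have "\<dots> = (\<integral>\<^sup>+ z. indicator G (y + z) \<partial>gauss t)"
    unfolding gauss_def by (subst nn_integral_density) (auto simp: mult.commute)
  finally show ?thesis .
qed

lemma absorbed_mass_le_1:
  fixes x y :: "real^'n"
  assumes "G \<in> sets borel" "0 < t"
  shows "absorbed_mass r x G t y \<le> 1"
proof -
  interpret prob_space "gauss t :: (real^'n) measure" by (rule prob_space_gauss) fact
  have "(\<integral>\<^sup>+ z. indicator G (y + z) \<partial>gauss t) \<le> (\<integral>\<^sup>+ z. 1 \<partial>(gauss t :: (real^'n) measure))"
    by (intro nn_integral_mono) (simp split: split_indicator)
  with absorbed_mass_le_gauss[OF assms(1), of r x t y] show ?thesis
    using emeasure_space_1 by simp
qed

lemma absorbed_mass_outside:
  assumes "0 < r" "0 < t" "G \<subseteq> supball x r" "y \<notin> supball x (2 * r)"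
  shows "absorbed_mass r x G t y = 0"
proof -
  obtain i where i: "2 * r < \<bar>y $ i - x $ i\<bar>" using assms(4) by (auto simp: supball_def not_le)
  have "indicator G v * (\<Prod>i\<in>UNIV. ennreal (absorbed r t (y $ i - x $ i) (v $ i - x $ i))) = 0" for v
  proof (cases "v \<in> G")
    case True
    then have "\<bar>v $ i - x $ i\<bar> \<le> r" using assms(3) by (auto simp: supball_def)
    then have "absorbed r t (y $ i - x $ i) (v $ i - x $ i) = 0" using assms i by (intro absorbed_outside) auto
    then have "(\<Prod>i\<in>UNIV. ennreal (absorbed r t (y $ i - x $ i) (v $ i - x $ i))) = 0"
      by (intro prod_zero) (auto intro!: exI[of _ i])
    then show ?thesis by simp
  qed simp
  then show ?thesis by (simp only: absorbed_mass_def nn_integral_const mult_zero_left)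
qed

text \<open>The coordinate factors are nonnegative, so the one-dimensional inequality multiplies up;
  Fubini then exchanges the target \<open>v\<close> and the step \<open>z\<close>.\<close>

lemma absorbed_mass_step:
  fixes x y :: "real^'n"
  assumes "0 < r" "0 < t" "0 < \<delta>" and [measurable]: "G \<in> sets borel"
  shows "absorbed_mass r x G (t + \<delta>) y \<le> (\<integral>\<^sup>+ z. absorbed_mass r x G t (y + z) \<partial>gauss \<delta>)"
proof -
  interpret prob_space "gauss \<delta> :: (real^'n) measure" by (rule prob_space_gauss) fact
  interpret pair_sigma_finite lborel "gauss \<delta> :: (real^'n) measure" ..
  have "absorbed_mass r x G (t + \<delta>) y
      \<le> (\<integral>\<^sup>+ v. indicator G v * (\<Prod>i\<in>UNIV. \<integral>\<^sup>+ z. ennreal (absorbed r t ((y $ i - x $ i) + z) (v $ i - x $ i)) * ennreal (normal_density 0 (sqrt \<delta>) z) \<partial>lborel) \<partial>lborel)"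
    unfolding absorbed_mass_def
    by (intro nn_integral_mono mult_left_mono prod_mono_ennreal absorbed_step assms) auto
  also have "\<dots> = (\<integral>\<^sup>+ v. indicator G v * (\<integral>\<^sup>+ z. (\<Prod>i\<in>UNIV. ennreal (absorbed r t ((y $ i - x $ i) + z $ i) (v $ i - x $ i))) \<partial>gauss \<delta>) \<partial>lborel)"
    by (subst nn_integral_gauss_prod[symmetric]) auto
  also have "\<dots> = (\<integral>\<^sup>+ v. (\<integral>\<^sup>+ z. indicator G v * (\<Prod>i\<in>UNIV. ennreal (absorbed r t ((y $ i - x $ i) + z $ i) (v $ i - x $ i))) \<partial>gauss \<delta>) \<partial>lborel)"
    by (intro nn_integral_cong nn_integral_cmult[symmetric]) measurable
  also have "\<dots> = (\<integral>\<^sup>+ z. (\<integral>\<^sup>+ v. indicator G v * (\<Prod>i\<in>UNIV. ennreal (absorbed r t ((y $ i - x $ i) + z $ i) (v $ i - x $ i))) \<partial>lborel) \<partial>gauss \<delta>)"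
    by (rule Fubini'[symmetric]) measurable
  also have "\<dots> = (\<integral>\<^sup>+ z. absorbed_mass r x G t (y + z) \<partial>gauss \<delta>)"
    by (simp add: absorbed_mass_def algebra_simps)
  finally show ?thesis .
qed

lemma absorbed_mass_lower:
  fixes x :: "real^'n"
  assumes "0 < r" "G \<subseteq> supball x r" and G[measurable]: "G \<in> sets borel"
  shows "ennreal (measure lborel G / (8 * r) ^ CARD('n)) \<le> absorbed_mass r x G (r\<^sup>2) x"
proof -
  have fin: "emeasure lborel G \<noteq> \<infinity>"
    using fmeasurableD2[OF supball_Int_fmeasurable[OF G, of x r]] assms(2) by (simp add: Int_absorb1)
  have "ennreal (measure lborel G / (8 * r) ^ CARD('n)) = (\<integral>\<^sup>+ v. indicator G v * (\<Prod>i\<in>(UNIV::'n set). ennreal (1 / (8 * r))) \<partial>lborel)"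
  proof -
    have "(\<Prod>i\<in>(UNIV::'n set). ennreal (1 / (8 * r))) = ennreal (1 / (8 * r) ^ CARD('n))"
      using \<open>0 < r\<close> by (simp add: ennreal_power power_divide)
    then have "(\<integral>\<^sup>+ v. indicator G v * (\<Prod>i\<in>(UNIV::'n set). ennreal (1 / (8 * r))) \<partial>lborel) = emeasure lborel G * ennreal (1 / (8 * r) ^ CARD('n))"
      by (simp add: nn_integral_multc)
    also have "emeasure lborel G = ennreal (measure lborel G)"
      using fin by (intro emeasure_eq_ennreal_measure) auto
    finally show ?thesis using \<open>0 < r\<close> by (simp flip: ennreal_mult)
  qed
  also have "\<dots> \<le> absorbed_mass r x G (r\<^sup>2) x"
    unfolding absorbed_mass_def
  proof (intro nn_integral_mono)
    fix v
    show "indicator G v * (\<Prod>i\<in>(UNIV::'n set). ennreal (1 / (8 * r))) \<le> indicator G v * (\<Prod>i\<in>UNIV. ennreal (absorbed r (r\<^sup>2) (x $ i - x $ i) (v $ i - x $ i)))"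
    proof (cases "v \<in> G")
      case True
      then have "\<bar>v $ i - x $ i\<bar> \<le> r" for i using assms(2) by (auto simp: supball_def)
      then show ?thesis using absorbed_lower[OF assms(1)]
        by (intro mult_left_mono prod_mono_ennreal ennreal_leI) auto
    qed simp
  qed
  finally show ?thesis .
qed

text \<open>Starting in \<open>G1\<close>, a walk without jumps larger than \<open>e\<close> cannot enter \<open>G2\<close> without
  visiting \<open>G1 \<inter> G2\<close>; so the mass that reaches \<open>G2\<close> bounds the superharmonic \<open>g\<close> from below.\<close>

lemma crossing_bound:
  fixes x :: "real^'n" and g :: "real^'n \<Rightarrow> ennreal"
  assumes "0 < r" "0 < \<delta>" and G2[measurable]: "G2 \<in> sets borel" and g[measurable]: "g \<in> borel_measurable borel"
    and super: "\<And>y. y \<in> supball x (2 * r) \<Longrightarrow> (\<integral>\<^sup>+ z. g (y + z) \<partial>gauss \<delta>) \<le> g y"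
    and low: "\<And>y. y \<in> supball x (2 * r) \<Longrightarrow> y \<in> G1 \<Longrightarrow> y \<in> G2 \<Longrightarrow> c \<le> g y"
    and cross: "\<And>y z. y \<in> G1 \<Longrightarrow> y \<notin> G2 \<Longrightarrow> z \<in> supball 0 e \<Longrightarrow> y + z \<in> G1"
    and "c \<le> 1" "y \<in> G1"
  shows "c * absorbed_mass r x (supball x r \<inter> G2) (real (Suc k) * \<delta>) y
     \<le> g y + of_nat (Suc k) * emeasure (gauss \<delta> :: (real^'n) measure) (- supball 0 e)"
  using \<open>y \<in> G1\<close>
proof (induction k arbitrary: y)
  define G where "G = supball x r \<inter> G2"
  have G[measurable]: "G \<in> sets borel" and Gr: "G \<subseteq> supball x r" by (auto simp: G_def)
  interpret prob_space "gauss \<delta> :: (real^'n) measure" by (rule prob_space_gauss) fact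
  define b where "b = emeasure (gauss \<delta> :: (real^'n) measure) (- supball 0 e)"
  \<comment> \<open>The two kinds of point at which the induction stops: outside the doubled box the
    mass vanishes, and in \<open>G2\<close> the point lies in both sets, so that \<open>low\<close>
    applies.\<close>
  have triv: "c * absorbed_mass r x G t y \<le> g y + d" if "y \<in> G1" "y \<notin> supball x (2 * r) \<or> y \<in> G2" "0 < t" for t y d
  proof (cases "y \<in> supball x (2 * r)")
    case True
    have "c * absorbed_mass r x G t y \<le> c * 1"
      using absorbed_mass_le_1[OF G that(3)] by (intro mult_left_mono) auto
    also have "\<dots> \<le> g y" using low[OF True] that True by simp
    finally show ?thesis by (simp add: add_increasing2)
  next
    case False
    then show ?thesis using absorbed_mass_outside[OF assms(1) that(3) Gr False] by simp
  qed
  \<comment> \<open>One step costs nothing for the superharmonic \<open>g\<close> and adds one more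
    chance \<open>b\<close> of a long jump.\<close>
  have int: "(\<integral>\<^sup>+ z. (g (y + z) + d) + indicator (- supball 0 e) z \<partial>gauss \<delta>) \<le> g y + (d + b)"
    if "y \<in> supball x (2 * r)" for y d
    using super[OF that] emeasure_space_1
    by (subst nn_integral_add, measurable, subst nn_integral_add, measurable) (simp add: b_def[symmetric] add.assoc add_right_mono)
  have inside: "y \<in> supball x (2 * r)" if "\<not> (y \<notin> supball x (2 * r) \<or> y \<in> G2)" for y using that by auto
  {
    case 0
    show ?case
    proof (cases "y \<notin> supball x (2 * r) \<or> y \<in> G2")
      case True
      then show ?thesis using triv[OF 0 True, of \<delta>] assms by (simp add: G_def)
    next
      case False
      have "c * absorbed_mass r x G \<delta> y \<le> c * (\<integral>\<^sup>+ z. indicator G (y + z) \<partial>gauss \<delta>)"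
        by (intro mult_left_mono absorbed_mass_le_gauss G) auto
      also have "\<dots> = (\<integral>\<^sup>+ z. c * indicator G (y + z) \<partial>gauss \<delta>)"
        by (rule nn_integral_cmult[symmetric]) measurable
      also have "\<dots> \<le> (\<integral>\<^sup>+ z. (g (y + z) + 0) + indicator (- supball 0 e) z \<partial>gauss \<delta>)"
      proof (intro nn_integral_mono)
        fix z :: "real^'n"
        have "c \<le> g (y + z)" if "y + z \<in> G" "z \<in> supball 0 e"
          using cross[OF 0 _ that(2)] False that(1) \<open>0 < r\<close>
          by (intro low) (auto simp: G_def intro: supball_mono)
        then show "c * indicator G (y + z) \<le> (g (y + z) + 0) + indicator (- supball 0 e) z"
          using \<open>c \<le> 1\<close> by (auto split: split_indicator intro: add_increasing)
      qed
      also have "\<dots> \<le> g y + (0 + b)" by (rule int[OF inside[OF False]])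
      finally show ?thesis by (simp add: G_def b_def)
    qed
  next
    case (Suc k)
    show ?case
    proof (cases "y \<notin> supball x (2 * r) \<or> y \<in> G2")
      case True
      have "0 < real (Suc (Suc k)) * \<delta>" using assms by simp
      from triv[OF Suc.prems True this] show ?thesis by (simp only: G_def)
    next
      case False
      let ?t = "real (Suc k) * \<delta>"
      have t: "0 < ?t" using assms by simp
      have "c * absorbed_mass r x G (?t + \<delta>) y \<le> c * (\<integral>\<^sup>+ z. absorbed_mass r x G ?t (y + z) \<partial>gauss \<delta>)"
        by (intro mult_left_mono absorbed_mass_step G assms t) auto
      also have "\<dots> = (\<integral>\<^sup>+ z. c * absorbed_mass r x G ?t (y + z) \<partial>gauss \<delta>)"
        unfolding absorbed_mass_def by (rule nn_integral_cmult[symmetric]) measurable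
      also have "\<dots> \<le> (\<integral>\<^sup>+ z. (g (y + z) + of_nat (Suc k) * b) + indicator (- supball 0 e) z \<partial>gauss \<delta>)"
      proof (intro nn_integral_mono)
        fix z :: "real^'n"
        show "c * absorbed_mass r x G ?t (y + z) \<le> (g (y + z) + of_nat (Suc k) * b) + indicator (- supball 0 e) z"
        proof (cases "z \<in> supball 0 e")
          case True
          then show ?thesis using Suc.IH[OF cross[OF Suc.prems _ True]] False by (simp add: G_def b_def)
        next
          case False
          have "c * absorbed_mass r x G ?t (y + z) \<le> 1 * 1"
            using absorbed_mass_le_1[OF G t] \<open>c \<le> 1\<close> by (intro mult_mono) auto
          then show ?thesis using False by (simp add: add_increasing)
        qed
      qed
      also have "\<dots> \<le> g y + (of_nat (Suc k) * b + b)" by (rule int[OF inside[OF False]])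
      finally show ?thesis by (simp add: G_def b_def algebra_simps)
    qed
  }
qed

text \<open>The start lies on one side of the strip between \<open>lo\<close> and \<open>hi\<close>,
  and points on the other side fill a fraction \<open>q\<close> of the ball. Steps shorter than the
  strip is wide cannot cross it unseen. The factor \<open>4 ^ CARD('n)\<close> is the quotient of
  \<open>(8 * r) ^ CARD('n)\<close> from \<open>absorbed_mass_lower\<close> and the volume
  \<open>(2 * r) ^ CARD('n)\<close>.\<close>

lemma level_hitting_bound:
  fixes x :: "real^'n" and g :: "real^'n \<Rightarrow> ennreal" and s :: "real^'n \<Rightarrow> real"
  assumes "0 < r" "0 < \<delta>" and k: "real (Suc k) * \<delta> = r\<^sup>2"
    and s[measurable]: "s \<in> borel_measurable borel" and g[measurable]: "g \<in> borel_measurable borel"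
    and super: "\<And>y. y \<in> supball x (2 * r) \<Longrightarrow> (\<integral>\<^sup>+ z. g (y + z) \<partial>gauss \<delta>) \<le> g y"
    and low: "\<And>y. y \<in> supball x (2 * r) \<Longrightarrow> lo \<le> s y \<Longrightarrow> s y \<le> hi \<Longrightarrow> c \<le> g y"
    and unif: "\<And>y z. z \<in> supball 0 e \<Longrightarrow> \<bar>s (y + z) - s y\<bar> \<le> hi - lo"
    and frac: "q * (2 * r) ^ CARD('n) \<le> measure lborel (supball x r \<inter> {v. s v \<le> hi})"
       "q * (2 * r) ^ CARD('n) \<le> measure lborel (supball x r \<inter> {v. lo \<le> s v})"
    and "c \<le> 1" "lo \<le> hi"
  shows "c * ennreal (q / 4 ^ CARD('n)) \<le> g x + of_nat (Suc k) * emeasure (gauss \<delta> :: (real^'n) measure) (- supball 0 e)"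
proof -
  have main: "c * ennreal (q / 4 ^ CARD('n)) \<le> g x + of_nat (Suc k) * emeasure (gauss \<delta> :: (real^'n) measure) (- supball 0 e)"
    if G2[measurable]: "G2 \<in> sets borel" and x: "x \<in> G1" and fr: "q * (2 * r) ^ CARD('n) \<le> measure lborel (supball x r \<inter> G2)"
     and l: "\<And>y. y \<in> supball x (2 * r) \<Longrightarrow> y \<in> G1 \<Longrightarrow> y \<in> G2 \<Longrightarrow> c \<le> g y"
     and cr: "\<And>y z. y \<in> G1 \<Longrightarrow> y \<notin> G2 \<Longrightarrow> z \<in> supball 0 e \<Longrightarrow> y + z \<in> G1" for G1 G2
  proof -
    have "q / 4 ^ CARD('n) = q * (2 * r) ^ CARD('n) / (8 * r) ^ CARD('n)"
    proof -
      have "(8 * r) ^ CARD('n) = 4 ^ CARD('n) * (2 * r) ^ CARD('n)" using power_mult_distrib[of 4 "2 * r" "CARD('n)"] by (simp only: mult.assoc[symmetric]) simp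
      then show ?thesis using \<open>0 < r\<close> by simp
    qed
    also have "\<dots> \<le> measure lborel (supball x r \<inter> G2) / (8 * r) ^ CARD('n)"
      using fr \<open>0 < r\<close> by (intro divide_right_mono) auto
    finally have "c * ennreal (q / 4 ^ CARD('n)) \<le> c * absorbed_mass r x (supball x r \<inter> G2) (r\<^sup>2) x"
      by (intro mult_left_mono order_trans[OF ennreal_leI absorbed_mass_lower] \<open>0 < r\<close>) auto
    also have "\<dots> \<le> g x + of_nat (Suc k) * emeasure (gauss \<delta> :: (real^'n) measure) (- supball 0 e)"
      unfolding k[symmetric]
      by (rule crossing_bound[where ?G1.0 = G1, OF assms(1,2) G2 g super l cr \<open>c \<le> 1\<close> x])
    finally show ?thesis .
  qed
  show ?thesis
  proof (cases "lo \<le> s x")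
    case True
    show ?thesis
    proof (rule main[of "{v. s v \<le> hi}" "{v. lo \<le> s v}"])
      show "y + z \<in> {v. lo \<le> s v}" if "y \<in> {v. lo \<le> s v}" "y \<notin> {v. s v \<le> hi}" "z \<in> supball 0 e" for y z
        using unif[OF that(3), of y] that by auto
    qed (use True frac low in auto)
  next
    case False
    show ?thesis
    proof (rule main[of "{v. lo \<le> s v}" "{v. s v \<le> hi}"])
      show "y + z \<in> {v. s v \<le> hi}" if "y \<in> {v. s v \<le> hi}" "y \<notin> {v. lo \<le> s v}" "z \<in> supball 0 e" for y z
        using unif[OF that(3), of y] that by auto
    qed (use False \<open>lo \<le> hi\<close> frac low in auto)
  qed
qed

section \<open>Descending through the scales\<close>

text \<open>The geometric sum has \<open>d\<close> terms, each at most \<open>2 ^ (d - 1)\<close>;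
  this is the origin of \<open>c0\<close>.\<close>

lemma power_shell_le:
  fixes x :: real
  assumes "0 \<le> x" "x \<le> 1"
  shows "(1 + x) ^ d - 1 \<le> c0 d * x"
proof -
  have "(1 + x) ^ d - 1 = x * (\<Sum>i<d. (1 + x) ^ i)"
    using power_diff_1_eq[of "1 + x" d] by simp
  also have "\<dots> \<le> x * (\<Sum>i<d. 2 ^ (d - 1))"
  proof (intro mult_left_mono sum_mono)
    fix i assume "i \<in> {..<d}"
    then have "(1 + x) ^ i \<le> 2 ^ i" "(2::real) ^ i \<le> 2 ^ (d - 1)"
      using assms by (auto intro!: power_mono power_increasing)
    then show "(1 + x) ^ i \<le> 2 ^ (d - 1)" by (rule order_trans)
  qed fact
  finally show ?thesis by (simp add: c0_def mult.commute)
qed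

definition radius :: "nat \<Rightarrow> real" where
  "radius l = 2 powr (- real l)"

lemma radius_pos [simp]: "0 < radius l"
  by (simp add: radius_def)

lemma radius_add: "radius (l + m) = radius l * radius m"
  by (simp add: radius_def powr_add[symmetric])

definition resonant :: "(real^'n) set \<Rightarrow> nat \<Rightarrow> (real^'n) set" where
  "resonant U0 l = {x. alpha_tilde CARD('n) \<le> sigma_tilde U0 (int l) x \<and> sigma_tilde U0 (int l) x \<le> 1 - alpha_tilde CARD('n)}"

text \<open>The tolerance \<open>a\<close> is a parameter because it grows by \<open>tol J\<close>
  with each further scale of a block.\<close>

definition balanced :: "(real^'n) set \<Rightarrow> nat \<Rightarrow> real \<Rightarrow> (real^'n) set" where
  "balanced U0 l a = {x. \<bar>sigma_hat U0 (int l) x - 1 / 2\<bar> \<le> a}"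

lemma Res_eq: "Res U0 lstar J L I = {x. J \<le> card {l \<in> Astar lstar J L I. x \<in> resonant U0 l}}"
  by (simp add: Res_def resonant_def)

lemma sigma_hat_nat: "U0 \<in> sets borel \<Longrightarrow> sigma_hat U0 (int l) = dens (- U0) (radius l)"
  by (simp add: fun_eq_iff sigma_hat_eq_dens radius_def)

lemma sigma_tilde_nat: "U0 \<in> sets borel \<Longrightarrow> sigma_tilde U0 (int l) = dens (- U0) (4 * radius l)"
  by (simp add: fun_eq_iff sigma_tilde_eq_dens radius_def)

lemma closed_resonant:
  fixes U0 :: "(real^'n) set"
  assumes "U0 \<in> sets borel" shows "closed (resonant U0 l)"
proof -
  have "continuous_on UNIV (dens (- U0) (4 * radius l))"
    using assms by (intro continuous_dens) auto
  then show ?thesis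
    unfolding resonant_def sigma_tilde_nat[OF assms]
    by (intro closed_Collect_conj closed_Collect_le continuous_intros)
qed

text \<open>A threshold on the count is a finite union, over index sets of size \<open>J\<close>, of
  intersections.\<close>

lemma closed_card_ge:
  assumes "finite T" "\<And>l. l \<in> T \<Longrightarrow> closed (R l)"
  shows "closed {x. J \<le> card {l \<in> T. x \<in> R l}}"
proof -
  have "{x. J \<le> card {l \<in> T. x \<in> R l}} = (\<Union>S\<in>{S. S \<subseteq> T \<and> card S = J}. \<Inter>l\<in>S. R l)" (is "?L = ?R")
  proof (intro equalityI subsetI)
    fix x assume "x \<in> ?L"
    then obtain S where "S \<subseteq> {l \<in> T. x \<in> R l}" "card S = J"
      using obtain_subset_with_card_n[of J "{l \<in> T. x \<in> R l}"] by auto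
    then show "x \<in> ?R" by auto
  next
    fix x assume "x \<in> ?R"
    then obtain S where "S \<subseteq> T" "card S = J" "\<forall>l\<in>S. x \<in> R l" by auto
    then have "S \<subseteq> {l \<in> T. x \<in> R l}" by auto
    then show "x \<in> ?L" using \<open>card S = J\<close> assms(1) card_mono[of "{l \<in> T. x \<in> R l}" S] by simp
  qed
  moreover have "closed ?R"
    using assms by (intro closed_UN closed_INT) (auto intro: finite_subset[of _ "Pow T"])
  ultimately show ?thesis by simp
qed

lemma finite_Astar [simp]: "finite (Astar lstar J L I)"
  by (rule finite_subset[of _ "{..<ell0 lstar J L + I * (J + 1) * L}"]) (auto simp: Astar_def)

lemma closed_Res:
  fixes U0 :: "(real^'n) set"
  assumes "U0 \<in> sets borel" shows "closed (Res U0 lstar J L I)"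
  unfolding Res_eq using assms by (intro closed_card_ge closed_resonant) auto

text \<open>The ball of radius \<open>r\<close> around \<open>x\<close> fits into the one of radius
  \<open>4 * r\<close> around \<open>y\<close>. Both \<open>U0\<close> and its complement fill at
  least 1/2 - 1/6 = 1/3 of the small ball, and dividing by the volume ratio
  \<open>4 ^ CARD('n)\<close> gives exactly \<open>alpha_tilde\<close>.\<close>

lemma balanced_imp_resonant:
  fixes U0 :: "(real^'n) set"
  assumes U0: "U0 \<in> sets borel" and x: "x \<in> balanced U0 l a" and "a \<le> 1 / 6" and y: "y \<in> supball x (3 * radius l)"
  shows "y \<in> resonant U0 l"
proof -
  let ?r = "radius l"
  have y': "y \<in> supball x (4 * ?r - ?r)" using y by simp
  have r: "0 < ?r" "?r \<le> 4 * ?r" by auto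
  have s: "(?r / (4 * ?r)) ^ CARD('n) = 1 / 4 ^ CARD('n)" using less_imp_neq[OF radius_pos, symmetric] by (simp add: power_one_over)
  have al: "alpha_tilde CARD('n) = 1 / 4 ^ CARD('n) * (1 / 3)"
    unfolding alpha_tilde_def powr_minus by (subst powr_realpow) (auto simp: inverse_eq_divide)
  have W: "- U0 \<in> sets borel" using U0 by auto
  have x': "1 / 3 \<le> dens (- U0) ?r x" "1 / 3 \<le> dens U0 ?r x"
    using x \<open>a \<le> 1 / 6\<close> dens_compl[OF r(1) U0, of x] unfolding balanced_def sigma_hat_nat[OF U0] by (auto simp: abs_le_iff)
  have "1 / 4 ^ CARD('n) * (1 / 3) \<le> 1 / 4 ^ CARD('n) * dens (- U0) ?r x"
    using x' by (intro mult_left_mono) auto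
  then have 1: "alpha_tilde CARD('n) \<le> dens (- U0) (4 * ?r) y"
    using dens_enlarge[OF r W y'] unfolding s al by linarith
  have "1 / 4 ^ CARD('n) * (1 / 3) \<le> 1 / 4 ^ CARD('n) * dens U0 ?r x"
    using x' by (intro mult_left_mono) auto
  then have 2: "alpha_tilde CARD('n) \<le> dens U0 (4 * ?r) y"
    using dens_enlarge[OF r U0 y'] unfolding s al by linarith
  have "dens (- U0) (4 * ?r) y = 1 - dens U0 (4 * ?r) y" by (rule dens_compl) (use U0 in auto)
  then show ?thesis using 1 2 by (simp add: resonant_def sigma_tilde_nat[OF U0])
qed

text \<open>Of the margin \<open>2 * q\<close>, one half pays for the shell and the other remains as
  the fraction of good points.\<close>

lemma level_set_fraction:
  fixes W :: "(real^'n) set"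
  assumes "0 < r" "0 < s" "s \<le> r" "W \<in> sets borel" and small: "c0 CARD('n) * (s / r) \<le> q"
    and x: "lo + 2 * q \<le> dens W r x" and "0 \<le> lo"
  shows "q * (2 * r) ^ CARD('n) \<le> measure lborel (supball x r \<inter> {z. lo \<le> dens W s z})"
proof -
  have "(1 + s / r) ^ CARD('n) - 1 \<le> q"
    using power_shell_le[of "s / r" "CARD('n)"] small assms by simp
  then have "q * (2 * r) ^ CARD('n) \<le> (dens W r x - ((1 + s / r) ^ CARD('n) - 1) - lo) * (2 * r) ^ CARD('n)"
    using x assms(1) by (intro mult_right_mono) auto
  also have "\<dots> \<le> measure lborel (supball x r \<inter> {z. lo \<le> dens W s z})"
    using assms by (intro dens_fraction) auto
  finally show ?thesis .
qed

text \<open>Over \<open>J\<close> scales the deviation from 1/2 adds up to 1/100, below the 1/6 that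
  \<open>balanced_imp_resonant\<close> tolerates. Half of \<open>tol J\<close> is the bound
  \<open>1 / (200 * J)\<close> in \<open>LJ\<close>.\<close>

definition tol :: "nat \<Rightarrow> real" where
  "tol J = 1 / (100 * real J)"

text \<open>At least the fraction \<open>tol J / 2\<close> of a ball around a balanced point is good for the next scale, see
  \<open>level_set_fraction\<close>. Half of the resulting bound \<open>tol J / 2 / 4 ^ d\<close> of \<open>level_hitting_bound\<close>
  is given up to absorb large jumps.\<close>

definition step_prob :: "nat \<Rightarrow> nat \<Rightarrow> real" where
  "step_prob d J = tol J / (4 * 4 ^ d)"

lemma step_prob: assumes "1 \<le> J" shows "0 < step_prob d J" "step_prob d J < 1"
proof -
  show "0 < step_prob d J" using assms by (simp add: step_prob_def tol_def)
  have "tol J \<le> 1" using assms by (simp add: tol_def)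
  moreover have "(1::real) < 4 * 4 ^ d" using one_le_power[of "4::real" d] by linarith
  ultimately show "step_prob d J < 1" by (simp add: step_prob_def)
qed

text \<open>Along the scales \<open>l, l + L, \<dots>\<close> the walk picks up one balanced scale after another. It moves at most
  \<open>2 * radius (l + k * L)\<close> in the \<open>k\<close>-th stage, so all scales met so far stay resonant.\<close>

lemma hit_chain:
  fixes U0 :: "(real^'n) set" and \<delta> :: real
  assumes U0: "U0 \<in> sets borel" and J: "1 \<le> J" and L: "5 \<le> L" and c0L: "c0 CARD('n) * radius L \<le> 1 / (200 * real J)"
    and A: "A \<in> sets borel" and target: "\<And>y. (\<forall>k<J. y \<in> resonant U0 (l + k * L)) \<Longrightarrow> y \<in> A"
    and \<delta>: "0 < \<delta>" and grid: "\<And>j. j < J \<Longrightarrow> \<exists>k. real (Suc k) * \<delta> = (radius (l + j * L))\<^sup>2"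
    and unif: "\<And>j y z. j < J \<Longrightarrow> z \<in> supball 0 e \<Longrightarrow>
         \<bar>sigma_hat U0 (int (l + j * L)) (y + z) - sigma_hat U0 (int (l + j * L)) y\<bar> \<le> tol J"
    and jumps: "\<And>j. j < J \<Longrightarrow> (radius (l + j * L))\<^sup>2 / \<delta> * measure (gauss \<delta> :: (real^'n) measure) (- supball 0 e) \<le> step_prob CARD('n) J ^ J"
    and n: "n < J" and bal: "\<And>k. k \<le> J - 1 - n \<Longrightarrow> \<exists>x\<in>balanced U0 (l + k * L) (real (Suc k) * tol J).
         y \<in> supball x (3 * radius (l + k * L) - 3 * radius (l + (J - 1 - n) * L))"
  shows "ennreal (step_prob CARD('n) J ^ n) \<le> hit (gauss \<delta>) A (resonant U0 l) y"
  using n bal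
proof (induction n arbitrary: y)
  define r where "r j = radius (l + j * L)" for j
  define g where "g = hit (gauss \<delta>) A (resonant U0 l)"
  define p where "p = step_prob CARD('n) J"
  have p: "0 < p" "p < 1" using step_prob[OF J] by (auto simp: p_def)
  have rpos: "0 < r j" for j by (simp add: r_def)
  have tolJ: "0 < tol J" "real J * tol J = 1 / 100" using J by (auto simp: tol_def)
  have acc: "real k * tol J \<le> 1 / 100" if "k \<le> J" for k
    using that tolJ mult_right_mono[of "real k" "real J" "tol J"] by linarith
  interpret G: prob_space "gauss \<delta> :: (real^'n) measure" by (rule prob_space_gauss) fact
  have R: "resonant U0 l \<in> sets borel" using closed_resonant[OF U0] by auto
  note gm = G.prob_space_axioms sets_gauss A R
  have res: "y \<in> resonant U0 (l + k * L)" if "x \<in> balanced U0 (l + k * L) (real (Suc k) * tol J)" "y \<in> supball x (3 * r k)" "k < J" for x y k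
    using balanced_imp_resonant[OF U0 that(1)] acc[of "Suc k"] that(2,3) by (simp add: r_def)
  {
    case 0
    \<comment> \<open>With no stage left, all \<open>J\<close> scales of the block have been met,
      and \<open>y\<close> is still close enough to each balanced point.\<close>
    have "y \<in> resonant U0 (l + k * L)" if "k < J" for k
    proof -
      have "\<exists>x\<in>balanced U0 (l + k * L) (real (Suc k) * tol J). y \<in> supball x (3 * r k - 3 * r (J - 1))"
        using 0(2)[of k] that by (simp only: r_def) simp
      then obtain x where x: "x \<in> balanced U0 (l + k * L) (real (Suc k) * tol J)" "y \<in> supball x (3 * r k - 3 * r (J - 1))"
        by blast
      from x(2) have "y \<in> supball x (3 * r k)" by (rule supball_mono) (use rpos[of "J - 1"] in simp)
      with x(1) show ?thesis using that by (rule res)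
    qed
    then have "y \<in> A" by (intro target) auto
    then show ?case using hit_target[OF gm] by simp
  next
    case (Suc n)
    \<comment> \<open>\<open>j\<close> is the last scale met so far; the present stage looks for
      balance at scale \<open>Suc j\<close> within distance \<open>2 * r j\<close> of
      \<open>y\<close>.\<close>
    define j where "j = J - 1 - Suc n"
    have bal: "\<exists>x\<in>balanced U0 (l + i * L) (real (Suc i) * tol J). y \<in> supball x (3 * r i - 3 * r j)" if "i \<le> j" for i
      using Suc.prems(2)[of i] that by (simp only: r_def j_def)
    have j: "Suc j < J" "J - 1 - n = Suc j" using Suc.prems(1) by (auto simp: j_def)
    have rj: "r (Suc j) = r j * radius L" by (simp add: r_def radius_add[symmetric] algebra_simps)
    have scL: "radius L \<le> 1 / 32"
    proof -
      have "radius L \<le> 2 powr (- 5)" unfolding radius_def using L by (intro powr_mono) auto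
      then show ?thesis by (simp add: powr_minus)
    qed
    have rj': "32 * r (Suc j) \<le> r j" using mult_left_mono[OF scL, of "r j"] rpos[of j] by (simp add: rj)
    obtain k where k: "real (Suc k) * \<delta> = (r j)\<^sup>2" using grid[of j] j by (auto simp: r_def)
    obtain x0 where x0: "x0 \<in> balanced U0 (l + 0 * L) (real (Suc 0) * tol J)" "y \<in> supball x0 (3 * r 0 - 3 * r j)"
      using bal[of 0] by blast
    obtain xj where xj: "xj \<in> balanced U0 (l + j * L) (real (Suc j) * tol J)" "y \<in> supball xj 0"
      using bal[of j] by auto
    \<comment> \<open>At the last scale the allowed displacement is
      \<open>3 * r j - 3 * r j = 0\<close>.\<close>
    have "xj = y" using xj(2) by (auto simp: supball_def vec_eq_iff)
    with xj(1) have ybal: "\<bar>sigma_hat U0 (int (l + j * L)) y - 1 / 2\<bar> \<le> real (Suc j) * tol J" by (simp add: balanced_def)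
    define s where "s = sigma_hat U0 (int (l + Suc j * L))"
    define lo where "lo = 1 / 2 - real (Suc (Suc j)) * tol J"
    define hi where "hi = 1 / 2 + real (Suc (Suc j)) * tol J"
    have s: "s = dens (- U0) (r (Suc j))" unfolding s_def by (simp only: sigma_hat_nat[OF U0] r_def)
    have sj: "sigma_hat U0 (int (l + j * L)) = dens (- U0) (r j)" by (simp only: sigma_hat_nat[OF U0] r_def)
    have W: "- U0 \<in> sets borel" using U0 by auto
    have lohi: "lo \<le> hi" "0 \<le> lo" "hi \<le> 1" "tol J \<le> hi - lo" using acc[of "Suc (Suc j)"] j tolJ
      by (auto simp: lo_def hi_def algebra_simps intro: add_increasing)
    have ratio: "r (Suc j) / r j = radius L" using rpos[of j] by (simp add: rj)
    \<comment> \<open>The purpose of \<open>LJ\<close>: passing from one scale to the next loses at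
      most \<open>tol J / 2\<close> to the shell.\<close>
    have q: "c0 CARD('n) * (r (Suc j) / r j) \<le> tol J / 2" unfolding ratio using c0L by (simp add: tol_def)
    have rle: "r (Suc j) \<le> r j" using rj' rpos[of "Suc j"] by linarith
    have lower: "lo + 2 * (tol J / 2) \<le> dens (- U0) (r j) y" "1 - hi + 2 * (tol J / 2) \<le> dens U0 (r j) y"
      using ybal dens_compl[OF rpos U0, of j y] unfolding sj by (auto simp: lo_def hi_def abs_le_iff algebra_simps)
    have frac: "tol J / 2 * (2 * r j) ^ CARD('n) \<le> measure lborel (supball y (r j) \<inter> {v. lo \<le> s v})"
      unfolding s using lohi by (intro level_set_fraction rpos rle W q lower(1))
    have "tol J / 2 * (2 * r j) ^ CARD('n) \<le> measure lborel (supball y (r j) \<inter> {v. 1 - hi \<le> dens U0 (r (Suc j)) v})"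
      using lohi by (intro level_set_fraction rpos rle U0 q lower(2)) auto
    also have "{v. 1 - hi \<le> dens U0 (r (Suc j)) v} = {v. s v \<le> hi}"
      unfolding s using dens_compl[OF rpos U0, of "Suc j"] by auto
    finally have frac': "tol J / 2 * (2 * r j) ^ CARD('n) \<le> measure lborel (supball y (r j) \<inter> {v. s v \<le> hi})" .
    have main: "ennreal (p ^ n) * ennreal (tol J / 2 / 4 ^ CARD('n)) \<le> g y + of_nat (Suc k) * emeasure (gauss \<delta> :: (real^'n) measure) (- supball 0 e)"
    proof (rule level_hitting_bound[OF rpos \<delta> k])
      show "s \<in> borel_measurable borel" unfolding s using rpos W by (rule borel_measurable_dens)
      show "g \<in> borel_measurable borel" unfolding g_def by (rule measurable_hit[OF gm])
      show "\<bar>s (y + z) - s y\<bar> \<le> hi - lo" if "z \<in> supball 0 e" for y z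
        unfolding s_def using unif[OF j(1) that, of y] lohi(4) by (rule order_trans)
      show "ennreal (p ^ n) \<le> 1" using p by (simp add: power_le_one ennreal_le_1)
      fix y' assume y': "y' \<in> supball y (2 * r j)"
      \<comment> \<open>The stage adds \<open>2 * r j\<close> to the displacement. The
        \<open>r j\<close> left in reserve exceeds \<open>3 * r (Suc j)\<close>, since consecutive
        scales differ by a factor of at least 32.\<close>
      have far: "y' \<in> supball x (3 * r k - r j)" if "y \<in> supball x (3 * r k - 3 * r j)" for x k
        using supball_trans[OF that y'] by simp
      have "y' \<in> resonant U0 (l + 0 * L)"
      proof (rule res[OF x0(1)])
        show "y' \<in> supball x0 (3 * r 0)" by (rule supball_mono[OF far[OF x0(2)]]) (use rpos[of j] in simp)
      qed (use J in simp)
      then have y'R: "y' \<in> resonant U0 l" by simp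
      show "(\<integral>\<^sup>+ z. g (y' + z) \<partial>gauss \<delta>) \<le> g y'"
      proof (cases "y' \<in> A")
        case True
        have "(\<integral>\<^sup>+ z. g (y' + z) \<partial>gauss \<delta>) \<le> (\<integral>\<^sup>+ z. 1 \<partial>(gauss \<delta> :: (real^'n) measure))"
          unfolding g_def by (intro nn_integral_mono hit_le_1[OF gm])
        then show ?thesis using hit_target[OF gm True] G.emeasure_space_1 by (simp add: g_def)
      next
        case False
        then show ?thesis using hit_harmonic[OF gm False y'R] by (simp add: g_def)
      qed
      assume lev: "lo \<le> s y'" "s y' \<le> hi"
      show "ennreal (p ^ n) \<le> g y'"
        unfolding p_def g_def
      proof (rule Suc.IH)
        show "n < J" using Suc.prems by simp
        fix i assume "i \<le> J - 1 - n"
        then consider "i \<le> j" | "i = Suc j" using j by linarith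
        then show "\<exists>x\<in>balanced U0 (l + i * L) (real (Suc i) * tol J). y' \<in> supball x (3 * radius (l + i * L) - 3 * radius (l + (J - 1 - n) * L))"
        proof cases
          case 1
          then obtain x where x: "x \<in> balanced U0 (l + i * L) (real (Suc i) * tol J)" "y \<in> supball x (3 * r i - 3 * r j)"
            using bal[of i] by blast
          have "y' \<in> supball x (3 * r i - 3 * r (Suc j))"
            by (rule supball_mono[OF far[OF x(2)]]) (use rj' rpos[of "Suc j"] in simp)
          with x(1) show ?thesis by (unfold j(2) r_def[symmetric]) blast
        next
          case 2
          have "y' \<in> balanced U0 (l + i * L) (real (Suc i) * tol J)"
            using lev by (simp add: balanced_def 2 s_def lo_def hi_def abs_le_iff)
          moreover have "y' \<in> supball y' (3 * r i - 3 * r (Suc j))" by (simp add: 2 supball_def)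
          ultimately show ?thesis by (unfold j(2) r_def[symmetric]) blast
        qed
      qed
    qed (use frac frac' lohi in auto)
    have "g y \<le> 1" unfolding g_def by (rule hit_le_1[OF gm])
    then obtain \<gamma> where \<gamma>: "g y = ennreal \<gamma>" "0 \<le> \<gamma>" by (metis ennreal_cases ennreal_one_neq_top top.extremum_unique)
    have "real (Suc k) = (r j)\<^sup>2 / \<delta>" using k \<delta> by (simp add: field_simps)
    then have kb: "real (Suc k) * measure (gauss \<delta> :: (real^'n) measure) (- supball 0 e) \<le> p ^ J"
      using jumps[of j] j by (simp add: r_def p_def)
    have "ennreal (p ^ n * (2 * p)) = ennreal (p ^ n) * ennreal (tol J / 2 / 4 ^ CARD('n))"
      using p tolJ by (simp add: p_def step_prob_def flip: ennreal_mult)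
    also have "\<dots> \<le> ennreal (\<gamma> + real (Suc k) * measure (gauss \<delta> :: (real^'n) measure) (- supball 0 e))"
      using main \<gamma> by (simp add: G.emeasure_eq_measure ennreal_mult ennreal_plus ennreal_of_nat_eq_real_of_nat del: of_nat_Suc)
    finally have "p ^ n * (2 * p) \<le> \<gamma> + real (Suc k) * measure (gauss \<delta> :: (real^'n) measure) (- supball 0 e)"
      using \<gamma>(2) by (subst (asm) ennreal_le_iff) auto
    \<comment> \<open>The main estimate yields \<open>2 * p ^ Suc n\<close>; long jumps take at most
      \<open>p ^ J\<close>, hence at most half of it.\<close>
    moreover have "p ^ J \<le> p ^ Suc n" using p Suc.prems(1) by (intro power_decreasing) auto
    moreover have "p ^ n * (2 * p) = 2 * p ^ Suc n" by simp
    ultimately have "p ^ Suc n \<le> \<gamma>" using kb by linarith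
    then show ?case using \<gamma>(1) by (simp add: g_def p_def ennreal_leI del: power_Suc)
  }
qed

section \<open>Overlapping trials\<close>

definition walk :: "'a::comm_monoid_add \<Rightarrow> (nat \<Rightarrow> 'a) \<Rightarrow> nat \<Rightarrow> 'a" where
  "walk x \<xi> k = x + (\<Sum>i<k. \<xi> i)"

lemma walk_Suc: "walk x \<xi> (Suc k) = walk x \<xi> k + \<xi> k"
  by (simp add: walk_def add.assoc)

lemma walk_upd: "k \<le> n \<Longrightarrow> walk x (\<xi>(n := z)) k = walk x \<xi> k"
  by (simp add: walk_def)

lemma measurable_walk [measurable]:
  fixes x :: "'a::euclidean_space"
  assumes "sets N = sets borel" "k \<le> n"
  shows "(\<lambda>\<xi>. walk x \<xi> k) \<in> borel_measurable (Pi\<^sub>M {..<n} (\<lambda>_. N))"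
proof -
  have "(\<lambda>\<xi>. \<xi> i) \<in> borel_measurable (Pi\<^sub>M {..<n} (\<lambda>_. N))" if "i < k" for i
    using measurable_component_singleton[of i "{..<n}" "\<lambda>_. N"] that assms by (simp cong: measurable_cong_sets)
  then show ?thesis unfolding walk_def by (intro borel_measurable_add borel_measurable_sum) auto
qed

text \<open>Allows several trials to start at the same step, each paid for by one factor
  \<open>1 - b\<close>. The induction drops only the nonnegative product
  \<open>b * (x + k * b)\<close>.\<close>

lemma one_minus_diff_le_power:
  fixes b x :: real
  assumes "0 \<le> b" "b \<le> 1" "0 \<le> x"
  shows "1 - x - real k * b \<le> (1 - b) ^ k * (1 - x)"
proof (induction k)
  case (Suc k)
  have "0 \<le> b * (x + real k * b)" using assms by simp
  then have "1 - x - real (Suc k) * b \<le> (1 - b) * (1 - x - real k * b)"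
    by (simp add: algebra_simps)
  also have "\<dots> \<le> (1 - b) * ((1 - b) ^ k * (1 - x))"
    using Suc assms by (intro mult_left_mono) auto
  finally show ?case by simp
qed simp

text \<open>\<open>g i\<close> stands for the probability of reaching \<open>A\<close> before
  leaving \<open>Window i\<close>. Subharmonicity and the overlap bound are asked only off
  \<open>A\<close>, where the walk is still running.\<close>

locale trials =
  fixes N :: "(real^'n) measure" and A :: "(real^'n) set" and Start Window :: "nat \<Rightarrow> (real^'n) set"
    and g :: "nat \<Rightarrow> real^'n \<Rightarrow> real" and I J :: nat and c :: real
  assumes N: "prob_space N" "sets N = sets borel"
    and A [measurable]: "A \<in> sets borel"
    and Start [measurable]: "\<And>i. Start i \<in> sets borel"
    and g [measurable]: "\<And>i. g i \<in> borel_measurable borel"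
    and g_nonneg: "\<And>i y. 0 \<le> g i y" and g_le_1: "\<And>i y. g i y \<le> 1"
    and g_outside: "\<And>i y. i < I \<Longrightarrow> y \<notin> A \<Longrightarrow> y \<notin> Window i \<Longrightarrow> g i y = 0"
    and g_subharmonic: "\<And>i y. i < I \<Longrightarrow> y \<notin> A \<Longrightarrow> y \<in> Window i \<Longrightarrow> g i y \<le> (\<integral>z. g i (y + z) \<partial>N)"
    and g_start: "\<And>i y. i < I \<Longrightarrow> y \<in> Start i \<Longrightarrow> c \<le> g i y"
    and overlap: "\<And>y. y \<notin> A \<Longrightarrow> card {i. i < I \<and> y \<in> Window i} \<le> J"
    and J: "1 \<le> J" and c: "0 \<le> c" "c < 1"
begin

interpretation N: prob_space N by (rule N)

definition rate :: real where "rate = c / real J"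

lemma rate_bounds: "0 \<le> rate" "rate < 1"
proof -
  have "c / real J \<le> c / 1" using c J by (intro divide_left_mono) auto
  then show "0 \<le> rate" "rate < 1" using c by (auto simp: rate_def)
qed

text \<open>The sum runs over all started trials, including those that have left their window. Such
  a trial contributes 0, and re-entering the window only lowers the potential.\<close>

definition pot :: "nat set \<Rightarrow> real^'n \<Rightarrow> real" where
  "pot S y = (1 / (1 - rate)) ^ card S * (1 - (\<Sum>i\<in>S. g i y) / real J)"

text \<open>A new trial lowers the second factor by at least \<open>c / J\<close>, which offsets its
  factor \<open>1 / (1 - rate)\<close>.\<close>

lemma pot_Un:
  assumes "finite S" "finite T" "\<And>i. i \<in> T \<Longrightarrow> i < I \<and> y \<in> Start i"
  shows "pot (S \<union> T) y \<le> pot S y"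
proof -
  define T' where "T' = T - S"
  have T': "finite T'" "S \<inter> T' = {}" "S \<union> T = S \<union> T'" "\<And>i. i \<in> T' \<Longrightarrow> c \<le> g i y"
    using assms g_start by (auto simp: T'_def)
  define x where "x = (\<Sum>i\<in>S. g i y) / real J"
  have "real (card T') * c \<le> (\<Sum>i\<in>T'. g i y)"
    using T'(4) by (intro sum_bounded_below[of T' c, simplified]) auto
  then have "real (card T') * rate \<le> (\<Sum>i\<in>T'. g i y) / real J"
    using J by (simp add: rate_def divide_right_mono)
  then have "1 - (\<Sum>i\<in>S \<union> T'. g i y) / real J \<le> 1 - x - real (card T') * rate"
    using T' assms(1) by (simp add: sum.union_disjoint x_def add_divide_distrib)
  also have "\<dots> \<le> (1 - rate) ^ card T' * (1 - x)"
    using rate_bounds g_nonneg by (intro one_minus_diff_le_power) (auto simp: x_def intro!: sum_nonneg divide_nonneg_nonneg)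
  finally have *: "1 - (\<Sum>i\<in>S \<union> T'. g i y) / real J \<le> (1 - rate) ^ card T' * (1 - x)" .
  have "pot (S \<union> T') y \<le> (1 / (1 - rate)) ^ card (S \<union> T') * ((1 - rate) ^ card T' * (1 - x))"
    unfolding pot_def using * rate_bounds by (intro mult_left_mono) auto
  also have "\<dots> = pot S y"
    using T' assms(1) rate_bounds by (simp add: pot_def x_def card_Un_disjoint power_add power_divide)
  finally show ?thesis by (simp add: T'(3))
qed

definition started :: "real^'n \<Rightarrow> (nat \<Rightarrow> real^'n) \<Rightarrow> nat \<Rightarrow> nat set" where
  "started x \<xi> n = {i. i < I \<and> (\<exists>k\<le>n. walk x \<xi> k \<in> Start i)}"

lemma started_Suc: "started x \<xi> (Suc n) = started x \<xi> n \<union> {i. i < I \<and> walk x \<xi> (Suc n) \<in> Start i}"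
  by (auto simp: started_def le_Suc_eq)

lemma finite_started [simp]: "finite (started x \<xi> n)"
  by (simp add: started_def)

definition value_process :: "real^'n \<Rightarrow> nat \<Rightarrow> (nat \<Rightarrow> real^'n) \<Rightarrow> ennreal" where
  "value_process x n \<xi> = (if \<forall>k\<le>n. walk x \<xi> k \<notin> A then ennreal (pot (started x \<xi> n) (walk x \<xi> n)) else 0)"

lemma measurable_value_process:
  "value_process x n \<in> borel_measurable (Pi\<^sub>M {..<n} (\<lambda>_. N))"
proof -
  note [measurable] = measurable_walk[OF N(2)]
  \<comment> \<open>The set-valued \<open>started\<close> is resolved into a product and a sum over
    all \<open>i < I\<close> with conditions on finitely many positions, which are measurable term
    by term.\<close>
  have eq: "pot (started x \<xi> n) y =
      (\<Prod>i<I. if \<exists>k\<in>{..n}. walk x \<xi> k \<in> Start i then 1 / (1 - rate) else 1) *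
      (1 - (\<Sum>i<I. if \<exists>k\<in>{..n}. walk x \<xi> k \<in> Start i then g i y else 0) / real J)" for \<xi> y
  proof -
    have s: "started x \<xi> n = {i\<in>{..<I}. \<exists>k\<in>{..n}. walk x \<xi> k \<in> Start i}" by (auto simp: started_def)
    show ?thesis
      unfolding pot_def s prod_constant[symmetric] by (simp only: prod.inter_filter[symmetric] sum.inter_filter[symmetric] finite_lessThan)
  qed
  have [measurable]: "Measurable.pred (Pi\<^sub>M {..<n} (\<lambda>_. N)) (\<lambda>\<xi>. walk x \<xi> k \<in> D)" if "k \<le> n" "D \<in> sets borel" for k D
    using measurable_walk[OF N(2) that(1)] that(2) by measurable
  have 1[measurable]: "Measurable.pred (Pi\<^sub>M {..<n} (\<lambda>_. N)) (\<lambda>\<xi>. \<exists>k\<in>{..n}. walk x \<xi> k \<in> Start i)" for i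
    by (rule pred_intros_finite) auto
  have 2[measurable]: "Measurable.pred (Pi\<^sub>M {..<n} (\<lambda>_. N)) (\<lambda>\<xi>. \<forall>k\<in>{..n}. walk x \<xi> k \<notin> A)"
    by (rule pred_intros_finite) (auto intro!: pred_intros_logic)
  have [measurable]: "(\<lambda>\<xi>. walk x \<xi> n) \<in> borel_measurable (Pi\<^sub>M {..<n} (\<lambda>_. N))" by simp
  have "value_process x n = (\<lambda>\<xi>. if \<forall>k\<in>{..n}. walk x \<xi> k \<notin> A then ennreal (
      (\<Prod>i<I. if \<exists>k\<in>{..n}. walk x \<xi> k \<in> Start i then 1 / (1 - rate) else 1) *
      (1 - (\<Sum>i<I. if \<exists>k\<in>{..n}. walk x \<xi> k \<in> Start i then g i (walk x \<xi> n) else 0) / real J)) else 0)"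
    by (intro ext, unfold value_process_def eq, rule if_cong) auto
  also have "\<dots> \<in> borel_measurable (Pi\<^sub>M {..<n} (\<lambda>_. N))"
    by measurable
  finally show ?thesis .
qed

lemma pot_average:
  assumes "y \<notin> A" "S \<subseteq> {..<I}"
  shows "(\<integral>\<^sup>+ z. (if y + z \<notin> A then ennreal (pot (S \<union> {i. i < I \<and> y + z \<in> Start i}) (y + z)) else 0) \<partial>N) \<le> ennreal (pot S y)"
proof -
  note [measurable_cong] = N(2)
  \<comment> \<open>Keeping only the trials whose window contains \<open>y\<close> leaves at most
    \<open>J\<close> of them, so \<open>h\<close> is nonnegative at every next position, also in
    \<open>A\<close>, where the process drops to 0. Leaving out the others can only enlarge
    \<open>h\<close> there, and at \<open>y\<close> itself they contribute nothing.\<close>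
  define S' where "S' = {i\<in>S. y \<in> Window i}"
  have fin: "finite S" "finite S'" using assms(2) by (auto simp: S'_def finite_subset)
  have card: "card S' \<le> J"
  proof -
    have "S' \<subseteq> {i. i < I \<and> y \<in> Window i}" using assms(2) by (auto simp: S'_def)
    then have "card S' \<le> card {i. i < I \<and> y \<in> Window i}" by (intro card_mono) auto
    with overlap[OF assms(1)] show ?thesis by simp
  qed
  define h where "h u = (1 / (1 - rate)) ^ card S * (1 - (\<Sum>i\<in>S'. g i u) / real J)" for u
  have h0: "0 \<le> h u" for u
  proof -
    have "(\<Sum>i\<in>S'. g i u) \<le> real (card S') * 1" using g_le_1 by (intro sum_bounded_above) auto
    then have "(\<Sum>i\<in>S'. g i u) \<le> real J" using card by linarith
    then have "(\<Sum>i\<in>S'. g i u) / real J \<le> 1" using J by simp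
    then show ?thesis unfolding h_def using rate_bounds by (intro mult_nonneg_nonneg) auto
  qed
  have le: "(if y + z \<notin> A then ennreal (pot (S \<union> {i. i < I \<and> y + z \<in> Start i}) (y + z)) else 0) \<le> ennreal (h (y + z))" for z
  proof -
    have "pot (S \<union> {i. i < I \<and> y + z \<in> Start i}) (y + z) \<le> pot S (y + z)"
      using fin by (intro pot_Un) auto
    also have "\<dots> \<le> h (y + z)"
    proof -
      have "(\<Sum>i\<in>S'. g i (y + z)) \<le> (\<Sum>i\<in>S. g i (y + z))"
        using fin g_nonneg by (intro sum_mono2) (auto simp: S'_def)
      then show ?thesis unfolding pot_def h_def using rate_bounds J by (intro mult_left_mono) (auto intro: divide_right_mono)
    qed
    finally show ?thesis by (auto intro: ennreal_leI)
  qed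
  have gi: "integrable N (\<lambda>z. g i (y + z))" for i
    by (rule N.integrable_const_bound[where B = 1]) (use g_nonneg g_le_1 in \<open>auto simp: abs_le_iff intro: order_trans[OF _ g_nonneg]\<close>)
  have hi: "integrable N (\<lambda>z. h (y + z))" unfolding h_def using gi by auto
  have "(\<integral>z. h (y + z) \<partial>N) = (1 / (1 - rate)) ^ card S * (1 - (\<Sum>i\<in>S'. (\<integral>z. g i (y + z) \<partial>N)) / real J)"
    unfolding h_def using gi by (simp add: N.prob_space)
  also have "\<dots> \<le> (1 / (1 - rate)) ^ card S * (1 - (\<Sum>i\<in>S'. g i y) / real J)"
    using rate_bounds assms by (intro mult_left_mono diff_left_mono divide_right_mono sum_mono g_subharmonic) (auto simp: S'_def)
  also have "(\<Sum>i\<in>S'. g i y) = (\<Sum>i\<in>S. g i y)"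
    using fin assms g_outside by (intro sum.mono_neutral_left) (auto simp: S'_def)
  finally have int: "(\<integral>z. h (y + z) \<partial>N) \<le> pot S y" by (simp add: pot_def)
  have "(\<integral>\<^sup>+ z. (if y + z \<notin> A then ennreal (pot (S \<union> {i. i < I \<and> y + z \<in> Start i}) (y + z)) else 0) \<partial>N) \<le> (\<integral>\<^sup>+ z. ennreal (h (y + z)) \<partial>N)"
    by (intro nn_integral_mono le)
  also have "\<dots> = ennreal (\<integral>z. h (y + z) \<partial>N)"
    using hi h0 by (intro nn_integral_eq_integral) auto
  also have "\<dots> \<le> ennreal (pot S y)" using int by (rule ennreal_leI)
  finally show ?thesis .
qed

lemma value_process_le_1: "(\<integral>\<^sup>+ \<xi>. value_process x n \<xi> \<partial>Pi\<^sub>M {..<n} (\<lambda>_. N)) \<le> 1"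
proof (induction n)
  case 0
  \<comment> \<open>Some trials may start already at time 0.\<close>
  have "pot ({} \<union> {i. i < I \<and> x \<in> Start i}) x \<le> pot {} x" by (rule pot_Un) auto
  then have "pot {i. i < I \<and> x \<in> Start i} x \<le> 1" by (simp add: pot_def)
  then have "value_process x 0 \<xi> \<le> 1" for \<xi>
    by (auto simp: value_process_def walk_def started_def ennreal_le_1)
  then have "(\<integral>\<^sup>+ \<xi>. value_process x 0 \<xi> \<partial>Pi\<^sub>M {..<0} (\<lambda>_. N)) \<le> (\<integral>\<^sup>+ \<xi>. 1 \<partial>Pi\<^sub>M {..<0::nat} (\<lambda>_. N))"
    by (intro nn_integral_mono) auto
  then show ?case by (simp add: PiM_empty)
next
  case (Suc n)
  interpret P: product_sigma_finite "\<lambda>_::nat. N" ..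
  have upd: "value_process x (Suc n) (\<xi>(n := z)) =
     (if \<forall>k\<le>n. walk x \<xi> k \<notin> A then
       (if walk x \<xi> n + z \<notin> A then ennreal (pot (started x \<xi> n \<union> {i. i < I \<and> walk x \<xi> n + z \<in> Start i}) (walk x \<xi> n + z)) else 0)
      else 0)" for \<xi> z
  proof -
    have w: "walk x (\<xi>(n := z)) (Suc n) = walk x \<xi> n + z" by (simp add: walk_Suc walk_upd)
    have s: "started x (\<xi>(n := z)) n = started x \<xi> n" by (auto simp: started_def walk_upd)
    have a: "(\<forall>k\<le>Suc n. walk x (\<xi>(n := z)) k \<notin> A) \<longleftrightarrow> (\<forall>k\<le>n. walk x \<xi> k \<notin> A) \<and> walk x \<xi> n + z \<notin> A"
      by (auto simp: le_Suc_eq w walk_upd)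
    show ?thesis unfolding value_process_def a started_Suc w s by auto
  qed
  have "(\<integral>\<^sup>+ \<xi>. value_process x (Suc n) \<xi> \<partial>Pi\<^sub>M {..<Suc n} (\<lambda>_. N))
      = (\<integral>\<^sup>+ \<xi>. (\<integral>\<^sup>+ z. value_process x (Suc n) (\<xi>(n := z)) \<partial>N) \<partial>Pi\<^sub>M {..<n} (\<lambda>_. N))"
    unfolding lessThan_Suc using measurable_value_process[of x "Suc n"]
    by (intro P.product_nn_integral_insert) (auto simp: lessThan_Suc)
  also have "\<dots> \<le> (\<integral>\<^sup>+ \<xi>. value_process x n \<xi> \<partial>Pi\<^sub>M {..<n} (\<lambda>_. N))"
  proof (intro nn_integral_mono)
    fix \<xi>
    show "(\<integral>\<^sup>+ z. value_process x (Suc n) (\<xi>(n := z)) \<partial>N) \<le> value_process x n \<xi>"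
    proof (cases "\<forall>k\<le>n. walk x \<xi> k \<notin> A")
      case True
      then have "walk x \<xi> n \<notin> A" by auto
      moreover have "started x \<xi> n \<subseteq> {..<I}" by (auto simp: started_def)
      ultimately show ?thesis
        using pot_average[of "walk x \<xi> n" "started x \<xi> n"] True
        unfolding upd unfolding value_process_def by simp
    next
      case False
      then show ?thesis unfolding upd by (simp only: if_False) simp
    qed
  qed
  also have "\<dots> \<le> 1" by (rule Suc)
  finally show ?case .
qed

text \<open>Markov's inequality: on this event every trial has been started and none contributes to
  the sum, so the value process equals \<open>(1 / (1 - rate)) ^ I\<close>.\<close>

lemma avoid_probability_le:
  "measure (Pi\<^sub>M {..<n} (\<lambda>_. N)) {\<xi>\<in>space (Pi\<^sub>M {..<n} (\<lambda>_. N)). (\<forall>k\<le>n. walk x \<xi> k \<notin> A) \<and>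
      (\<forall>i<I. \<exists>k\<le>n. walk x \<xi> k \<in> Start i) \<and> (\<forall>i<I. g i (walk x \<xi> n) = 0)} \<le> (1 - c / real J) ^ I"
    (is "measure ?P ?E \<le> _")
proof -
  interpret P: product_prob_space "\<lambda>_::nat. N" "{..<n}" ..
  define K where "K = (1 / (1 - rate)) ^ I"
  have K: "0 < K" using rate_bounds by (simp add: K_def)
  have sub: "?E \<subseteq> {\<xi>\<in>space ?P. ennreal K \<le> value_process x n \<xi>}"
  proof safe
    fix \<xi> assume *: "\<forall>k\<le>n. walk x \<xi> k \<notin> A" "\<forall>i<I. \<exists>k\<le>n. walk x \<xi> k \<in> Start i" "\<forall>i<I. g i (walk x \<xi> n) = 0"
    have "started x \<xi> n = {..<I}" using *(2) by (auto simp: started_def)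
    then show "ennreal K \<le> value_process x n \<xi>" using * by (simp add: value_process_def pot_def K_def)
  qed
  have m: "{\<xi>\<in>space ?P. ennreal K \<le> value_process x n \<xi>} \<in> sets ?P"
    using measurable_value_process[of x n] by measurable
  have "ennreal K * emeasure ?P ?E \<le> ennreal K * emeasure ?P {\<xi>\<in>space ?P. ennreal K \<le> value_process x n \<xi>}"
    by (intro mult_left_mono emeasure_mono sub m) auto
  also have "\<dots> = (\<integral>\<^sup>+ \<xi>. ennreal K * indicator {\<xi>\<in>space ?P. ennreal K \<le> value_process x n \<xi>} \<xi> \<partial>?P)"
    by (rule nn_integral_cmult_indicator[symmetric, OF m])
  also have "\<dots> \<le> (\<integral>\<^sup>+ \<xi>. value_process x n \<xi> \<partial>?P)"
    by (intro nn_integral_mono) (auto split: split_indicator)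
  also have "\<dots> \<le> 1" by (rule value_process_le_1)
  finally have "ennreal (K * measure ?P ?E) \<le> 1"
    using K by (simp add: P.emeasure_eq_measure ennreal_mult)
  then have "K * measure ?P ?E \<le> 1" by (simp add: ennreal_le_1)
  then have "measure ?P ?E \<le> 1 / K" using K by (simp add: field_simps)
  also have "1 / K = (1 - c / real J) ^ I" using rate_bounds by (simp add: K_def rate_def power_one_over field_simps)
  finally show ?thesis .
qed

end

section \<open>Brownian motion on a time grid\<close>

lemma measurable_vec_lambda:
  "(\<lambda>f. \<chi> i. f i) \<in> (\<Pi>\<^sub>M i\<in>UNIV. borel :: real measure) \<rightarrow>\<^sub>M (borel :: (real^'n) measure)"
  unfolding borel_measurable_euclidean_space[of "\<lambda>f. \<chi> i. f i"]
proof
  fix b :: "real^'n" assume "b \<in> Basis"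
  then obtain i where b: "b = axis i 1" by (auto simp: Basis_vec_def)
  have "(\<lambda>f. f i) \<in> (\<Pi>\<^sub>M i\<in>UNIV. borel :: real measure) \<rightarrow>\<^sub>M borel"
    by (rule measurable_component_singleton) simp
  then show "(\<lambda>f. (\<chi> i. f i) \<bullet> b) \<in> borel_measurable (\<Pi>\<^sub>M i\<in>UNIV. borel)"
    by (simp add: b inner_axis)
qed

text \<open>A product measure is determined by its values on rectangles. This form matches the
  increments of \<open>BM_family\<close>, which are described by independent normal
  coordinates.\<close>

lemma gauss_eq_PiM:
  assumes "0 < \<delta>"
  shows "gauss \<delta> = distr (\<Pi>\<^sub>M i\<in>UNIV. density lborel (normal_density 0 (sqrt \<delta>))) borel (\<lambda>f. \<chi> i::'n::finite. f i)"
proof -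
  let ?D = "density lborel (\<lambda>u. ennreal (normal_density 0 (sqrt \<delta>) u))"
  interpret D: prob_space ?D by (rule prob_space_normal_density) (use assms in simp)
  interpret product_sigma_finite "\<lambda>_::'n. ?D" ..
  have m: "(\<lambda>z. \<lambda>i\<in>UNIV. z $ i) \<in> (gauss \<delta> :: (real^'n) measure) \<rightarrow>\<^sub>M (\<Pi>\<^sub>M i\<in>UNIV. ?D)"
    by (intro measurable_restrict) (simp add: measurable_cong_sets[OF sets_gauss] measurable_cong_sets[OF refl sets_density])
  have "distr (gauss \<delta> :: (real^'n) measure) (\<Pi>\<^sub>M i\<in>UNIV. ?D) (\<lambda>z. \<lambda>i\<in>UNIV. z $ i) = (\<Pi>\<^sub>M i\<in>UNIV. ?D)"
  proof (rule PiM_eqI)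
    fix A :: "'n \<Rightarrow> real set" assume "\<And>i. i \<in> UNIV \<Longrightarrow> A i \<in> sets ?D"
    then have A[measurable]: "A i \<in> sets borel" for i by simp
    have P: "Pi\<^sub>E UNIV A \<in> sets (\<Pi>\<^sub>M i\<in>UNIV. ?D)" by (intro sets_PiM_I_finite) auto
    have "emeasure (distr (gauss \<delta> :: (real^'n) measure) (\<Pi>\<^sub>M i\<in>UNIV. ?D) (\<lambda>z. \<lambda>i\<in>UNIV. z $ i)) (Pi\<^sub>E UNIV A)
        = emeasure (gauss \<delta> :: (real^'n) measure) {z. \<forall>i. z $ i \<in> A i}"
      by (subst emeasure_distr[OF m P]) (auto intro!: arg_cong[of _ _ "emeasure _"])
    also have "\<dots> = (\<integral>\<^sup>+ z. indicator {z. \<forall>i. z $ i \<in> A i} z \<partial>(gauss \<delta> :: (real^'n) measure))"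
      by (subst nn_integral_indicator) auto
    also have "\<dots> = (\<integral>\<^sup>+ z. (\<Prod>i\<in>UNIV. indicator (A i) (z $ i)) \<partial>(gauss \<delta> :: (real^'n) measure))"
      by (intro nn_integral_cong) (auto simp: indicator_def prod_zero_iff)
    also have "\<dots> = (\<Prod>i\<in>UNIV. \<integral>\<^sup>+ u. indicator (A i) u * ennreal (normal_density 0 (sqrt \<delta>) u) \<partial>lborel)"
      by (rule nn_integral_gauss_prod) auto
    also have "\<dots> = (\<Prod>i\<in>UNIV. emeasure ?D (A i))"
      by (intro prod.cong refl) (simp add: emeasure_density mult.commute)
    finally show "emeasure (distr (gauss \<delta> :: (real^'n) measure) (\<Pi>\<^sub>M i\<in>UNIV. ?D) (\<lambda>z. \<lambda>i\<in>UNIV. z $ i)) (Pi\<^sub>E UNIV A) = (\<Prod>i\<in>UNIV. emeasure ?D (A i))" .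
  qed auto
  then have "distr (\<Pi>\<^sub>M i\<in>UNIV. ?D) borel (\<lambda>f. \<chi> i::'n. f i)
     = distr (distr (gauss \<delta> :: (real^'n) measure) (\<Pi>\<^sub>M i\<in>UNIV. ?D) (\<lambda>z. \<lambda>i\<in>UNIV. z $ i)) borel (\<lambda>f. \<chi> i. f i)"
    by simp
  also have "\<dots> = distr (gauss \<delta>) borel (\<lambda>z. z)"
  proof (subst distr_distr)
    have "sets (\<Pi>\<^sub>M i\<in>(UNIV :: 'n set). borel :: real measure) = sets (\<Pi>\<^sub>M i\<in>(UNIV :: 'n set). ?D)"
      by (intro sets_PiM_cong) auto
    from measurable_cong_sets[OF this refl] measurable_vec_lambda
    show "(\<lambda>f. \<chi> i::'n. f i) \<in> (\<Pi>\<^sub>M i\<in>UNIV. ?D) \<rightarrow>\<^sub>M borel" by blast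
    have "(\<lambda>f. \<chi> i. f i) \<circ> (\<lambda>z. \<lambda>i\<in>UNIV. z $ i) = (\<lambda>z :: real^'n. z)"
      by (auto simp: fun_eq_iff vec_eq_iff)
    then show "distr (gauss \<delta>) borel ((\<lambda>f. \<chi> i. f i) \<circ> (\<lambda>z. \<lambda>i\<in>UNIV. z $ i)) = distr (gauss \<delta>) borel (\<lambda>z :: real^'n. z)"
      by simp
  qed (rule m)
  also have "\<dots> = gauss \<delta>" by (rule distr_id2) simp
  finally show ?thesis by simp
qed

locale brownian =
  fixes M :: "real^'n \<Rightarrow> 'w measure" and X :: "real^'n \<Rightarrow> real \<Rightarrow> 'w \<Rightarrow> real^'n"
  assumes BM: "BM_family M X"
begin

lemma prob_space_M: "prob_space (M x)"
  using BM by (simp add: BM_family_def)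

lemma X_measurable [measurable]: "0 \<le> t \<Longrightarrow> X x t \<in> borel_measurable (M x)"
  using BM by (simp add: BM_family_def)

lemma X_0: "\<omega> \<in> space (M x) \<Longrightarrow> X x 0 \<omega> = x"
  using BM by (simp add: BM_family_def)

lemma X_continuous: "\<omega> \<in> space (M x) \<Longrightarrow> continuous_on {0..} (\<lambda>t. X x t \<omega>)"
  using BM by (simp add: BM_family_def)

lemma increment_law:
  assumes "0 \<le> s" "s < t"
  shows "distr (M x) borel (\<lambda>\<omega>. X x t \<omega> - X x s \<omega>) = gauss (t - s)"
proof -
  interpret prob_space "M x" by (rule prob_space_M)
  let ?D = "density lborel (\<lambda>u. ennreal (normal_density 0 (sqrt (t - s)) u))"
  let ?Z = "\<lambda>\<omega>. X x t \<omega> - X x s \<omega>"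
  have Z: "?Z \<in> borel_measurable (M x)" using assms by (intro borel_measurable_diff X_measurable) auto
  have Zi: "(\<lambda>\<omega>. ?Z \<omega> $ i) \<in> borel_measurable (M x)" for i using Z by measurable
  have ind: "indep_vars (\<lambda>_. borel) (\<lambda>i \<omega>. ?Z \<omega> $ i) UNIV"
    and dist: "distributed (M x) lborel (\<lambda>\<omega>. ?Z \<omega> $ i) (normal_density 0 (sqrt (t - s)))" for i
    using BM assms by (auto simp: BM_family_def)
  have "distr (M x) borel (\<lambda>\<omega>. ?Z \<omega> $ i) = ?D" for i
    using distributed_distr_eq_density[OF dist, of i] by (simp cong: distr_cong)
  then have law: "distr (M x) (\<Pi>\<^sub>M i\<in>UNIV. borel) (\<lambda>\<omega>. \<lambda>i\<in>UNIV. ?Z \<omega> $ i) = (\<Pi>\<^sub>M i\<in>UNIV. ?D)"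
    using indep_vars_iff_distr_eq_PiM[where I = UNIV and M' = "\<lambda>_. borel" and X = "\<lambda>i \<omega>. ?Z \<omega> $ i"] ind Zi by simp
  have "gauss (t - s) = distr (distr (M x) (\<Pi>\<^sub>M i\<in>UNIV. borel) (\<lambda>\<omega>. \<lambda>i\<in>UNIV. ?Z \<omega> $ i)) borel (\<lambda>f. \<chi> i. f i)"
    unfolding law by (rule gauss_eq_PiM) (use assms in simp)
  also have "\<dots> = distr (M x) borel ?Z"
  proof (subst distr_distr[OF measurable_vec_lambda])
    show "(\<lambda>\<omega>. \<lambda>i\<in>UNIV. ?Z \<omega> $ i) \<in> M x \<rightarrow>\<^sub>M (\<Pi>\<^sub>M i\<in>UNIV. borel)"
      by (rule measurable_restrict) (rule Zi)
    have "(\<lambda>f. \<chi> i. f i) \<circ> (\<lambda>\<omega>. \<lambda>i\<in>UNIV. ?Z \<omega> $ i) = ?Z"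
      by (auto simp: fun_eq_iff vec_eq_iff)
    then show "distr (M x) borel ((\<lambda>f. \<chi> i. f i) \<circ> (\<lambda>\<omega>. \<lambda>i\<in>UNIV. ?Z \<omega> $ i)) = distr (M x) borel ?Z"
      by simp
  qed
  finally show ?thesis by simp
qed

definition steps :: "real^'n \<Rightarrow> real \<Rightarrow> nat \<Rightarrow> 'w \<Rightarrow> nat \<Rightarrow> real^'n" where
  "steps x \<delta> n \<omega> = (\<lambda>i\<in>{..<n}. X x (real (Suc i) * \<delta>) \<omega> - X x (real i * \<delta>) \<omega>)"

lemma steps_measurable:
  assumes "0 < \<delta>"
  shows "steps x \<delta> n \<in> M x \<rightarrow>\<^sub>M (\<Pi>\<^sub>M i\<in>{..<n}. gauss \<delta>)"
  unfolding steps_def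
proof (rule measurable_restrict)
  fix i
  have "(\<lambda>\<omega>. X x (real (Suc i) * \<delta>) \<omega> - X x (real i * \<delta>) \<omega>) \<in> borel_measurable (M x)"
    using assms by (intro borel_measurable_diff X_measurable) auto
  then show "(\<lambda>\<omega>. X x (real (Suc i) * \<delta>) \<omega> - X x (real i * \<delta>) \<omega>) \<in> M x \<rightarrow>\<^sub>M gauss \<delta>"
    by (simp cong: measurable_cong_sets)
qed

lemma steps_law:
  assumes "0 < \<delta>" "0 < n"
  shows "distr (M x) (\<Pi>\<^sub>M i\<in>{..<n}. gauss \<delta>) (steps x \<delta> n) = (\<Pi>\<^sub>M i\<in>{..<n}. gauss \<delta>)"
proof -
  interpret prob_space "M x" by (rule prob_space_M)
  let ?Z = "\<lambda>i \<omega>. X x (real (Suc i) * \<delta>) \<omega> - X x (real i * \<delta>) \<omega>"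
  have Z: "?Z i \<in> borel_measurable (M x)" for i
    using assms by (intro borel_measurable_diff X_measurable) auto
  have "\<And>(ts::nat \<Rightarrow> real) k. 0 \<le> ts 0 \<and> (\<forall>i<k. ts i < ts (Suc i)) \<Longrightarrow>
        indep_vars (\<lambda>_. borel) (\<lambda>i \<omega>. X x (ts (Suc i)) \<omega> - X x (ts i) \<omega>) {..<k}"
    using BM unfolding BM_family_def by blast
  from this[of "\<lambda>i. real i * \<delta>" n] have ind: "indep_vars (\<lambda>_. borel) ?Z {..<n}"
    using assms by simp
  have law: "distr (M x) borel (?Z i) = gauss \<delta>" for i
    using increment_law[of "real i * \<delta>" "real (Suc i) * \<delta>" x] assms by (simp add: algebra_simps)
  have "distr (M x) (\<Pi>\<^sub>M i\<in>{..<n}. borel) (\<lambda>\<omega>. \<lambda>i\<in>{..<n}. ?Z i \<omega>) = (\<Pi>\<^sub>M i\<in>{..<n}. gauss \<delta>)"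
    using indep_vars_iff_distr_eq_PiM[where I = "{..<n}" and M' = "\<lambda>_. borel" and X = ?Z] ind Z assms
    by (simp only: law) auto
  moreover have "distr (M x) (\<Pi>\<^sub>M i\<in>{..<n}. borel) (\<lambda>\<omega>. \<lambda>i\<in>{..<n}. ?Z i \<omega>) = distr (M x) (\<Pi>\<^sub>M i\<in>{..<n}. gauss \<delta>) (steps x \<delta> n)"
    by (intro distr_cong refl sets_PiM_cong) (auto simp: steps_def)
  ultimately show ?thesis by simp
qed

lemma walk_steps:
  assumes "\<omega> \<in> space (M x)" "k \<le> n"
  shows "walk x (steps x \<delta> n \<omega>) k = X x (real k * \<delta>) \<omega>"
  using assms(2)
proof (induction k)
  case 0
  show ?case using X_0[OF assms(1)] by (simp add: walk_def)
next
  case (Suc k)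
  then show ?case by (simp add: walk_Suc steps_def del: of_nat_Suc)
qed

lemma measure_steps:
  assumes "0 < \<delta>" "0 < n" "{\<xi>\<in>space (\<Pi>\<^sub>M i\<in>{..<n}. gauss \<delta>). Q \<xi>} \<in> sets (\<Pi>\<^sub>M i\<in>{..<n}. gauss \<delta>)"
  shows "measure (M x) {\<omega>\<in>space (M x). Q (steps x \<delta> n \<omega>)} = measure (\<Pi>\<^sub>M i\<in>{..<n}. gauss \<delta>) {\<xi>\<in>space (\<Pi>\<^sub>M i\<in>{..<n}. gauss \<delta>). Q \<xi>}"
    "{\<omega>\<in>space (M x). Q (steps x \<delta> n \<omega>)} \<in> sets (M x)"
proof -
  have m: "steps x \<delta> n \<in> M x \<rightarrow>\<^sub>M (\<Pi>\<^sub>M i\<in>{..<n}. gauss \<delta>)" by (rule steps_measurable) fact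
  have eq: "{\<omega>\<in>space (M x). Q (steps x \<delta> n \<omega>)} = steps x \<delta> n -` {\<xi>\<in>space (\<Pi>\<^sub>M i\<in>{..<n}. gauss \<delta>). Q \<xi>} \<inter> space (M x)"
    using measurable_space[OF m] by auto
  show "{\<omega>\<in>space (M x). Q (steps x \<delta> n \<omega>)} \<in> sets (M x)"
    unfolding eq using m assms(3) by (rule measurable_sets)
  show "measure (M x) {\<omega>\<in>space (M x). Q (steps x \<delta> n \<omega>)} = measure (\<Pi>\<^sub>M i\<in>{..<n}. gauss \<delta>) {\<xi>\<in>space (\<Pi>\<^sub>M i\<in>{..<n}. gauss \<delta>). Q \<xi>}"
    unfolding eq by (subst measure_distr[symmetric, OF m assms(3)]) (simp only: steps_law[OF assms(1,2)])
qed

text \<open>The steps have the same product law under both measures, and the starting point enters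
  \<open>walk\<close> only as a summand.\<close>

lemma grid_event_translate:
  assumes "0 < \<delta>" "0 < n" and C: "C \<in> sets borel" and D: "D = (\<lambda>y. x - x' + y) ` C"
  shows "measure (M x) {\<omega>\<in>space (M x). \<forall>k\<le>n. X x (real k * \<delta>) \<omega> \<in> D}
       = measure (M x') {\<omega>\<in>space (M x'). \<forall>k\<le>n. X x' (real k * \<delta>) \<omega> \<in> C}"
proof -
  have step: "measure (M x) {\<omega>\<in>space (M x). \<forall>k\<le>n. X x (real k * \<delta>) \<omega> \<in> C}
     = measure (\<Pi>\<^sub>M i\<in>{..<n}. gauss \<delta>) {\<xi>\<in>space (\<Pi>\<^sub>M i\<in>{..<n}. gauss \<delta>). \<forall>k\<le>n. walk x \<xi> k \<in> C}"
    if "C \<in> sets borel" for x C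
  proof -
    have [measurable]: "Measurable.pred (\<Pi>\<^sub>M i\<in>{..<n}. gauss \<delta>) (\<lambda>\<xi>. walk x \<xi> k \<in> C)" if "k \<le> n" for k
      using measurable_walk[OF sets_gauss that, of x \<delta>] \<open>C \<in> sets borel\<close> by measurable
    have "Measurable.pred (\<Pi>\<^sub>M i\<in>{..<n}. gauss \<delta>) (\<lambda>\<xi>. \<forall>k\<in>{..n}. walk x \<xi> k \<in> C)"
      by (rule pred_intros_finite) auto
    then have "{\<xi>\<in>space (\<Pi>\<^sub>M i\<in>{..<n}. gauss \<delta>). \<forall>k\<le>n. walk x \<xi> k \<in> C} \<in> sets (\<Pi>\<^sub>M i\<in>{..<n}. gauss \<delta>)"
      by (simp add: pred_def Ball_def)
    note measure_steps(1)[OF assms(1,2) this, of x, symmetric]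
    moreover have "{\<omega>\<in>space (M x). \<forall>k\<le>n. walk x (steps x \<delta> n \<omega>) k \<in> C} = {\<omega>\<in>space (M x). \<forall>k\<le>n. X x (real k * \<delta>) \<omega> \<in> C}"
      using walk_steps by auto
    ultimately show ?thesis by simp
  qed
  have Dm: "D \<in> sets borel"
  proof -
    have "D = (\<lambda>y. y - (x - x')) -` C \<inter> space borel" unfolding D by (auto simp: image_iff algebra_simps) (metis add.commute diff_add_cancel)
    then show ?thesis using measurable_sets[of "\<lambda>y. y - (x - x')" borel borel C] C by simp
  qed
  have "walk x \<xi> k \<in> D \<longleftrightarrow> walk x' \<xi> k \<in> C" for \<xi> k
    unfolding D by (auto simp: walk_def image_iff algebra_simps)
  then show ?thesis by (simp add: step[OF C] step[OF Dm])
qed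

end

section \<open>Avoiding the resonance set\<close>

text \<open>A single coordinate suffices, since its density is at most
  \<open>1 / sqrt (2 * pi * t)\<close>. The bound tends to 0 with growing \<open>t\<close>, so a
  fixed box is unlikely at late times.\<close>

lemma gauss_box_bound:
  assumes "0 < t" "0 \<le> K"
  shows "measure (gauss t :: (real^'n) measure) (supball 0 K) \<le> 2 * K / sqrt (2 * pi * t)"
proof -
  interpret prob_space "gauss t :: (real^'n) measure" by (rule prob_space_gauss) fact
  let ?c = "1 / sqrt (2 * pi * t)"
  have "emeasure (gauss t :: (real^'n) measure) (supball 0 K) \<le> (\<integral>\<^sup>+ z. indicator {- K..K} (z $ i) \<partial>(gauss t :: (real^'n) measure))" for i :: 'n
  proof -
    have "indicator (supball 0 K) z \<le> (indicator {- K..K} (z $ i) :: ennreal)" for z :: "real^'n"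
    proof (cases "z \<in> supball 0 K")
      case True
      then have "\<bar>z $ i\<bar> \<le> K" by (auto simp: supball_def)
      then have "z $ i \<in> {- K..K}" by auto
      then show ?thesis by (simp split: split_indicator)
    qed simp
    then have "(\<integral>\<^sup>+ z. indicator (supball 0 K) z \<partial>(gauss t :: (real^'n) measure)) \<le> (\<integral>\<^sup>+ z. indicator {- K..K} (z $ i) \<partial>(gauss t :: (real^'n) measure))"
      by (intro nn_integral_mono) auto
    then show ?thesis by simp
  qed
  also have "(\<integral>\<^sup>+ z. indicator {- K..K} (z $ i) \<partial>(gauss t :: (real^'n) measure)) = (\<integral>\<^sup>+ u. indicator {- K..K} u * ennreal (normal_density 0 (sqrt t) u) \<partial>lborel)" for i :: 'n
    using assms by (intro nn_integral_gauss_component) auto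
  also have "\<dots> \<le> (\<integral>\<^sup>+ u. ennreal ?c * indicator {- K..K} u \<partial>lborel)"
  proof (intro nn_integral_mono)
    fix u :: real
    have "normal_density 0 (sqrt t) u \<le> normal_density 0 (sqrt t) 0"
      using assms by (intro normal_density_antimono) auto
    also have "\<dots> = ?c" using assms by (simp add: normal_density_def)
    finally show "indicator {- K..K} u * ennreal (normal_density 0 (sqrt t) u) \<le> ennreal ?c * indicator {- K..K} u"
      by (auto split: split_indicator intro: ennreal_leI)
  qed
  also have "\<dots> = ennreal (2 * K / sqrt (2 * pi * t))"
    using assms by (subst nn_integral_cmult_indicator) (auto simp flip: ennreal_mult)
  finally show ?thesis using assms by (simp add: emeasure_eq_measure)
qed

text \<open>The first index at or above the level is close to it, because the value before was
  below.\<close>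

lemma discrete_crossing:
  fixes f :: "nat \<Rightarrow> real"
  assumes "f 0 \<le> a" "a \<le> f n" "\<And>k. k < n \<Longrightarrow> \<bar>f (Suc k) - f k\<bar> \<le> \<eta>" "0 \<le> \<eta>"
  shows "\<exists>k\<le>n. \<bar>f k - a\<bar> \<le> \<eta>"
proof -
  define k where "k = (LEAST k. a \<le> f k)"
  have k: "a \<le> f k" unfolding k_def by (rule LeastI[of _ n]) fact
  have kn: "k \<le> n" unfolding k_def by (rule Least_le) fact
  show ?thesis
  proof (cases k)
    case 0
    then show ?thesis using k assms by (intro exI[of _ 0]) auto
  next
    case (Suc j)
    then have "\<not> a \<le> f j" unfolding k_def using not_less_Least[of j "\<lambda>k. a \<le> f k"] by simp
    then show ?thesis using k kn assms(3)[of j] Suc by (intro exI[of _ k]) auto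
  qed
qed

lemma dens_far:
  assumes "0 < R" "R \<le> 4" "U \<subseteq> supball 0 \<rho>" "y \<notin> supball 0 (\<rho> + 4)"
  shows "dens (- U) R (y :: real^'n) = 1"
proof -
  have "supball y R \<inter> U = {}"
  proof (rule ccontr)
    assume "supball y R \<inter> U \<noteq> {}"
    then obtain z where "z \<in> supball y R" "z \<in> supball 0 \<rho>" using assms by auto
    then have "y \<in> supball 0 (\<rho> + R)" by (intro supball_trans[of z]) (simp_all add: supball_sym[of y])
    then show False using supball_mono[of y 0 "\<rho> + R" "\<rho> + 4"] assms by simp
  qed
  then have "supball y R \<inter> - U = supball y R" by auto
  then show ?thesis using assms by (simp add: dens_def measure_supball)
qed

lemma bounded_subset_supball:
  assumes "bounded (U :: (real^'n) set)"
  obtains \<rho> where "0 < \<rho>" "U \<subseteq> supball 0 \<rho>"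
proof -
  obtain \<rho> where "0 < \<rho>" "\<And>x. x \<in> U \<Longrightarrow> norm x \<le> \<rho>"
    using assms by (auto simp: bounded_pos)
  then show ?thesis
    by (intro that[of \<rho>]) (auto intro!: dist_imp_in_supball simp: dist_norm)
qed

section \<open>Dyadic scales and their blocks\<close>

lemma radius_le_1: "radius l \<le> 1"
  unfolding radius_def using powr_mono[of "- real l" 0 2] by simp

lemma radius_sq: "(radius l)\<^sup>2 = 1 / 4 ^ l"
proof -
  have "radius l = 1 / 2 ^ l" by (simp add: radius_def powr_minus powr_realpow inverse_eq_divide)
  moreover have "(2 ^ l)\<^sup>2 = (4 :: real) ^ l" by (simp add: power2_eq_square flip: power_mult_distrib)
  ultimately show ?thesis by (simp add: power_divide)
qed

text \<open>A stage at scale \<open>l\<close> lasts \<open>(radius l)\<^sup>2 = 1 / 4 ^ l\<close>,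
  that is, \<open>4 ^ (n - l)\<close> grid steps; a mesh \<open>1 / 4 ^ n\<close> therefore suits
  all scales up to \<open>n\<close>.\<close>

lemma radius_grid:
  assumes "l \<le> n"
  shows "\<exists>k. real (Suc k) * (1 / 4 ^ n) = (radius l)\<^sup>2"
proof (intro exI[of _ "4 ^ (n - l) - 1"])
  have "(4::real) ^ n = 4 ^ (n - l) * 4 ^ l" using assms by (simp flip: power_add)
  moreover have "real (Suc (4 ^ (n - l) - 1)) = 4 ^ (n - l)" by (simp add: of_nat_diff)
  ultimately show "real (Suc (4 ^ (n - l) - 1)) * (1 / 4 ^ n) = (radius l)\<^sup>2"
    by (simp add: radius_sq del: of_nat_Suc)
qed

text \<open>The least element exists because \<open>c0 d / 2 ^ L\<close> tends to 0, and its bound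
  persists for larger \<open>L\<close>.\<close>

lemma LJ_bounds:
  assumes "1 \<le> J" "LJ d J \<le> L"
  shows "5 \<le> L" "c0 d * radius L \<le> 1 / (200 * real J)"
proof -
  have "(\<lambda>L. c0 d * (1 / 2) ^ L) \<longlonglongrightarrow> c0 d * 0" by (intro tendsto_intros) auto
  then have "eventually (\<lambda>L. c0 d * (1 / 2) ^ L < 1 / (200 * real J)) sequentially"
    by (rule order_tendstoD) (use assms in simp)
  then obtain m where m: "\<And>L. m \<le> L \<Longrightarrow> c0 d * (1 / 2) ^ L < 1 / (200 * real J)"
    by (auto simp: eventually_sequentially)
  have pw: "2 powr (- real k) = (1 / 2 :: real) ^ k" for k
    by (simp add: powr_minus powr_realpow inverse_eq_divide power_one_over)
  have "5 \<le> max 5 m \<and> c0 d * 2 powr (- real (max 5 m)) \<le> 1 / (200 * real J)"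
    unfolding pw using m[of "max 5 m"] by auto
  then have *: "5 \<le> LJ d J \<and> c0 d * 2 powr (- real (LJ d J)) \<le> 1 / (200 * real J)"
    unfolding LJ_def by (rule LeastI)
  then show "5 \<le> L" using assms by simp
  have "c0 d * radius L \<le> c0 d * radius (LJ d J)"
    unfolding radius_def using assms by (intro mult_left_mono powr_mono) (auto simp: c0_def)
  with * show "c0 d * radius L \<le> 1 / (200 * real J)" by (simp add: radius_def)
qed

lemma ell0_props:
  assumes "0 < L"
  shows "(J + 1) * L dvd ell0 lstar J L" "lstar \<le> ell0 lstar J L"
proof -
  \<comment> \<open>The multiple \<open>(J + 1) * L * lstar\<close> is a witness for the least
    element.\<close>
  have "1 * lstar \<le> (J + 1) * L * lstar" using assms by (intro mult_right_mono) auto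
  then have "(J + 1) * L dvd (J + 1) * L * lstar \<and> lstar \<le> (J + 1) * L * lstar" by simp
  then have "(J + 1) * L dvd ell0 lstar J L \<and> lstar \<le> ell0 lstar J L"
    unfolding ell0_def by (rule LeastI)
  then show "(J + 1) * L dvd ell0 lstar J L" "lstar \<le> ell0 lstar J L" by auto
qed

text \<open>The top scale of trial \<open>i\<close>. A block has length \<open>(J + 1) * L\<close>,
  so the \<open>J\<close> scales used by one trial end before the next block begins.\<close>

definition block :: "nat \<Rightarrow> nat \<Rightarrow> nat \<Rightarrow> nat \<Rightarrow> nat" where
  "block lstar J L i = ell0 lstar J L + i * (J + 1) * L"

lemma block_Astar:
  assumes "0 < L" "i < I" "j < J"
  shows "block lstar J L i + j * L \<in> Astar lstar J L I"
proof -
  have "L dvd ell0 lstar J L" using ell0_props(1)[OF assms(1)] by (rule dvd_trans[rotated]) simp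
  moreover have "i * (J + 1) * L + j * L < I * (J + 1) * L"
  proof -
    have "i * (J + 1) + j < Suc i * (J + 1)" using assms by simp
    also have "\<dots> \<le> I * (J + 1)" using assms by (intro mult_right_mono) auto
    finally show ?thesis using assms(1) by (simp flip: add_mult_distrib)
  qed
  ultimately show ?thesis unfolding Astar_def block_def by auto
qed

lemma inj_block:
  assumes "0 < L" shows "inj (block lstar J L)"
proof (rule injI)
  fix x y assume "block lstar J L x = block lstar J L y"
  then have "x * ((J + 1) * L) = y * ((J + 1) * L)"
    by (simp only: block_def mult.assoc add_left_cancel)
  then show "x = y" using assms by (simp only: mult_cancel2) auto
qed

context brownian
begin

text \<open>The error \<open>\<epsilon>\<close> covers long steps and a position near
  \<open>U0\<close> at the final time. The order of choices matters: \<open>e\<close> depends on the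
  finitely many scales, \<open>T\<close> on \<open>\<epsilon>\<close>, and the mesh comes last,
  since the number of steps is \<open>T * 4 ^ n\<close>.\<close>

lemma avoid_Res_bound_approx:
  fixes U0 :: "(real^'n) set"
  assumes U0: "U0 \<in> Ucal lstar {0}" and L: "LJ CARD('n) J \<le> L" and J: "1 \<le> J" and \<epsilon>: "0 < \<epsilon>"
  shows "nohit_prob M X (Res U0 lstar J L I) 0 \<le> (1 - step_prob CARD('n) J ^ J / real J) ^ I + \<epsilon>"
proof -
  define A where "A = Res U0 lstar J L I"
  define p where "p = step_prob CARD('n) J"
  have p: "0 < p" "p < 1" using step_prob[OF J] by (auto simp: p_def)
  note L5 = LJ_bounds[OF J L]
  have L0: "0 < L" using L5 by simp
  have Ub: "U0 \<in> sets borel" and bdd: "bounded U0"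
    and half: "\<And>l. lstar \<le> l \<Longrightarrow> sigma_hat U0 (int l) 0 \<le> 1 / 2" using U0 by (auto simp: Ucal_def)
  have W: "- U0 \<in> sets borel" using Ub by auto
  have cA: "closed A" unfolding A_def by (rule closed_Res[OF Ub])
  then have A[measurable]: "A \<in> sets borel" by auto
  define l where "l i = block lstar J L i" for i
  have tol: "0 < tol J" using J by (simp add: tol_def)
  obtain \<rho> where \<rho>: "0 < \<rho>" "U0 \<subseteq> supball 0 \<rho>" using bounded_subset_supball[OF bdd] .
  \<comment> \<open>The largest balls in use have radius \<open>4 * radius m\<close>, at most 4;
    around points outside this box they miss \<open>U0\<close>.\<close>
  define K where "K = \<rho> + 4"
  have far_hat: "sigma_hat U0 (int m) y = 1" if "y \<notin> supball 0 K" for m y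
    unfolding sigma_hat_nat[OF Ub] using that radius_le_1[of m] \<rho> by (intro dens_far) (auto simp: K_def)
  have far_tilde: "sigma_tilde U0 (int m) y = 1" if "y \<notin> supball 0 K" for m y
    unfolding sigma_tilde_nat[OF Ub] using that radius_le_1[of m] \<rho> by (intro dens_far) (auto simp: K_def)
  have far: "y \<notin> resonant U0 m" if "y \<notin> supball 0 K" for m y
    using far_tilde[OF that, of m] by (simp add: resonant_def alpha_tilde_def)
  obtain e where e: "0 < e" "\<And>i j y z. i < I \<Longrightarrow> j < J \<Longrightarrow> z \<in> supball 0 e \<Longrightarrow>
       \<bar>sigma_hat U0 (int (l i + j * L)) (y + z) - sigma_hat U0 (int (l i + j * L)) y\<bar> \<le> tol J"
  proof -
    have "\<exists>e>0. \<forall>x y :: real^'n. y \<in> supball x e \<longrightarrow> \<bar>dens (- U0) (radius m) y - dens (- U0) (radius m) x\<bar> \<le> tol J" for m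
      using dens_uniform[OF radius_pos W tol, of m] by metis
    then obtain f where f: "\<And>m. 0 < f m" "\<And>m x y :: real^'n. y \<in> supball x (f m) \<Longrightarrow> \<bar>dens (- U0) (radius m) y - dens (- U0) (radius m) x\<bar> \<le> tol J"
      by metis
    \<comment> \<open>The element 1 keeps \<open>Min\<close> meaningful when there are no scales, as
      for \<open>I = 0\<close>.\<close>
    define S where "S = insert 1 (f ` Astar lstar J L I)"
    have S: "finite S" "S \<noteq> {}" by (auto simp: S_def)
    show ?thesis
    proof (rule that[of "Min S"])
      show "0 < Min S" using S f(1) by (subst Min_gr_iff) (auto simp: S_def)
      fix i j y and z :: "real^'n" assume ij: "i < I" "j < J" and z: "z \<in> supball 0 (Min S)"
      have "f (l i + j * L) \<in> S" unfolding S_def l_def using block_Astar[OF L0 ij] by auto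
      then have "Min S \<le> f (l i + j * L)" using S by auto
      then have "y + z \<in> supball y (f (l i + j * L))" using supball_mono[OF z] by (simp add: supball_def)
      from f(2)[OF this]
      show "\<bar>sigma_hat U0 (int (l i + j * L)) (y + z) - sigma_hat U0 (int (l i + j * L)) y\<bar> \<le> tol J"
        unfolding sigma_hat_nat[OF Ub] .
    qed
  qed
  \<comment> \<open>A step is long with probability at most \<open>C * \<delta>\<^sup>2\<close>, so
    all \<open>T / \<delta>\<close> steps together contribute at most
    \<open>T * C * \<delta>\<close>.\<close>
  define C where "C = real CARD('n) * 3 / e ^ 4"
  have C: "0 < C" using e by (simp add: C_def)
  obtain T :: nat where T: "0 < T" "2 * K / sqrt (2 * pi * real T) \<le> \<epsilon> / 2"
  proof -
    have "((\<lambda>T. 2 * K / sqrt (2 * pi * real T)) \<longlongrightarrow> 0) sequentially"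
      by real_asymp
    then have "eventually (\<lambda>T. 2 * K / sqrt (2 * pi * real T) < \<epsilon> / 2) sequentially"
      by (rule order_tendstoD) (use \<epsilon> in simp)
    then have "eventually (\<lambda>T. 2 * K / sqrt (2 * pi * real T) < \<epsilon> / 2 \<and> 0 < T) sequentially"
      by (intro eventually_conj eventually_gt_at_top)
    then show ?thesis using that by (auto dest!: eventually_happens intro: less_imp_le)
  qed
  obtain n where n: "\<And>i j. i < I \<Longrightarrow> j < J \<Longrightarrow> l i + j * L \<le> n" "C * (1 / 4 ^ n) \<le> p ^ J" "real T * (C * (1 / 4 ^ n)) \<le> \<epsilon> / 2"
  proof -
    have t: "((\<lambda>n. c * (1 / 4 ^ n)) \<longlongrightarrow> 0) sequentially" for c :: real
      by real_asymp
    have "eventually (\<lambda>n. C * (1 / 4 ^ n) < p ^ J) sequentially"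
      by (rule order_tendstoD[OF t]) (use p in simp)
    moreover have "eventually (\<lambda>n. real T * C * (1 / 4 ^ n) < \<epsilon> / 2) sequentially"
      by (rule order_tendstoD[OF t]) (use \<epsilon> in simp)
    moreover have "eventually (\<lambda>n. ell0 lstar J L + I * (J + 1) * L \<le> n) sequentially"
      by (rule eventually_ge_at_top)
    ultimately have "eventually (\<lambda>n. C * (1 / 4 ^ n) < p ^ J \<and> real T * C * (1 / 4 ^ n) < \<epsilon> / 2 \<and> ell0 lstar J L + I * (J + 1) * L \<le> n) sequentially"
      by eventually_elim auto
    then obtain n where n: "C * (1 / 4 ^ n) < p ^ J" "real T * C * (1 / 4 ^ n) < \<epsilon> / 2" "ell0 lstar J L + I * (J + 1) * L \<le> n"
      by (auto dest!: eventually_happens)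
    show ?thesis
    proof (rule that[of n])
      show "l i + j * L \<le> n" if "i < I" "j < J" for i j
        using block_Astar[OF L0 that, of lstar] n(3) by (simp add: Astar_def l_def)
    qed (use n in \<open>auto simp: mult.assoc\<close>)
  qed
  define \<delta> :: real where "\<delta> = 1 / 4 ^ n"
  define m where "m = T * 4 ^ n"
  have \<delta>: "0 < \<delta>" by (simp add: \<delta>_def)
  have m: "0 < m" "real m * \<delta> = real T" using T by (auto simp: m_def \<delta>_def)
  interpret G: prob_space "gauss \<delta> :: (real^'n) measure" by (rule prob_space_gauss) fact
  interpret P: prob_space "M 0" by (rule prob_space_M)
  define \<beta> where "\<beta> = measure (gauss \<delta> :: (real^'n) measure) (- supball 0 e)"
  have \<beta>: "\<beta> \<le> C * \<delta>\<^sup>2" "0 \<le> \<beta>"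
    using gauss_jump_bound[OF \<delta> e(1), where ?'n = 'n] by (simp_all add: \<beta>_def C_def)
  have \<beta>': "\<beta> / \<delta> \<le> C * \<delta>" using \<beta>(1) \<delta> by (simp add: power2_eq_square pos_divide_le_eq mult.assoc)
  define g where "g i y = enn2real (hit (gauss \<delta>) A (resonant U0 (l i)) y)" for i y
  have R: "resonant U0 k \<in> sets borel" for k using closed_resonant[OF Ub] by auto
  note gm = G.prob_space_axioms sets_gauss A R
  have g_hit: "ennreal (g i y) = hit (gauss \<delta>) A (resonant U0 (l i)) y" for i y
    unfolding g_def using hit_le_1[OF gm, of "l i" y] by (intro ennreal_enn2real) (auto simp: less_top[symmetric] top_unique)
  have trials: "trials (gauss \<delta>) A (\<lambda>i. balanced U0 (l i) (tol J)) (\<lambda>i. resonant U0 (l i)) g I J (p ^ J)"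
  proof
    show "balanced U0 (l i) (tol J) \<in> sets borel" for i
    proof -
      have [measurable]: "dens (- U0) (radius (l i)) \<in> borel_measurable borel" using W by (intro borel_measurable_dens) auto
      show ?thesis unfolding balanced_def sigma_hat_nat[OF Ub] by measurable
    qed
    show "g i \<in> borel_measurable borel" for i
      unfolding g_def using measurable_hit[OF gm, of "l i"] by measurable
    show g0: "0 \<le> g i y" for i y by (simp add: g_def)
    show g1: "g i y \<le> 1" for i y
    proof -
      have "ennreal (g i y) \<le> ennreal 1" unfolding g_hit using hit_le_1[OF gm] by simp
      then show ?thesis by (subst (asm) ennreal_le_iff) auto
    qed
    show "g i y = 0" if "y \<notin> A" "y \<notin> resonant U0 (l i)" for i y
      using hit_outside[OF gm that] by (simp add: g_def)
    show "g i y \<le> (\<integral>z. g i (y + z) \<partial>gauss \<delta>)" if "y \<notin> A" "y \<in> resonant U0 (l i)" for i y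
    proof -
      have [measurable]: "g i \<in> borel_measurable borel"
        unfolding g_def using measurable_hit[OF gm, of "l i"] by measurable
      have int: "integrable (gauss \<delta>) (\<lambda>z. g i (y + z))"
        by (rule G.integrable_const_bound[where B = 1]) (use g0 g1 in auto)
      have "ennreal (g i y) = (\<integral>\<^sup>+ z. ennreal (g i (y + z)) \<partial>gauss \<delta>)"
        unfolding g_hit by (rule hit_harmonic[OF gm that, symmetric])
      also have "\<dots> = ennreal (\<integral>z. g i (y + z) \<partial>gauss \<delta>)"
        using int by (intro nn_integral_eq_integral) (auto simp: g_def)
      finally show ?thesis by (subst (asm) ennreal_inj) (auto simp: g_def intro!: integral_nonneg_AE)
    qed
    show "p ^ J \<le> g i y" if i: "i < I" and y: "y \<in> balanced U0 (l i) (tol J)" for i y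
    proof -
      have "ennreal (step_prob CARD('n) J ^ (J - 1)) \<le> hit (gauss \<delta>) A (resonant U0 (l i)) y"
      proof (rule hit_chain[OF Ub J L5 A])
        show "z \<in> A" if "\<forall>k<J. z \<in> resonant U0 (l i + k * L)" for z
        proof -
          have "(\<lambda>k. l i + k * L) ` {..<J} \<subseteq> {k \<in> Astar lstar J L I. z \<in> resonant U0 k}"
            using that block_Astar[OF L0 i] by (auto simp: l_def)
          then have "card ((\<lambda>k. l i + k * L) ` {..<J}) \<le> card {k \<in> Astar lstar J L I. z \<in> resonant U0 k}"
            by (intro card_mono) auto
          moreover have "card ((\<lambda>k. l i + k * L) ` {..<J}) = J"
            using L0 by (subst card_image) (auto simp: inj_on_def)
          ultimately show ?thesis by (simp add: A_def Res_eq)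
        qed
        show "\<exists>k. real (Suc k) * \<delta> = (radius (l i + j * L))\<^sup>2" if "j < J" for j
          unfolding \<delta>_def by (rule radius_grid) (rule n(1)[OF i that])
        show "\<bar>sigma_hat U0 (int (l i + j * L)) (y + z) - sigma_hat U0 (int (l i + j * L)) y\<bar> \<le> tol J"
          if "j < J" "z \<in> supball 0 e" for j y z by (rule e(2)[OF i that])
        show "(radius (l i + j * L))\<^sup>2 / \<delta> * measure (gauss \<delta> :: (real^'n) measure) (- supball 0 e) \<le> step_prob CARD('n) J ^ J" for j
        proof -
          have "(radius (l i + j * L))\<^sup>2 / \<delta> * \<beta> \<le> 1 / \<delta> * \<beta>"
            using \<beta>(2) \<delta> radius_le_1[of "l i + j * L"] less_imp_le[OF radius_pos[of "l i + j * L"]]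
            by (intro mult_right_mono divide_right_mono) (auto simp: power_le_one)
          also have "\<dots> \<le> C * \<delta>" using \<beta>' by simp
          also have "\<dots> \<le> p ^ J" using n(2) by (simp add: \<delta>_def)
          finally show ?thesis by (simp add: \<beta>_def p_def)
        qed
        \<comment> \<open>With \<open>J - 1\<close> stages to go only the top scale has been met,
          with displacement 0, and \<open>y\<close> is its own witness.\<close>
        show "\<exists>x\<in>balanced U0 (l i + k * L) (real (Suc k) * tol J). y \<in> supball x (3 * radius (l i + k * L) - 3 * radius (l i + (J - 1 - (J - 1)) * L))"
          if "k \<le> J - 1 - (J - 1)" for k
          using that y by (auto simp: supball_def intro!: bexI[of _ y])
      qed (use \<delta> J in auto)
      then have "ennreal (p ^ (J - 1)) \<le> ennreal (g i y)" by (simp add: g_hit p_def)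
      then have "p ^ (J - 1) \<le> g i y" by (subst (asm) ennreal_le_iff) (auto simp: g_def)
      \<comment> \<open>For \<open>J = 1\<close> the stronger bound \<open>p ^ (J - 1)\<close>
        equals 1, whereas the locale asks for a constant below 1.\<close>
      moreover have "p ^ J \<le> p ^ (J - 1)" using p by (intro power_decreasing) auto
      ultimately show ?thesis by simp
    qed
    show "card {i. i < I \<and> y \<in> resonant U0 (l i)} \<le> J" if "y \<notin> A" for y
    proof -
      \<comment> \<open>Different blocks have different top scales, all in \<open>Astar\<close>, and
        off the resonance set fewer than \<open>J\<close> of those are resonant.\<close>
      have "card {i. i < I \<and> y \<in> resonant U0 (l i)} = card (l ` {i. i < I \<and> y \<in> resonant U0 (l i)})"
        using inj_block[OF L0, of lstar J] by (intro card_image[symmetric]) (auto simp: inj_on_def inj_def l_def)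
      also have "\<dots> \<le> card {k \<in> Astar lstar J L I. y \<in> resonant U0 k}"
        using block_Astar[OF L0, of _ I 0 J lstar] J by (intro card_mono) (auto simp: l_def)
      also have "\<dots> < J" using that by (simp add: A_def Res_eq)
      finally show ?thesis by simp
    qed
    show "p ^ J < 1" using p J by (simp add: power_less_one_iff)
  qed (use J p A in \<open>auto intro: G.prob_space_axioms\<close>)
  interpret trials "gauss \<delta>" A "\<lambda>i. balanced U0 (l i) (tol J)" "\<lambda>i. resonant U0 (l i)" g I J "p ^ J"
    by (rule trials)
  let ?PM = "\<Pi>\<^sub>M i\<in>{..<m}. (gauss \<delta> :: (real^'n) measure)"
  define Q where "Q \<xi> \<longleftrightarrow> (\<forall>k\<le>m. walk 0 \<xi> k \<notin> A) \<and> (\<forall>i<I. \<exists>k\<le>m. walk 0 \<xi> k \<in> balanced U0 (l i) (tol J)) \<and> (\<forall>i<I. g i (walk 0 \<xi> m) = 0)" for \<xi>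
  have QE: "{\<xi>\<in>space ?PM. Q \<xi>} \<in> sets ?PM"
  proof -
    have [measurable]: "Measurable.pred ?PM (\<lambda>\<xi>. walk 0 \<xi> k \<in> D)" if "k \<le> m" "D \<in> sets borel" for k D
      using measurable_walk[OF sets_gauss that(1), of 0 \<delta>] that(2) by measurable
    have [measurable]: "(\<lambda>\<xi>. walk 0 \<xi> m) \<in> borel_measurable ?PM" by (rule measurable_walk) auto
    have "Measurable.pred ?PM (\<lambda>\<xi>. (\<forall>k\<in>{..m}. walk 0 \<xi> k \<notin> A) \<and> (\<forall>i\<in>{..<I}. \<exists>k\<in>{..m}. walk 0 \<xi> k \<in> balanced U0 (l i) (tol J)) \<and> (\<forall>i\<in>{..<I}. g i (walk 0 \<xi> m) = 0))"
      by (intro pred_intros_logic pred_intros_finite) (auto intro!: pred_intros_logic)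
    then show ?thesis by (simp add: pred_def Q_def Ball_def Bex_def)
  qed
  define E1 where "E1 = {\<omega>\<in>space (M 0). Q (steps 0 \<delta> m \<omega>)}"
  have E1: "E1 \<in> P.events"
    unfolding E1_def by (rule measure_steps(2)[OF \<delta> m(1) QE])
  have "P.prob E1 = measure ?PM {\<xi>\<in>space ?PM. Q \<xi>}"
    unfolding E1_def by (rule measure_steps(1)[OF \<delta> m(1) QE])
  also have "\<dots> \<le> (1 - p ^ J / real J) ^ I"
    unfolding Q_def by (rule avoid_probability_le)
  finally have E1': "P.prob E1 \<le> (1 - p ^ J / real J) ^ I" .
  define inc where "inc k \<omega> = X 0 (real (Suc k) * \<delta>) \<omega> - X 0 (real k * \<delta>) \<omega>" for k \<omega>
  have inc[measurable]: "inc k \<in> borel_measurable (M 0)" for k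
    unfolding inc_def using \<delta> by (intro borel_measurable_diff X_measurable) auto
  define E2 where "E2 = (\<Union>k<m. inc k -` (- supball 0 e) \<inter> space (M 0))"
  have E2: "E2 \<in> P.events" unfolding E2_def by (intro sets.finite_UN measurable_sets[OF inc]) auto
  have "P.prob E2 \<le> (\<Sum>k<m. P.prob (inc k -` (- supball 0 e) \<inter> space (M 0)))"
    unfolding E2_def by (intro P.finite_measure_subadditive_finite) (auto intro!: measurable_sets[OF inc])
  also have "\<dots> = (\<Sum>k<m. \<beta>)"
  proof (intro sum.cong refl)
    fix k
    have "distr (M 0) borel (inc k) = gauss \<delta>"
      using increment_law[of "real k * \<delta>" "real (Suc k) * \<delta>" 0] \<delta> by (simp add: algebra_simps inc_def[abs_def])
    then show "P.prob (inc k -` (- supball 0 e) \<inter> space (M 0)) = \<beta>"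
      unfolding \<beta>_def by (subst measure_distr[symmetric, OF inc]) auto
  qed
  also have "\<dots> = real T / \<delta> * \<beta>" using m(2) \<delta> by (simp add: field_simps)
  also have "\<dots> \<le> real T * (C * \<delta>)" using mult_left_mono[OF \<beta>', of "real T"] by simp
  also have "\<dots> \<le> \<epsilon> / 2" using n(3) by (simp add: \<delta>_def)
  finally have E2': "P.prob E2 \<le> \<epsilon> / 2" .
  define E3 where "E3 = (\<lambda>\<omega>. X 0 (real T) \<omega> - X 0 0 \<omega>) -` supball 0 K \<inter> space (M 0)"
  have XT: "(\<lambda>\<omega>. X 0 (real T) \<omega> - X 0 0 \<omega>) \<in> borel_measurable (M 0)"
    by (intro borel_measurable_diff X_measurable) auto
  have E3: "E3 \<in> P.events" unfolding E3_def by (intro measurable_sets[OF XT]) auto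
  have "P.prob E3 = measure (gauss (real T)) (supball (0::real^'n) K)"
    using increment_law[of 0 "real T" 0] T(1) unfolding E3_def by (subst measure_distr[symmetric, OF XT]) auto
  also have "\<dots> \<le> \<epsilon> / 2"
  proof (rule order_trans[OF gauss_box_bound T(2)])
    show "0 \<le> K" using \<rho>(1) by (simp add: K_def)
  qed (use T in simp)
  finally have E3': "P.prob E3 \<le> \<epsilon> / 2" .
  have sub: "{\<omega>\<in>space (M 0). \<forall>s\<ge>0. X 0 s \<omega> \<notin> A} \<subseteq> E1 \<union> (E2 \<union> E3)"
  proof
    fix \<omega> assume "\<omega> \<in> {\<omega>\<in>space (M 0). \<forall>s\<ge>0. X 0 s \<omega> \<notin> A}"
    then have \<omega>: "\<omega> \<in> space (M 0)" "\<And>s. 0 \<le> s \<Longrightarrow> X 0 s \<omega> \<notin> A" by auto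
    show "\<omega> \<in> E1 \<union> (E2 \<union> E3)"
    proof (rule ccontr)
      assume not: "\<omega> \<notin> E1 \<union> (E2 \<union> E3)"
      define Y where "Y = walk 0 (steps 0 \<delta> m \<omega>)"
      have Y: "Y k = X 0 (real k * \<delta>) \<omega>" if "k \<le> m" for k unfolding Y_def by (rule walk_steps[OF \<omega>(1) that])
      have Ym: "Y m \<notin> supball 0 K"
        using not \<omega>(1) X_0[OF \<omega>(1)] by (auto simp: E3_def Y m(2))
      have YA: "Y k \<notin> A" if "k \<le> m" for k using \<omega>(2)[of "real k * \<delta>"] \<delta> by (simp add: Y[OF that])
      \<comment> \<open>At the origin the density is at most 1/2 because \<open>l i\<close> is at
        least \<open>lstar\<close>; at the final position it is 1; short steps change it by at most
        \<open>tol J\<close>. So every trial starts.\<close>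
      have "\<exists>k\<le>m. Y k \<in> balanced U0 (l i) (tol J)" if i: "i < I" for i
        unfolding balanced_def mem_Collect_eq
      proof (rule discrete_crossing[of "\<lambda>k. sigma_hat U0 (int (l i)) (Y k)"])
        show "sigma_hat U0 (int (l i)) (Y 0) \<le> 1 / 2"
          using half[of "l i"] ell0_props(2)[OF L0, of lstar J] by (simp add: Y_def walk_def l_def block_def)
        show "1 / 2 \<le> sigma_hat U0 (int (l i)) (Y m)" using far_hat[OF Ym] by simp
        show "\<bar>sigma_hat U0 (int (l i)) (Y (Suc k)) - sigma_hat U0 (int (l i)) (Y k)\<bar> \<le> tol J" if "k < m" for k
        proof -
          have "inc k \<omega> \<in> supball 0 e" using not \<omega>(1) that by (auto simp: E2_def)
          moreover have "Y (Suc k) = Y k + inc k \<omega>" using that by (simp add: Y inc_def del: of_nat_Suc)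
          ultimately show ?thesis using e(2)[OF i, of 0 "inc k \<omega>" "Y k"] J by simp
        qed
      qed (use tol in simp)
      moreover have "g i (Y m) = 0" for i
        using hit_outside[OF gm YA[OF order_refl] far[OF Ym]] by (simp add: g_def)
      ultimately have "\<omega> \<in> E1" using YA \<omega>(1) by (auto simp: E1_def Q_def Y_def)
      with not show False by simp
    qed
  qed
  have "nohit_prob M X A 0 \<le> P.prob (E1 \<union> (E2 \<union> E3))"
    unfolding nohit_prob_def using E1 E2 E3 by (intro P.finite_measure_mono sub) auto
  also have "\<dots> \<le> P.prob E1 + P.prob (E2 \<union> E3)"
    using E1 E2 E3 by (intro measure_Un_le) auto
  also have "P.prob (E2 \<union> E3) \<le> P.prob E2 + P.prob E3"
    using E2 E3 by (intro measure_Un_le) auto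
  finally show ?thesis using E1' E2' E3' by (simp add: A_def p_def)
qed

end

section \<open>Translation invariance\<close>

lemma dyadic_floor_LIMSEQ:
  fixes s :: real
  assumes "0 \<le> s"
  shows "(\<lambda>n. real (nat \<lfloor>s * 4 ^ n\<rfloor>) * (1 / 4 ^ n)) \<longlonglongrightarrow> s"
proof -
  have le: "real (nat \<lfloor>s * 4 ^ n\<rfloor>) * (1 / 4 ^ n) \<le> s" for n
    using assms of_int_floor_le[of "s * 4 ^ n"] by (simp add: field_simps)
  have ge: "s - (1 / 4) ^ n \<le> real (nat \<lfloor>s * 4 ^ n\<rfloor>) * (1 / 4 ^ n)" for n
  proof -
    have "s * 4 ^ n - 1 \<le> real (nat \<lfloor>s * 4 ^ n\<rfloor>)" using assms by linarith
    then have "(s * 4 ^ n - 1) * (1 / 4 ^ n) \<le> real (nat \<lfloor>s * 4 ^ n\<rfloor>) * (1 / 4 ^ n)"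
      by (intro mult_right_mono) auto
    then show ?thesis by (simp add: diff_divide_distrib power_one_over)
  qed
  show ?thesis
  proof (rule tendsto_sandwich)
    show "\<forall>\<^sub>F n in sequentially. s - (1 / 4) ^ n \<le> real (nat \<lfloor>s * 4 ^ n\<rfloor>) * (1 / 4 ^ n)"
      by (rule always_eventually, rule allI, rule ge)
    show "\<forall>\<^sub>F n in sequentially. real (nat \<lfloor>s * 4 ^ n\<rfloor>) * (1 / 4 ^ n) \<le> s"
      by (rule always_eventually, rule allI, rule le)
    have "(\<lambda>n. (1 / 4 :: real) ^ n) \<longlonglongrightarrow> 0" by (rule LIMSEQ_power_zero) simp
    from tendsto_diff[OF tendsto_const[of s] this]
    show "(\<lambda>n. s - (1 / 4) ^ n) \<longlonglongrightarrow> s" by simp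
  qed (rule tendsto_const)
qed

text \<open>A positive gap with a non-strict inequality: the set is closed, so membership at dyadic
  times passes to limits.\<close>

definition away :: "'a::metric_space set \<Rightarrow> nat \<Rightarrow> 'a set" where
  "away F k = {z. \<forall>y\<in>F. 1 / real (Suc k) \<le> dist z y}"

lemma closed_away: "closed (away F k)"
proof -
  have "away F k = (\<Inter>y\<in>F. {z. 1 / real (Suc k) \<le> dist z y})" by (auto simp: away_def)
  then show ?thesis by (auto intro!: closed_INT closed_Collect_le continuous_intros)
qed

lemma away_mono:
  assumes "k \<le> k'" shows "away F k \<subseteq> away F k'"
proof -
  have "1 / real (Suc k') \<le> 1 / real (Suc k)" using assms by (intro divide_left_mono) auto
  then show ?thesis unfolding away_def by (blast intro: order_trans)
qed

context brownian
begin

definition grid_away :: "real^'n \<Rightarrow> (real^'n) set \<Rightarrow> nat \<Rightarrow> nat \<Rightarrow> nat \<Rightarrow> 'w set" where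
  "grid_away x F m k n = {\<omega>\<in>space (M x). \<forall>j\<le>Suc m * 4 ^ n. X x (real j * (1 / 4 ^ n)) \<omega> \<in> away F k}"

lemma grid_away_measurable [measurable]: "grid_away x F m k n \<in> sets (M x)"
proof -
  have [measurable]: "away F k \<in> sets borel" by (intro borel_closed closed_away)
  have "Measurable.pred (M x) (\<lambda>\<omega>. \<forall>j\<in>{..Suc m * 4 ^ n}. X x (real j * (1 / 4 ^ n)) \<omega> \<in> away F k)"
  proof (rule pred_intros_finite)
    fix j
    have [measurable]: "X x (real j * (1 / 4 ^ n)) \<in> borel_measurable (M x)" by (rule X_measurable) simp
    show "Measurable.pred (M x) (\<lambda>\<omega>. X x (real j * (1 / 4 ^ n)) \<omega> \<in> away F k)" by measurable
  qed simp
  then show ?thesis by (simp add: pred_def grid_away_def Ball_def)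
qed

lemma decseq_grid_away: "decseq (grid_away x F m k)"
proof (intro decseq_SucI subsetI)
  fix n \<omega> assume *: "\<omega> \<in> grid_away x F m k (Suc n)"
  show "\<omega> \<in> grid_away x F m k n"
    unfolding grid_away_def
  proof (intro CollectI conjI allI impI)
    show "\<omega> \<in> space (M x)" using * by (simp add: grid_away_def)
    fix j assume "j \<le> Suc m * 4 ^ n"
    then have "4 * j \<le> Suc m * 4 ^ Suc n" by simp
    then have "X x (real (4 * j) * (1 / 4 ^ Suc n)) \<omega> \<in> away F k" using * unfolding grid_away_def by blast
    then show "X x (real j * (1 / 4 ^ n)) \<omega> \<in> away F k" by simp
  qed
qed

lemma incseq_Inter_grid_away: "incseq (\<lambda>k. \<Inter>n. grid_away x F m k n)"
proof (intro incseq_SucI INF_mono')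
  fix k n
  show "grid_away x F m k n \<subseteq> grid_away x F m (Suc k) n"
    unfolding grid_away_def using away_mono[of k "Suc k" F] by auto
qed

lemma decseq_Union_grid_away: "decseq (\<lambda>m. \<Union>k. \<Inter>n. grid_away x F m k n)"
proof (intro decseq_SucI subsetI)
  fix m \<omega> assume "\<omega> \<in> (\<Union>k. \<Inter>n. grid_away x F (Suc m) k n)"
  then obtain k where k: "\<And>n. \<omega> \<in> grid_away x F (Suc m) k n" by auto
  have "\<omega> \<in> grid_away x F m k n" for n
    using k[of n] unfolding grid_away_def by (auto intro: order_trans[OF _ mult_le_mono1])
  then show "\<omega> \<in> (\<Union>k. \<Inter>n. grid_away x F m k n)" by auto
qed

text \<open>On a compact time interval the path keeps a positive distance from the closed set;
  conversely, dyadic times determine a continuous path. The result is built from grid events that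
  are monotone in each of the three indices.\<close>

lemma nohit_eq_grid_away:
  assumes "closed F"
  shows "{\<omega>\<in>space (M x). \<forall>s\<ge>0. X x s \<omega> \<notin> F} = (\<Inter>m. \<Union>k. \<Inter>n. grid_away x F m k n)"
proof (intro equalityI subsetI)
  fix \<omega> assume "\<omega> \<in> {\<omega>\<in>space (M x). \<forall>s\<ge>0. X x s \<omega> \<notin> F}"
  then have \<omega>: "\<omega> \<in> space (M x)" "\<And>s. 0 \<le> s \<Longrightarrow> X x s \<omega> \<notin> F" by auto
  have "\<exists>k. \<forall>n. \<omega> \<in> grid_away x F m k n" for m
  proof -
    let ?K = "(\<lambda>t. X x t \<omega>) ` {0..real (Suc m)}"
    have "compact ?K"
      by (rule compact_continuous_image[OF continuous_on_subset[OF X_continuous[OF \<omega>(1)]]]) auto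
    moreover have "?K \<inter> F = {}" using \<omega>(2) by auto
    ultimately obtain d where d: "0 < d" "\<And>z y. z \<in> ?K \<Longrightarrow> y \<in> F \<Longrightarrow> d \<le> dist z y"
      using separate_compact_closed[of ?K F] assms by blast
    obtain k where "1 / real (Suc k) < d" using nat_approx_posE[OF d(1)] .
    then have k: "z \<in> away F k" if "z \<in> ?K" for z using d(2)[OF that] by (fastforce simp: away_def)
    have "\<omega> \<in> grid_away x F m k n" for n
      unfolding grid_away_def
    proof (intro CollectI conjI allI impI \<omega>(1) k imageI)
      fix j assume "j \<le> Suc m * 4 ^ n"
      then have "real j \<le> real (Suc m * 4 ^ n)" by (simp only: of_nat_le_iff)
      then show "real j * (1 / 4 ^ n) \<in> {0..real (Suc m)}" by (simp add: pos_divide_le_eq distrib_right)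
    qed
    then show ?thesis by auto
  qed
  then show "\<omega> \<in> (\<Inter>m. \<Union>k. \<Inter>n. grid_away x F m k n)" by auto
next
  fix \<omega> assume *: "\<omega> \<in> (\<Inter>m. \<Union>k. \<Inter>n. grid_away x F m k n)"
  have "\<omega> \<in> (\<Union>k. \<Inter>n. grid_away x F 0 k n)" using * by (rule INT_D) simp
  then have sp: "\<omega> \<in> space (M x)" by (auto simp: grid_away_def)
  moreover have "X x s \<omega> \<notin> F" if s: "0 \<le> s" for s
  proof -
    obtain m :: nat where m: "s \<le> real m" using real_arch_simple by blast
    from * have "\<omega> \<in> (\<Union>k. \<Inter>n. grid_away x F m k n)" by (rule INT_D) simp
    then obtain k where k: "\<And>n. \<omega> \<in> grid_away x F m k n" by auto
    define t where "t = (\<lambda>n. real (nat \<lfloor>s * 4 ^ n\<rfloor>) * (1 / 4 ^ n))"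
    have t: "t \<longlonglongrightarrow> s" unfolding t_def by (rule dyadic_floor_LIMSEQ[OF s])
    have t_ge: "0 \<le> t n" for n unfolding t_def by (intro mult_nonneg_nonneg) auto
    have mem: "X x (t n) \<omega> \<in> away F k" for n
    proof -
      have "real (nat \<lfloor>s * 4 ^ n\<rfloor>) \<le> s * 4 ^ n" using s by (intro of_nat_floor) simp
      also have "\<dots> \<le> real (Suc m) * 4 ^ n" using m by (intro mult_right_mono) auto
      finally have "real (nat \<lfloor>s * 4 ^ n\<rfloor>) \<le> real (Suc m * 4 ^ n)" by (simp add: distrib_right)
      then have "nat \<lfloor>s * 4 ^ n\<rfloor> \<le> Suc m * 4 ^ n" by (simp only: of_nat_le_iff)
      then show ?thesis using k[of n] unfolding grid_away_def t_def by blast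
    qed
    have "(\<lambda>n. X x (t n) \<omega>) \<longlonglongrightarrow> X x s \<omega>"
      using continuous_on_tendsto_compose[OF X_continuous[OF sp] t] s t_ge by (simp add: always_eventually)
    with closed_away[of F k] mem have "X x s \<omega> \<in> away F k" by (rule closed_sequentially)
    then show ?thesis by (auto simp: away_def)
  qed
  ultimately show "\<omega> \<in> {\<omega>\<in>space (M x). \<forall>s\<ge>0. X x s \<omega> \<notin> F}" by simp
qed

text \<open>For different starting points only the laws on time grids can be compared. Equality is
  carried from there through three monotone limits, in \<open>n\<close>, then \<open>k\<close>, then
  \<open>m\<close>.\<close>

lemma nohit_prob_translate:
  assumes "closed F"
  shows "nohit_prob M X ((+) x ` F) x = nohit_prob M X F 0"
proof -
  let ?F = "(+) x ` F"
  interpret Px: prob_space "M x" by (rule prob_space_M)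
  interpret P0: prob_space "M 0" by (rule prob_space_M)
  have tr: "away ?F k = (\<lambda>y. x - 0 + y) ` away F k" for k
  proof (intro equalityI subsetI)
    fix z assume z: "z \<in> away ?F k"
    have "z - x \<in> away F k"
      using z unfolding away_def by (auto simp: dist_norm algebra_simps)
    then show "z \<in> (\<lambda>y. x - 0 + y) ` away F k" by (intro image_eqI[of _ _ "z - x"]) auto
  qed (auto simp: away_def dist_norm)
  have 1: "Px.prob (grid_away x ?F m k n) = P0.prob (grid_away 0 F m k n)" for m k n
    unfolding grid_away_def
    by (rule grid_event_translate[OF _ _ _ tr]) (use closed_away[of F k] in auto)
  have sm[measurable]: "grid_away y G m k n \<in> sets (M y)" for y G m k n by (rule grid_away_measurable)
  have 2: "Px.prob (\<Inter>n. grid_away x ?F m k n) = P0.prob (\<Inter>n. grid_away 0 F m k n)" for m k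
  proof (rule LIMSEQ_unique)
    show "(\<lambda>n. Px.prob (grid_away x ?F m k n)) \<longlonglongrightarrow> Px.prob (\<Inter>n. grid_away x ?F m k n)"
      by (intro Px.finite_Lim_measure_decseq decseq_grid_away) auto
    show "(\<lambda>n. Px.prob (grid_away x ?F m k n)) \<longlonglongrightarrow> P0.prob (\<Inter>n. grid_away 0 F m k n)"
      unfolding 1 by (intro P0.finite_Lim_measure_decseq decseq_grid_away) auto
  qed
  have 3: "Px.prob (\<Union>k. \<Inter>n. grid_away x ?F m k n) = P0.prob (\<Union>k. \<Inter>n. grid_away 0 F m k n)" for m
  proof (rule LIMSEQ_unique)
    show "(\<lambda>k. Px.prob (\<Inter>n. grid_away x ?F m k n)) \<longlonglongrightarrow> Px.prob (\<Union>k. \<Inter>n. grid_away x ?F m k n)"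
      by (intro Px.finite_Lim_measure_incseq incseq_Inter_grid_away) auto
    show "(\<lambda>k. Px.prob (\<Inter>n. grid_away x ?F m k n)) \<longlonglongrightarrow> P0.prob (\<Union>k. \<Inter>n. grid_away 0 F m k n)"
      unfolding 2 by (intro P0.finite_Lim_measure_incseq incseq_Inter_grid_away) auto
  qed
  have "Px.prob (\<Inter>m. \<Union>k. \<Inter>n. grid_away x ?F m k n) = P0.prob (\<Inter>m. \<Union>k. \<Inter>n. grid_away 0 F m k n)"
  proof (rule LIMSEQ_unique)
    show "(\<lambda>m. Px.prob (\<Union>k. \<Inter>n. grid_away x ?F m k n)) \<longlonglongrightarrow> Px.prob (\<Inter>m. \<Union>k. \<Inter>n. grid_away x ?F m k n)"
      by (intro Px.finite_Lim_measure_decseq decseq_Union_grid_away) auto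
    show "(\<lambda>m. Px.prob (\<Union>k. \<Inter>n. grid_away x ?F m k n)) \<longlonglongrightarrow> P0.prob (\<Inter>m. \<Union>k. \<Inter>n. grid_away 0 F m k n)"
      unfolding 3 by (intro P0.finite_Lim_measure_decseq decseq_Union_grid_away) auto
  qed
  then show ?thesis
    unfolding nohit_prob_def nohit_eq_grid_away[OF assms] nohit_eq_grid_away[OF closed_translation[OF assms]] .
qed

end

section \<open>Translation of densities, resonance sets and admissible sets\<close>

lemma supball_translate: "supball (v + x) r = (+) v ` supball x r"
proof (intro equalityI subsetI)
  fix z assume "z \<in> supball (v + x) r"
  then show "z \<in> (+) v ` supball x r"
    by (intro image_eqI[of _ _ "z - v"]) (auto simp: supball_def algebra_simps)
qed (auto simp: supball_def)

lemma Compl_translate: "- ((+) v ` U) = (+) v ` (- U)" for v :: "'a::group_add"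
  by (rule bij_image_Compl_eq[symmetric]) (rule bij_plus)

lemma measure_translate_Int:
  "measure lebesgue (supball (v + x) r \<inter> - ((+) v ` U)) = measure lebesgue (supball x r \<inter> - U)"
  unfolding supball_translate Compl_translate
  by (subst image_Int[symmetric]) (auto simp: measure_translation)

lemma sigma_hat_translate: "sigma_hat ((+) v ` U) l (v + x) = sigma_hat U l x"
  by (simp only: sigma_hat_def measure_translate_Int) (simp only: supball_translate measure_translation)

lemma sigma_tilde_translate: "sigma_tilde ((+) v ` U) l (v + x) = sigma_tilde U l x"
  by (simp only: sigma_tilde_def measure_translate_Int) (simp only: supball_translate measure_translation)

lemma Res_translate: "Res ((+) v ` U) lstar J L I = (+) v ` Res U lstar J L I"
proof (intro equalityI subsetI)
  fix z assume "z \<in> Res ((+) v ` U) lstar J L I"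
  then have "v + (z - v) \<in> Res ((+) v ` U) lstar J L I" by simp
  then have "z - v \<in> Res U lstar J L I" unfolding Res_def mem_Collect_eq sigma_tilde_translate .
  then show "z \<in> (+) v ` Res U lstar J L I" by (intro image_eqI[of _ _ "z - v"]) auto
qed (auto simp: Res_def sigma_tilde_translate)

text \<open>Of the conditions on \<open>A\<close> only the one at the point \<open>x\<close> is
  kept, and it becomes the condition at the origin.\<close>

lemma Ucal_translate:
  assumes "U \<in> Ucal lstar A" "x \<in> A"
  shows "(+) (- x) ` U \<in> Ucal lstar {0}"
proof -
  have "(+) (- x) ` U = (+) x -` U \<inter> space borel"
  proof (intro equalityI subsetI)
    fix z assume "z \<in> (+) x -` U \<inter> space borel"
    then show "z \<in> (+) (- x) ` U" by (intro image_eqI[of _ _ "x + z"]) auto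
  qed auto
  also have "\<dots> \<in> sets borel"
    by (rule measurable_sets[of "(+) x" borel borel]) (use assms(1) in \<open>auto simp: Ucal_def\<close>)
  finally have "(+) (- x) ` U \<in> sets borel" .
  moreover have "sigma_hat ((+) (- x) ` U) l 0 \<le> 1 / 2" if "int lstar \<le> l" for l
  proof -
    have "sigma_hat ((+) (- x) ` U) l 0 = sigma_hat U l x"
      using sigma_hat_translate[of "- x" U l x] by (simp only: left_minus)
    also have "\<dots> \<le> 1 / 2" using assms that unfolding Ucal_def by blast
    finally show ?thesis .
  qed
  moreover have "U \<noteq> {}" "bounded U" using assms(1) unfolding Ucal_def by blast+
  ultimately show ?thesis using bounded_translation[of U "- x"] unfolding Ucal_def by blast
qed

text \<open>A supremum of reals needs a nonempty set. A box around the unit neighbourhood of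
  \<open>A\<close> works: balls of radius at most 1 around points of \<open>A\<close> do not meet
  its complement.\<close>

lemma Ucal_nonempty:
  fixes A :: "(real^'n) set"
  assumes "bounded A" shows "Ucal 0 A \<noteq> {}"
proof -
  obtain \<rho> where \<rho>: "0 < \<rho>" "A \<subseteq> supball 0 \<rho>" using bounded_subset_supball[OF assms] .
  define U :: "(real^'n) set" where "U = supball 0 (\<rho> + 1)"
  have "sigma_hat U l x \<le> 1 / 2" if "x \<in> A" "0 \<le> l" for x l
  proof -
    have "2 powr (- real_of_int l) \<le> (1::real)" using powr_mono[of "- real_of_int l" 0 2] that by simp
    then have "supball x (2 powr (- real_of_int l)) \<subseteq> U"
      using supball_trans[of x 0 \<rho>] \<rho>(2) that(1) unfolding U_def by (meson add_left_mono subsetI subset_iff supball_mono)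
    then have "supball x (2 powr (- real_of_int l)) \<inter> - U = {}" by auto
    then show ?thesis by (simp add: sigma_hat_def)
  qed
  moreover have "0 \<in> U" using \<rho>(1) by (simp add: U_def supball_def)
  moreover have "bounded U" by (simp add: U_def supball_eq_cbox bounded_cbox)
  ultimately have "U \<in> Ucal 0 A" by (auto simp: Ucal_def U_def)
  then show ?thesis by auto
qed

section \<open>Suprema over all configurations, and the rate in \<open>I\<close>\<close>

context brownian
begin

definition Phi_values :: "nat \<Rightarrow> nat \<Rightarrow> (real^'n) set \<Rightarrow> real set" where
  "Phi_values J I A = {nohit_prob M X (Res U0 lstar J L I) x | lstar U0 L x.
       U0 \<in> Ucal lstar A \<and> L \<ge> LJ CARD('n) J \<and> x \<in> A}"

lemma Phi_eq: "Phi M X J I A = Sup (Phi_values J I A)"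
  by (simp add: Phi_def Phi_values_def)

lemma Phi_values_bounds:
  assumes "v \<in> Phi_values J I A" shows "0 \<le> v" "v \<le> 1"
  using assms prob_space.prob_le_1[OF prob_space_M] by (auto simp: Phi_values_def nohit_prob_def)

lemma bdd_above_Phi_values: "bdd_above (Phi_values J I A)"
  using Phi_values_bounds by (intro bdd_aboveI[of _ 1]) auto

lemma Phi_values_nonempty:
  assumes "bounded A" "A \<noteq> {}" shows "Phi_values J I A \<noteq> {}"
  using Ucal_nonempty[OF assms(1)] assms(2) unfolding Phi_values_def by blast

lemma Phi_le_Phi_origin:
  assumes "compact A" "A \<noteq> {}"
  shows "Phi M X J I A \<le> Phi M X J I {0}"
  unfolding Phi_eq
proof (rule cSup_subset_mono)
  show "Phi_values J I A \<noteq> {}" using assms by (intro Phi_values_nonempty compact_imp_bounded)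
  show "bdd_above (Phi_values J I {0})" by (rule bdd_above_Phi_values)
  show "Phi_values J I A \<subseteq> Phi_values J I {0}"
  proof
    fix v assume "v \<in> Phi_values J I A"
    then obtain lstar U0 L x where v: "v = nohit_prob M X (Res U0 lstar J L I) x"
      and U0: "U0 \<in> Ucal lstar A" "LJ CARD('n) J \<le> L" "x \<in> A" unfolding Phi_values_def by blast
    define U where "U = (+) (- x) ` U0"
    have U: "U \<in> Ucal lstar {0}" unfolding U_def using U0(1,3) by (rule Ucal_translate)
    have "U0 = (+) x ` U" by (simp add: U_def image_image)
    then have "v = nohit_prob M X ((+) x ` Res U lstar J L I) x" unfolding v by (simp only: Res_translate)
    also have "\<dots> = nohit_prob M X (Res U lstar J L I) 0"
      using U by (intro nohit_prob_translate closed_Res) (auto simp: Ucal_def)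
    finally show "v \<in> Phi_values J I {0}" using U U0(2) unfolding Phi_values_def by blast
  qed
qed

lemma Phi_origin_nonneg: "0 \<le> Phi M X J I {0}"
proof -
  obtain v where v: "v \<in> Phi_values J I {0}" using Phi_values_nonempty[of "{0}" J I] by auto
  then show ?thesis
    unfolding Phi_eq by (rule order_trans[OF Phi_values_bounds(1) cSup_upper[OF _ bdd_above_Phi_values]]) (rule v)+
qed

lemma Phi_origin_le:
  assumes "1 \<le> J"
  shows "Phi M X J I {0} \<le> (1 - step_prob CARD('n) J ^ J / real J) ^ I"
  unfolding Phi_eq
proof (rule cSup_least)
  show "Phi_values J I {0} \<noteq> {}" by (rule Phi_values_nonempty) auto
  fix v assume "v \<in> Phi_values J I {0}"
  then obtain lstar U0 L where v: "v = nohit_prob M X (Res U0 lstar J L I) 0"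
    and U0: "U0 \<in> Ucal lstar {0}" "LJ CARD('n) J \<le> L" unfolding Phi_values_def by blast
  show "v \<le> (1 - step_prob CARD('n) J ^ J / real J) ^ I"
    unfolding v by (rule field_le_epsilon) (rule avoid_Res_bound_approx[OF U0 assms])
qed

end

text \<open>The total exponent \<open>1 - 1 / 2 ^ (J - 1)\<close> of \<open>I\<close> is
  nonnegative, so the power of \<open>I\<close> is at least 1 and multiplies a negative logarithm.
  For \<open>y = 0\<close> the left side is minus infinity.\<close>

lemma eln_scaled_le:
  assumes "0 \<le> y" "y \<le> (1 - c) ^ I" "0 < c" "c < 1" "1 \<le> I"
  shows "ereal (real I powr (- 1 / 2 ^ (J - 1))) * eln y \<le> ereal (ln (1 - c))"
proof (cases "y = 0")
  case True
  then show ?thesis using assms by (simp add: eln_def)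
next
  case False
  define e :: real where "e = - 1 / 2 ^ (J - 1)"
  have e: "- 1 \<le> e" by (simp add: e_def)
  have ln: "ln (1 - c) \<le> 0" using assms by simp
  have "ln y \<le> ln ((1 - c) ^ I)" using False assms by (subst ln_le_cancel_iff) auto
  also have "\<dots> = real I * ln (1 - c)" using assms by (simp add: ln_realpow)
  finally have "real I powr e * ln y \<le> real I powr e * (real I * ln (1 - c))" by (intro mult_left_mono) auto
  also have "\<dots> = real I powr (e + 1) * ln (1 - c)" using assms by (simp add: powr_add)
  also have "\<dots> \<le> 1 * ln (1 - c)"
    using e assms ln by (intro mult_right_mono_neg ge_one_powr_ge_zero) auto
  finally show ?thesis using False by (simp add: eln_def e_def)
qed

theorem theorem2p1:
  fixes M :: "real^'n \<Rightarrow> 'w measure" and X :: "real^'n \<Rightarrow> real \<Rightarrow> 'w \<Rightarrow> real^'n"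
  assumes "CARD('n) \<ge> 3"
  shows "(BM_family M X \<longrightarrow> (\<forall>J I (A::(real^'n) set). J \<ge> 1 \<and> I \<ge> 1 \<and> compact A \<and> A \<noteq> {} \<longrightarrow>
             Phi M X J I A \<le> Phi M X J I {0}))
      \<and> (\<forall>J::nat. J \<ge> 1 \<longrightarrow> (\<exists>c2::real. 0 < c2 \<and> c2 < 1 \<and>
           (\<forall>(M'::real^'n \<Rightarrow> 'w measure) X'. BM_family M' X' \<longrightarrow>
              limsup (\<lambda>I::nat. ereal (real I powr (- 1 / 2 ^ (J - 1))) * eln (Phi M' X' J I {0}))
                \<le> ereal (ln (1 - c2)))))"
proof (intro conjI impI allI)
  fix J I :: nat and A :: "(real^'n) set"
  assume "BM_family M X" and A: "J \<ge> 1 \<and> I \<ge> 1 \<and> compact A \<and> A \<noteq> {}"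
  then interpret brownian M X by unfold_locales
  show "Phi M X J I A \<le> Phi M X J I {0}" using A by (intro Phi_le_Phi_origin) auto
next
  fix J :: nat assume J: "J \<ge> 1"
  \<comment> \<open>Fixed before any Brownian family is chosen; it depends on the dimension and
    \<open>J\<close> only.\<close>
  define c where "c = step_prob CARD('n) J ^ J / real J"
  have p: "0 < step_prob CARD('n) J" "step_prob CARD('n) J < 1" using step_prob[OF J] by auto
  have "step_prob CARD('n) J ^ J < 1" using p J by (simp add: power_less_one_iff)
  then have c: "0 < c" "c < 1" using p J by (auto simp: c_def divide_less_eq)
  have "limsup (\<lambda>I::nat. ereal (real I powr (- 1 / 2 ^ (J - 1))) * eln (Phi M' X' J I {0})) \<le> ereal (ln (1 - c))"
    if "BM_family M' X'" for M' :: "real^'n \<Rightarrow> 'w measure" and X'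
  proof -
    interpret brownian M' X' using that by unfold_locales
    show ?thesis
    proof (rule Limsup_bounded)
      show "\<forall>\<^sub>F I in sequentially. ereal (real I powr (- 1 / 2 ^ (J - 1))) * eln (Phi M' X' J I {0}) \<le> ereal (ln (1 - c))"
        using eventually_ge_at_top[of 1]
      proof eventually_elim
        case (elim I)
        then show ?case using Phi_origin_nonneg Phi_origin_le[OF J] c by (intro eln_scaled_le) (auto simp: c_def)
      qed
    qed
  qed
  then show "\<exists>c2::real. 0 < c2 \<and> c2 < 1 \<and>
           (\<forall>(M'::real^'n \<Rightarrow> 'w measure) X'. BM_family M' X' \<longrightarrow>
              limsup (\<lambda>I::nat. ereal (real I powr (- 1 / 2 ^ (J - 1))) * eln (Phi M' X' J I {0}))
                \<le> ereal (ln (1 - c2)))"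
    using c by blast
qed

end
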